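(* Let $(\Sigma,m)$ be a weighted simplicial complex. The following assertions are equivalent: (i) $\delta_D$ is an ideal boundary condition on $(\Sigma,m)$. (ii) $\partial\partial_N=0$, i.e. $\partial(\partial_N\omega)=0$ for all $\omega\in D(\partial_N)$. Moreover, if for all $\rho\in\Sigma$ all connected components of the graph $b_\rho$ over $\mathrm{lk}(\rho)$ are recurrent, then $\delta_D$ is an ideal boundary condition on $(\Sigma,m)$.
   Context: Weighted simplicial complexes. Let $X$ be a set (of vertices). A simplicial complex $\hat\Sigma$ over $X$ is a (non-empty) set of finite subsets of $X$ closed under taking subsets, whose $0$-simplices are identified with $X$; it contains $\varnothing$. A simplex with $k+1$ elements has dimension $k$. Write $\tau\prec\sigma$ (or $\sigma\succ\tau$) if $\tau\subseteq\sigma$ and $|\sigma\setminus\tau|=1$; then $\tau$ is a face of $\sigma$ and $\sigma$ a coface of $\tau$. Let $m:\hat\Sigma\to(0,\infty)$. Put $\Sigma=\hat\Sigma$ if $\sum_{x\in X}m(x)<\infty$ and $\Sigma=\hat\Sigma\setminus\{\varnothing\}$ otherwise. Assume $m$ is locally summable: $\sum_{\sigma\succ\tau}m(\sigma)<\infty$ for all $\tau\in\Sigma$. Then $(\Sigma,m)$ is called a weighted simplicial complex; no local finiteness is assumed. All simplices below range over $\Sigma$. $C(\Sigma)$ denotes the complex functions on $\Sigma$, $C_c(\Sigma)$ those of finite support, and $\ell^2=\ell^2(\Sigma,m)$ is the Hilbert space with inner product $\langle f,g\rangle=\sum_{\tau\in\Sigma} m(\tau)f(\tau)\overline{g(\tau)}$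 and norm $\|\cdot\|_2$. Coboundary and boundary. Fix a coboundary operator, i.e. a linear operator $\delta:C(\Sigma)\to C(\Sigma)$ of the form $\delta\omega(\sigma)=\sum_{\tau\prec\sigma}\theta(\tau,\sigma)\omega(\tau)$ (a finite sum) with $\theta(\tau,\sigma)=\delta 1_\tau(\sigma)\in\{\pm1\}$ for $\tau\prec\sigma$, satisfying $\delta\delta=0$. The boundary operator $\partial:D(\partial)\to C(\Sigma)$ is $$\partial\omega(\rho)=\frac1{m(\rho)}\sum_{\tau\succ\rho}m(\tau)\theta(\rho,\tau)\omega(\tau),\qquad D(\partial)=\Big\{\omega\in C(\Sigma):\sum_{\tau\succ\rho}m(\tau)|\omega(\tau)|<\infty\text{ for all }\rho\in\Sigma\Big\}.$$ One has $\ell^2\subseteq D(\partial)$. Boundary conditions. $\partial_N$ is the restriction of $\partial$ to $D(\partial_N)=\{\omega\in\ell^2:\partial\omega\in\ell^2\}$. $\delta_N$ is the restriction of $\delta$ to $D(\delta_N)=\{\omega\in\ell^2:\delta\omega\in\ell^2\}$. $\delta_D$ is the restriction of $\delta$ to $D(\delta_D)=\{\omega\in\ell^2:\lim_n(\|\omega_n-\omega\|_2^2+\|\delta(\omega_n-\omega)\|_2^2)=0\text{ for some }\omega_n\in C_c(\Sigma)\}$. These are closed densely defined operators on $\ell^2$. An ideal boundary condition on $(\Sigma,m)$ is a closed operator $\delta_I$ with $\delta_D\subseteq\delta_I\subseteq\delta_N$ (inclusion of operators) and $\mathrm{range}(\delta_I)\subseteq D(\delta_I)$. Links. For $\rho\in\Sigma$,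 $\mathrm{lk}(\rho)=\{v\in X: v\cup\rho\in\Sigma,\ v\cup\rho\succ\rho\}$ (identifying the vertex $v$ with $\{v\}$), with $v\rho=v\cup\rho$ and $vv'\rho=v\cup v'\cup\rho$. The link graph is the symmetric function $b_\rho:\mathrm{lk}(\rho)\times\mathrm{lk}(\rho)\to[0,\infty)$, $b_\rho(v,v')=m(vv'\rho)$ if $v\ne v'$ and $vv'\rho\in\Sigma$, and $b_\rho(v,v')=0$ otherwise. Local summability gives $\sum_{v'}b_\rho(v,v')<\infty$ for all $v\in\mathrm{lk}(\rho)$. Connected components are the classes of vertices joined by finite paths along which $b_\rho>0$. Recurrence. A connected graph $b$ over $X$ is recurrent if the Markov chain $(Y_n)$ with transition probabilities $\mathbb P(Y_n=y\mid Y_{n-1}=x)=b(x,y)/\sum_z b(x,z)$ satisfies $\mathbb P(Y_k=y\text{ for some }k>0\mid Y_0=x)=1$ for all $x,y$; equivalently, the constant function $1$ is a pointwise limit of finitely supported functions $\varphi_n$ with $\frac12\sum_{x,y}b(x,y)|\varphi_n(x)-\varphi_n(y)|^2\to0$. A component consisting of a single vertex counts as recurrent. *)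

theory Defs
  imports "HOL-Probability.Probability"
begin

section \<open>Weighted simplicial complexes\<close>

definition simplicial_complex :: "'v set \<Rightarrow> 'v set set \<Rightarrow> bool" where
  "simplicial_complex X K \<longleftrightarrow>
     K \<noteq> {} \<and> (\<forall>\<sigma>\<in>K. finite \<sigma> \<and> \<sigma> \<subseteq> X) \<and> (\<forall>\<sigma>\<in>K. \<forall>\<tau>. \<tau> \<subseteq> \<sigma> \<longrightarrow> \<tau> \<in> K) \<and> (\<forall>v\<in>X. {v} \<in> K)"

definition face :: "'v set \<Rightarrow> 'v set \<Rightarrow> bool" where
  "face \<tau> \<sigma> \<longleftrightarrow> \<tau> \<subseteq> \<sigma> \<and> card (\<sigma> - \<tau>) = 1"

(* The set \<Sigma> obtained from K = \<Sigma>-hat: the empty simplex is kept iff the total vertex weight is finite. *)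
definition simplices :: "'v set \<Rightarrow> 'v set set \<Rightarrow> ('v set \<Rightarrow> real) \<Rightarrow> 'v set set" where
  "simplices X K m = (if (\<lambda>v. m {v}) summable_on X then K else K - {{}})"

definition weighted_simplicial_complex :: "'v set \<Rightarrow> 'v set set \<Rightarrow> ('v set \<Rightarrow> real) \<Rightarrow> bool" where
  "weighted_simplicial_complex X K m \<longleftrightarrow>
     simplicial_complex X K \<and> (\<forall>\<sigma>\<in>K. 0 < m \<sigma>) \<and>
     (\<forall>\<tau>\<in>simplices X K m. m summable_on {\<sigma>\<in>simplices X K m. face \<tau> \<sigma>})"

section \<open>Function spaces\<close>

(* A function on S is represented by its extension by 0. *)
type_synonym 'v cochain = "'v set \<Rightarrow> complex"

definition cochains :: "'v set set \<Rightarrow> 'v cochain set" where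
  "cochains S = {\<omega>. \<forall>\<sigma>. \<sigma> \<notin> S \<longrightarrow> \<omega> \<sigma> = 0}"

definition fin_cochains :: "'v set set \<Rightarrow> 'v cochain set" where
  "fin_cochains S = {\<omega>\<in>cochains S. finite {\<sigma>. \<omega> \<sigma> \<noteq> 0}}"

(* Squared norm, with value \<infinity> off the Hilbert space; a real-valued infsum would be 0 there. *)
definition l2_normsq :: "'v set set \<Rightarrow> ('v set \<Rightarrow> real) \<Rightarrow> 'v cochain \<Rightarrow> ennreal" where
  "l2_normsq S m \<omega> = (\<Sum>\<^sub>\<infinity>\<tau>\<in>S. ennreal (m \<tau> * (cmod (\<omega> \<tau>))\<^sup>2))"

definition l2 :: "'v set set \<Rightarrow> ('v set \<Rightarrow> real) \<Rightarrow> 'v cochain set" where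
  "l2 S m = {\<omega>\<in>cochains S. l2_normsq S m \<omega> < \<infinity>}"

section \<open>Coboundary and boundary\<close>

type_synonym 'v coboundary = "'v cochain \<Rightarrow> 'v cochain"

definition incidence :: "'v coboundary \<Rightarrow> 'v set \<Rightarrow> 'v set \<Rightarrow> complex" where
  "incidence \<delta> \<tau> \<sigma> = \<delta> (indicator {\<tau>}) \<sigma>"

(* Only the values of \<delta> on cochains S matter; linearity there is a consequence of the sum formula. *)
definition coboundary_operator :: "'v set set \<Rightarrow> 'v coboundary \<Rightarrow> bool" where
  "coboundary_operator S \<delta> \<longleftrightarrow>
     (\<forall>\<omega>\<in>cochains S. \<delta> \<omega> \<in> cochains S \<and>
        (\<forall>\<sigma>\<in>S. \<delta> \<omega> \<sigma> = (\<Sum>\<tau> | \<tau> \<in> S \<and> face \<tau> \<sigma>. incidence \<delta> \<tau> \<sigma> * \<omega> \<tau>)) \<and>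
        \<delta> (\<delta> \<omega>) = (\<lambda>_. 0)) \<and>
     (\<forall>\<tau>\<in>S. \<forall>\<sigma>\<in>S. face \<tau> \<sigma> \<longrightarrow> incidence \<delta> \<tau> \<sigma> \<in> {1, -1})"

definition boundary_fun ::
  "'v set set \<Rightarrow> ('v set \<Rightarrow> real) \<Rightarrow> 'v coboundary \<Rightarrow> 'v cochain \<Rightarrow> 'v cochain" where
  "boundary_fun S m \<delta> \<omega> \<rho> =
     (if \<rho> \<in> S
      then 1 / of_real (m \<rho>) * (\<Sum>\<^sub>\<infinity>\<tau>\<in>{\<tau>\<in>S. face \<rho> \<tau>}. of_real (m \<tau>) * incidence \<delta> \<rho> \<tau> * \<omega> \<tau>)
      else 0)"

definition boundary_dom :: "'v set set \<Rightarrow> ('v set \<Rightarrow> real) \<Rightarrow> 'v cochain set" where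
  "boundary_dom S m =
     {\<omega>\<in>cochains S. \<forall>\<rho>\<in>S. (\<lambda>\<tau>. m \<tau> * cmod (\<omega> \<tau>)) summable_on {\<tau>\<in>S. face \<rho> \<tau>}}"

section \<open>Operators and boundary conditions\<close>

(* Partially defined operators are given by their graphs, so inclusion of operators is set inclusion. *)
type_synonym 'v operator = "('v cochain \<times> 'v cochain) set"

definition boundary :: "'v set set \<Rightarrow> ('v set \<Rightarrow> real) \<Rightarrow> 'v coboundary \<Rightarrow> 'v operator" where
  "boundary S m \<delta> = {(\<omega>, boundary_fun S m \<delta> \<omega>) | \<omega>. \<omega> \<in> boundary_dom S m}"

definition boundary_N :: "'v set set \<Rightarrow> ('v set \<Rightarrow> real) \<Rightarrow> 'v coboundary \<Rightarrow> 'v operator" where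
  "boundary_N S m \<delta> = {(\<omega>, \<eta>) \<in> boundary S m \<delta>. \<omega> \<in> l2 S m \<and> \<eta> \<in> l2 S m}"

definition delta_N :: "'v set set \<Rightarrow> ('v set \<Rightarrow> real) \<Rightarrow> 'v coboundary \<Rightarrow> 'v operator" where
  "delta_N S m \<delta> = {(\<omega>, \<delta> \<omega>) | \<omega>. \<omega> \<in> l2 S m \<and> \<delta> \<omega> \<in> l2 S m}"

definition delta_D :: "'v set set \<Rightarrow> ('v set \<Rightarrow> real) \<Rightarrow> 'v coboundary \<Rightarrow> 'v operator" where
  "delta_D S m \<delta> = {(\<omega>, \<delta> \<omega>) | \<omega>. \<omega> \<in> l2 S m \<and>
     (\<exists>u :: nat \<Rightarrow> 'v cochain. (\<forall>n. u n \<in> fin_cochains S) \<and>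
        (\<lambda>n. l2_normsq S m (\<lambda>\<sigma>. u n \<sigma> - \<omega> \<sigma>) + l2_normsq S m (\<delta> (\<lambda>\<sigma>. u n \<sigma> - \<omega> \<sigma>)))
          \<longlonglongrightarrow> 0)}"

definition closed_operator :: "'v set set \<Rightarrow> ('v set \<Rightarrow> real) \<Rightarrow> 'v operator \<Rightarrow> bool" where
  "closed_operator S m T \<longleftrightarrow>
     T \<subseteq> l2 S m \<times> l2 S m \<and> single_valued T \<and>
     ((\<lambda>_. 0), (\<lambda>_. 0)) \<in> T \<and>
     (\<forall>f g f' g' c. (f, g) \<in> T \<and> (f', g') \<in> T \<longrightarrow> ((\<lambda>\<sigma>. c * f \<sigma> + f' \<sigma>), (\<lambda>\<sigma>. c * g \<sigma> + g' \<sigma>)) \<in> T) \<and>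
     (\<forall>u v. \<forall>f\<in>l2 S m. \<forall>g\<in>l2 S m.
        (\<forall>n::nat. (u n, v n) \<in> T) \<and>
        (\<lambda>n. l2_normsq S m (\<lambda>\<sigma>. u n \<sigma> - f \<sigma>)) \<longlonglongrightarrow> 0 \<and>
        (\<lambda>n. l2_normsq S m (\<lambda>\<sigma>. v n \<sigma> - g \<sigma>)) \<longlonglongrightarrow> 0 \<longrightarrow> (f, g) \<in> T)"

definition ideal_boundary_condition ::
  "'v set set \<Rightarrow> ('v set \<Rightarrow> real) \<Rightarrow> 'v coboundary \<Rightarrow> 'v operator \<Rightarrow> bool" where
  "ideal_boundary_condition S m \<delta> T \<longleftrightarrow>
     closed_operator S m T \<and> delta_D S m \<delta> \<subseteq> T \<and> T \<subseteq> delta_N S m \<delta> \<and> Range T \<subseteq> Domain T"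

section \<open>Links\<close>

definition link :: "'v set \<Rightarrow> 'v set set \<Rightarrow> 'v set \<Rightarrow> 'v set" where
  "link X S \<rho> = {v\<in>X. {v} \<union> \<rho> \<in> S \<and> face \<rho> ({v} \<union> \<rho>)}"

definition link_graph ::
  "'v set \<Rightarrow> 'v set set \<Rightarrow> ('v set \<Rightarrow> real) \<Rightarrow> 'v set \<Rightarrow> 'v \<Rightarrow> 'v \<Rightarrow> real" where
  "link_graph X S m \<rho> v v' =
     (if v \<in> link X S \<rho> \<and> v' \<in> link X S \<rho> \<and> v \<noteq> v' \<and> {v} \<union> {v'} \<union> \<rho> \<in> S
      then m ({v} \<union> {v'} \<union> \<rho>) else 0)"

definition graph_components :: "'v set \<Rightarrow> ('v \<Rightarrow> 'v \<Rightarrow> real) \<Rightarrow> 'v set set" where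
  "graph_components V b =
     {{y\<in>V. (x, y) \<in> {(v, v'). v \<in> V \<and> v' \<in> V \<and> 0 < b v v'}\<^sup>*} | x. x \<in> V}"

section \<open>Recurrence\<close>

(* The Markov property is the usual
     P(Y_(n+1) = z | Y_0 = s_0, ..., Y_n = s_n) = p s_n z
   multiplied by the probability of the conditioning event. *)
definition markov_chain ::
  "'w measure \<Rightarrow> (nat \<Rightarrow> 'w \<Rightarrow> 'v) \<Rightarrow> 'v set \<Rightarrow> ('v \<Rightarrow> 'v \<Rightarrow> real) \<Rightarrow> 'v \<Rightarrow> bool" where
  "markov_chain M Y V p x \<longleftrightarrow>
     prob_space M \<and> (\<forall>n. Y n \<in> measurable M (count_space V)) \<and>
     \<P>(\<omega> in M. Y 0 \<omega> = x) = 1 \<and>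
     (\<forall>n. \<forall>s :: nat \<Rightarrow> 'v. \<forall>z\<in>V. (\<forall>k\<le>n. s k \<in> V) \<longrightarrow>
        \<P>(\<omega> in M. (\<forall>k\<le>n. Y k \<omega> = s k) \<and> Y (Suc n) \<omega> = z) =
        \<P>(\<omega> in M. \<forall>k\<le>n. Y k \<omega> = s k) * p (s n) z)"

(* Recurrence of a connected graph b over V, where each b x is summable over V, so V is countable.
   The chain started at x exists on the path space, and its law is unique; hence it does not matter
   which realisation (M, Y) is used. *)
definition recurrent :: "'v set \<Rightarrow> ('v \<Rightarrow> 'v \<Rightarrow> real) \<Rightarrow> bool" where
  "recurrent V b \<longleftrightarrow>
     (\<exists>x. V = {x}) \<or>
     (\<forall>x\<in>V. \<forall>y\<in>V. \<exists>(M :: (nat \<Rightarrow> 'v) measure) Y.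
        markov_chain M Y V (\<lambda>v w. b v w / (\<Sum>\<^sub>\<infinity>z\<in>V. b v z)) x \<and>
        \<P>(\<omega> in M. \<exists>k>0. Y k \<omega> = y) = 1)"

end

theory Submission
  imports Defs
begin

text \<open>
  Write \<open>\<theta> \<tau>\<close> for the coboundary of the indicator of a simplex \<open>\<tau>\<close>. The operator \<open>\<delta>\<^sub>D\<close> is always
  closed and contained in \<open>\<delta>\<^sub>N\<close>, so the only question is whether it maps its domain into itself. Because
  \<open>\<delta> \<delta> = 0\<close> and finitely supported cochains are dense in the domain for the graph norm, this holds
  if and only if every \<open>\<theta> \<tau>\<close> is in the domain (\<open>ideal_boundary_condition_iff\<close>). As
  \<open>\<delta> (\<theta> \<tau>) = 0\<close>, this means that \<open>(\<theta> \<tau>, 0)\<close> lies in the closure of the graph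
  \<open>{(u, \<delta> u)}\<close> over the finitely supported \<open>u\<close>, a subspace of the direct sum of two copies of the
  Hilbert space.

  A vector lies in the closure of a subspace if and only if it is orthogonal to the orthogonal
  complement. By Green's formula the complement of the graph consists of the pairs \<open>(- \<partial> b, b)\<close>
  with \<open>b\<close> in the domain of \<open>\<partial>\<^sub>N\<close>, and the inner product of \<open>(\<theta> \<tau>, 0)\<close> with such a pair is
  \<open>- m \<tau>\<close> times the value of \<open>\<partial> (\<partial>\<^sub>N b)\<close> at \<open>\<tau>\<close>. This is the equivalence. The easy half,
  \<open>boundary_boundary_N_if_approximable\<close>, needs only Green's formula and the Cauchy-Schwarz inequality;
  the converse, \<open>approximable_if_boundary_boundary_N\<close>, needs the projection argument of
  \<open>approximable_by_duality\<close>.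

  For the criterion by links, \<open>\<theta> \<rho>\<close> is approximated directly. It lives on the simplices
  \<open>v\<rho>\<close> with \<open>v\<close> in the link of \<open>\<rho>\<close>, and it is multiplied by a finitely supported function \<open>\<phi>\<close> of
  \<open>v\<close>. Since \<open>\<delta> (\<theta> \<rho>) = 0\<close>, the coboundary of the product has the value \<open>\<phi> v - \<phi> w\<close>, up to sign, at
  \<open>vw\<rho>\<close>, so its squared norm is at most the energy of \<open>\<phi>\<close>, a sum over ordered pairs of link vertices
  (\<open>approximable_\<theta>_if_null_capacity\<close>). Recurrence provides such \<open>\<phi>\<close> of
  arbitrarily small energy which are one on prescribed vertices: for a single vertex \<open>x\<close> take the
  probability that the random walk hits \<open>x\<close> within a bounded time and before leaving a finite set. Its
  energy is at most twice the total weight at \<open>x\<close> times the probability that the walk started at \<open>x\<close>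
  fails to return in this restricted way (\<open>energy_hit_le\<close>), and that tends to zero by recurrence
  (\<open>hit_tends_to_1\<close>). Several vertices and several components are handled by taking maxima.
\<close>

section \<open>Weighted square summable functions and duality\<close>

lemma LIMSEQ_zero_if_square:
  fixes u :: "nat \<Rightarrow> real"
  assumes "(\<lambda>n. (u n)\<^sup>2) \<longlonglongrightarrow> 0"
  shows "u \<longlonglongrightarrow> 0"
  using tendsto_real_sqrt[OF assms] by (simp add: tendsto_rabs_zero_iff)

text \<open>Square summable functions on an index set \<open>I\<close> carrying a weight. Functions are real, and their
values outside \<open>I\<close> are ignored; complex cochains enter below through their absolute values or,
where the coboundary operator preserves real cochains, through their real parts.\<close>

locale weighted_l2 =
  fixes I :: "'i set" and w :: "'i \<Rightarrow> real"
  assumes weight_pos: "i \<in> I \<Longrightarrow> 0 < w i"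
begin

definition square_summable :: "('i \<Rightarrow> real) \<Rightarrow> bool" where
  "square_summable f \<longleftrightarrow> (\<lambda>i. w i * (f i)\<^sup>2) summable_on I"

definition ip :: "('i \<Rightarrow> real) \<Rightarrow> ('i \<Rightarrow> real) \<Rightarrow> real" where
  "ip f g = (\<Sum>\<^sub>\<infinity>i\<in>I. w i * f i * g i)"

lemma abs_weighted_product_le:
  assumes "i \<in> I"
  shows "\<bar>w i * f i * g i\<bar> \<le> w i * (f i)\<^sup>2 + w i * (g i)\<^sup>2"
proof -
  have "2 * \<bar>f i * g i\<bar> \<le> (f i)\<^sup>2 + (g i)\<^sup>2"
    using sum_squares_bound[of "\<bar>f i\<bar>" "\<bar>g i\<bar>"] by (simp add: abs_mult)
  moreover have "0 \<le> \<bar>f i * g i\<bar>" by simp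
  ultimately have "\<bar>f i * g i\<bar> \<le> (f i)\<^sup>2 + (g i)\<^sup>2" by linarith
  then have "w i * \<bar>f i * g i\<bar> \<le> w i * ((f i)\<^sup>2 + (g i)\<^sup>2)"
    using weight_pos[OF assms] by (intro mult_left_mono) auto
  then show ?thesis
    using weight_pos[OF assms] by (simp add: abs_mult algebra_simps)
qed

lemma summable_product:
  assumes "square_summable f" "square_summable g"
  shows "(\<lambda>i. w i * f i * g i) summable_on I"
proof -
  have "(\<lambda>i. w i * (f i)\<^sup>2 + w i * (g i)\<^sup>2) summable_on I"
    using assms by (auto simp: square_summable_def intro: summable_on_add)
  then have "(\<lambda>i. \<bar>w i * f i * g i\<bar>) summable_on I"
    by (rule summable_on_comparison_test) (use abs_weighted_product_le in auto)
  then show ?thesis by (subst summable_on_iff_abs_summable_on_real) simp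
qed

lemma square_summable_combination:
  assumes "square_summable f" "square_summable g"
  shows "square_summable (\<lambda>i. c * f i + g i)"
proof -
  have "(\<lambda>i. c\<^sup>2 * (w i * (f i)\<^sup>2) + 2 * c * (w i * f i * g i) + w i * (g i)\<^sup>2) summable_on I"
    using assms summable_product[OF assms] unfolding square_summable_def
    by (intro summable_on_add summable_on_cmult_right)
  then show ?thesis
    unfolding square_summable_def by (simp add: power2_eq_square algebra_simps)
qed

lemma square_summable_diff:
  assumes "square_summable f" "square_summable g"
  shows "square_summable (\<lambda>i. f i - g i)"
  using square_summable_combination[OF assms(2,1), of "-1"] by simp

lemma ip_commute: "ip f g = ip g f"
  unfolding ip_def by (rule infsum_cong) (simp add: mult.commute mult.left_commute)

lemma ip_combination:
  assumes "square_summable f" "square_summable g" "square_summable h"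
  shows "ip (\<lambda>i. c * f i + g i) h = c * ip f h + ip g h"
proof -
  have "(\<Sum>\<^sub>\<infinity>i\<in>I. w i * (c * f i + g i) * h i) = (\<Sum>\<^sub>\<infinity>i\<in>I. c * (w i * f i * h i) + w i * g i * h i)"
    by (rule infsum_cong) (simp add: algebra_simps)
  also have "\<dots> = c * ip f h + ip g h"
    unfolding ip_def using summable_product assms
    by (subst infsum_add) (auto simp: infsum_cmult_right' intro!: summable_on_cmult_right)
  finally show ?thesis by (simp add: ip_def)
qed

lemma ip_diff:
  assumes "square_summable f" "square_summable g" "square_summable h"
  shows "ip (\<lambda>i. f i - g i) h = ip f h - ip g h"
  using ip_combination[OF assms(2,1,3), of "-1"] by simp

lemma ip_self: "ip f f = (\<Sum>\<^sub>\<infinity>i\<in>I. w i * (f i)\<^sup>2)"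
  unfolding ip_def by (rule infsum_cong) (simp add: power2_eq_square)

lemma weighted_square_nonneg: "i \<in> I \<Longrightarrow> 0 \<le> w i * (f i)\<^sup>2"
  using weight_pos[of i] by simp

lemma ip_self_nonneg: "0 \<le> ip f f"
  unfolding ip_self by (rule infsum_nonneg) (rule weighted_square_nonneg)

lemma ip_self_combination:
  assumes "square_summable f" "square_summable g"
  shows "ip (\<lambda>i. c * f i + g i) (\<lambda>i. c * f i + g i) = c\<^sup>2 * ip f f + 2 * c * ip f g + ip g g"
proof -
  let ?h = "\<lambda>i. c * f i + g i"
  have "ip ?h ?h = c * ip ?h f + ip ?h g"
    using ip_combination[OF assms square_summable_combination[OF assms], of c c]
    by (simp only: ip_commute[of f ?h] ip_commute[of g ?h])
  also have "\<dots> = c\<^sup>2 * ip f f + 2 * c * ip f g + ip g g"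
    unfolding ip_combination[OF assms assms(1)] ip_combination[OF assms assms(2)] ip_commute[of g f]
    by (simp add: power2_eq_square algebra_simps)
  finally show ?thesis .
qed

lemma ip_self_ge_term:
  assumes "square_summable f" "i \<in> I"
  shows "w i * (f i)\<^sup>2 \<le> ip f f"
  using finite_sum_le_infsum[OF assms(1)[unfolded square_summable_def], of "{i}"]
    assms(2) weighted_square_nonneg by (simp add: ip_self)

text \<open>The case \<open>a = 0\<close> is included, since the form \<open>ip\<close> vanishes on functions that are zero on \<open>I\<close>
without being identically zero.\<close>

lemma quadratic_nonneg_discriminant:
  fixes a b c :: real
  assumes "\<And>t. 0 \<le> t\<^sup>2 * a + 2 * t * b + c" "0 \<le> a"
  shows "b\<^sup>2 \<le> a * c"
proof (cases "a = 0")
  case True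
  have "b = 0"
  proof (rule ccontr)
    assume "b \<noteq> 0"
    then show False
      using assms(1)[of "- (c + 1) / (2 * b)"] True by (simp add: field_simps)
  qed
  then show ?thesis using True by simp
next
  case False
  then have "0 < a" using assms(2) by simp
  have "0 \<le> a * ((- b / a)\<^sup>2 * a + 2 * (- b / a) * b + c)"
    using assms(1)[of "- b / a"] \<open>0 < a\<close> by (intro mult_nonneg_nonneg) auto
  also have "\<dots> = a * c - b\<^sup>2"
    using \<open>0 < a\<close> by (simp add: field_simps power2_eq_square)
  finally show ?thesis by simp
qed

lemma Cauchy_Schwarz:
  assumes "square_summable f" "square_summable g"
  shows "(ip f g)\<^sup>2 \<le> ip f f * ip g g"
proof (rule quadratic_nonneg_discriminant)
  show "0 \<le> t\<^sup>2 * ip f f + 2 * t * ip f g + ip g g" for t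
    using ip_self_nonneg[of "\<lambda>i. t * f i + g i"] ip_self_combination[OF assms, of t] by simp
qed (rule ip_self_nonneg)

text \<open>Completeness: the limit is taken pointwise on \<open>I\<close>, and the Cauchy estimate passes to it because
it bounds every finite partial sum.\<close>

lemma square_summable_limit:
  assumes f: "\<And>n. square_summable (f n)"
    and cauchy: "\<And>n k. n \<le> k \<Longrightarrow> ip (\<lambda>i. f n i - f k i) (\<lambda>i. f n i - f k i) \<le> e n"
    and e: "e \<longlonglongrightarrow> 0"
  obtains g where "square_summable g"
    and "\<And>n. ip (\<lambda>i. f n i - g i) (\<lambda>i. f n i - g i) \<le> e n"
proof -
  let ?d = "\<lambda>n k i. f n i - f k i"
  have ss: "square_summable (?d n k)" for n k
    by (intro square_summable_diff f)
  have conv: "convergent (\<lambda>n. f n i)" if i: "i \<in> I" for i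
  proof -
    have "Cauchy (\<lambda>n. f n i)"
    proof (rule CauchyI')
      fix r :: real assume "0 < r"
      then have "0 < w i * r\<^sup>2" using weight_pos[OF i] by simp
      then obtain N where N: "\<And>n. n \<ge> N \<Longrightarrow> e n < w i * r\<^sup>2"
        using order_tendstoD(2)[OF e] by (auto simp: eventually_sequentially)
      have "dist (f n i) (f k i) < r" if "N \<le> n" "n < k" for n k
      proof -
        have "w i * (f n i - f k i)\<^sup>2 < w i * r\<^sup>2"
          using ip_self_ge_term[OF ss i, of n k] cauchy[of n k] N[of n] that by simp
        then have "\<bar>f n i - f k i\<bar>\<^sup>2 < r\<^sup>2" using weight_pos[OF i] by simp
        then have "\<bar>f n i - f k i\<bar> < r" by (rule power2_less_imp_less) (use \<open>0 < r\<close> in simp)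
        then show ?thesis by (simp add: dist_real_def)
      qed
      then show "\<exists>M. \<forall>m\<ge>M. \<forall>n>m. dist (f m i) (f n i) < r" by blast
    qed
    then show ?thesis by (rule Cauchy_convergent)
  qed
  define g where "g i = lim (\<lambda>n. f n i)" for i
  have lim: "(\<lambda>n. f n i) \<longlonglongrightarrow> g i" if "i \<in> I" for i
    using conv[OF that] by (simp add: g_def convergent_LIMSEQ_iff)
  have bound: "(\<Sum>i\<in>T. w i * (f n i - g i)\<^sup>2) \<le> e n" if T: "finite T" "T \<subseteq> I" for T n
  proof (rule LIMSEQ_le_const2)
    show "(\<lambda>k. \<Sum>i\<in>T. w i * (f n i - f k i)\<^sup>2) \<longlonglongrightarrow> (\<Sum>i\<in>T. w i * (f n i - g i)\<^sup>2)"
      using lim T by (intro tendsto_intros) auto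
    have "(\<Sum>i\<in>T. w i * (f n i - f k i)\<^sup>2) \<le> e n" if "n \<le> k" for k
    proof -
      have "(\<Sum>i\<in>T. w i * (f n i - f k i)\<^sup>2) \<le> (\<Sum>\<^sub>\<infinity>i\<in>I. w i * (f n i - f k i)\<^sup>2)"
        using ss[of n k] T weighted_square_nonneg
        by (intro finite_sum_le_infsum) (auto simp: square_summable_def)
      also have "\<dots> = ip (?d n k) (?d n k)"
        by (simp add: ip_self)
      finally show ?thesis using cauchy[OF that] by simp
    qed
    then show "\<exists>N. \<forall>k\<ge>N. (\<Sum>i\<in>T. w i * (f n i - f k i)\<^sup>2) \<le> e n" by blast
  qed
  have sd: "square_summable (\<lambda>i. f n i - g i)" for n
    unfolding square_summable_def
  proof (rule nonneg_bdd_above_summable_on)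
    show "bdd_above (sum (\<lambda>i. w i * (f n i - g i)\<^sup>2) ` {F. F \<subseteq> I \<and> finite F})"
      by (rule bdd_aboveI[where M = "e n"]) (use bound in auto)
  qed (rule weighted_square_nonneg)
  show ?thesis
  proof
    show "square_summable g"
      using square_summable_diff[OF f sd, of 0 0] by simp
    show "ip (\<lambda>i. f n i - g i) (\<lambda>i. f n i - g i) \<le> e n" for n
      using infsum_le_finite_sums[OF sd[of n, unfolded square_summable_def] bound]
      by (simp add: ip_self)
  qed
qed

lemma parallelogram:
  assumes "square_summable f" "square_summable g"
  shows "ip (\<lambda>i. f i - g i) (\<lambda>i. f i - g i)
         = 2 * ip f f + 2 * ip g g - 4 * ip (\<lambda>i. (f i + g i) / 2) (\<lambda>i. (f i + g i) / 2)"
proof -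
  have "ip (\<lambda>i. f i - g i) (\<lambda>i. f i - g i) = ip f f - 2 * ip f g + ip g g"
    using ip_self_combination[OF assms(2,1), of "-1"] by (simp add: ip_commute[of g f] algebra_simps)
  moreover have "ip (\<lambda>i. (f i + g i) / 2) (\<lambda>i. (f i + g i) / 2) = (ip f f + 2 * ip f g + ip g g) / 4"
  proof -
    have "ip (\<lambda>i. (f i + g i) / 2) (\<lambda>i. (f i + g i) / 2)
        = (\<Sum>\<^sub>\<infinity>i\<in>I. (1/4) * (w i * (1 * f i + g i) * (1 * f i + g i)))"
      unfolding ip_def by (rule infsum_cong) simp
    also have "\<dots> = ip (\<lambda>i. 1 * f i + g i) (\<lambda>i. 1 * f i + g i) / 4"
      by (simp only: infsum_cmult_right') (simp add: ip_def)
    also have "\<dots> = (ip f f + 2 * ip f g + ip g g) / 4"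
      by (simp only: ip_self_combination[OF assms]) simp
    finally show ?thesis .
  qed
  ultimately show ?thesis by simp
qed

text \<open>The double orthogonal complement of a subspace lies in its closure. A minimising sequence
\<open>r n = x - f n\<close> for the distance from \<open>x\<close> to \<open>W\<close> is Cauchy by the parallelogram identity, its
limit \<open>R\<close> is orthogonal to \<open>W\<close> by minimality, hence also orthogonal to \<open>x\<close> by assumption, and
therefore to every \<open>r n\<close> and to itself; so the distance is zero.\<close>

lemma approximable_by_duality:
  assumes zero: "(\<lambda>_. 0) \<in> W"
    and combination: "\<forall>f\<in>W. \<forall>g\<in>W. \<forall>c. (\<lambda>i. c * f i + g i) \<in> W"
    and square_summable_W: "\<forall>f\<in>W. square_summable f"
    and x: "square_summable x"
    and dual: "\<forall>r. square_summable r \<longrightarrow> (\<forall>f\<in>W. ip f r = 0) \<longrightarrow> ip x r = 0"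
    and "0 < \<epsilon>"
  shows "\<exists>f\<in>W. ip (\<lambda>i. x i - f i) (\<lambda>i. x i - f i) < \<epsilon>"
proof -
  have lin: "(\<lambda>i. c * f i + g i) \<in> W" if "f \<in> W" "g \<in> W" for f g c
    by (rule combination[rule_format, OF that])
  have W: "square_summable f" if "f \<in> W" for f
    by (rule square_summable_W[rule_format, OF that])
  define q where "q f = ip (\<lambda>i. x i - f i) (\<lambda>i. x i - f i)" for f
  have q0: "0 \<le> q f" for f by (simp add: q_def ip_self_nonneg)
  define d where "d = Inf (q ` W)"
  have bdd: "bdd_below (q ` W)" by (rule bdd_belowI[where m = 0]) (use q0 in auto)
  have d: "d \<le> q f" if "f \<in> W" for f
    unfolding d_def using that bdd by (intro cInf_lower) auto
  have "\<exists>f\<in>W. q f < d + 1 / real (Suc n)" for n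
  proof (rule ccontr)
    assume "\<not> (\<exists>f\<in>W. q f < d + 1 / real (Suc n))"
    then have "d + 1 / real (Suc n) \<le> d"
      unfolding d_def using zero by (intro cInf_greatest) (auto simp: not_less d_def)
    then show False by (simp add: field_simps)
  qed
  then have "\<exists>f. \<forall>n. f n \<in> W \<and> q (f n) < d + 1 / real (Suc n)"
    by (intro choice) blast
  then obtain f where fW: "\<And>n. f n \<in> W" and f: "\<And>n. q (f n) < d + 1 / real (Suc n)"
    by blast
  define r where "r n = (\<lambda>i. x i - f n i)" for n
  have rs: "square_summable (r n)" for n
    unfolding r_def by (intro square_summable_diff x W fW)
  have q_r: "ip (r n) (r n) = q (f n)" for n by (simp add: q_def r_def)
  \<comment> \<open>the midpoint of two points of \<open>W\<close> is in \<open>W\<close>, hence no closer to \<open>x\<close> than \<open>d\<close>\<close>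
  have mid: "d \<le> ip (\<lambda>i. (r n i + r k i) / 2) (\<lambda>i. (r n i + r k i) / 2)" for n k
  proof -
    have half: "(\<lambda>i. (1/2) * f n i + 0) \<in> W" by (rule lin[OF fW zero])
    have "(\<lambda>i. (1/2) * f k i + ((1/2) * f n i + 0)) \<in> W" by (rule lin[OF fW half])
    moreover have "(r n i + r k i) / 2 = x i - ((1/2) * f k i + ((1/2) * f n i + 0))" for i
      by (simp add: r_def field_simps)
    ultimately show ?thesis using d by (simp only: q_def)
  qed
  have "ip (\<lambda>i. r n i - r k i) (\<lambda>i. r n i - r k i) \<le> 4 / real (Suc n)" if "n \<le> k" for n k
  proof -
    have "1 / real (Suc k) \<le> 1 / real (Suc n)" using that by (simp add: field_simps)
    then show ?thesis
      unfolding parallelogram[OF rs rs] using mid[of n k] f[of n] f[of k] q_r[of n] q_r[of k]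
      by simp
  qed
  moreover have e: "(\<lambda>n. 4 / real (Suc n)) \<longlonglongrightarrow> 0"
    using LIMSEQ_Suc[OF lim_const_over_n[of 4]] by simp
  ultimately obtain R where R: "square_summable R"
    and rR: "\<And>n. ip (\<lambda>i. r n i - R i) (\<lambda>i. r n i - R i) \<le> 4 / real (Suc n)"
    using square_summable_limit[of r "\<lambda>n. 4 / real (Suc n)", OF rs] by blast
  have lim: "(\<lambda>n. ip (r n) h) \<longlonglongrightarrow> ip R h" if h: "square_summable h" for h
  proof -
    have "(\<lambda>n. (ip (r n) h - ip R h)\<^sup>2) \<longlonglongrightarrow> 0"
    proof (rule tendsto_sandwich[OF _ _ tendsto_const])
      have "(ip (r n) h - ip R h)\<^sup>2 \<le> 4 / real (Suc n) * ip h h" for n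
        using Cauchy_Schwarz[OF square_summable_diff[OF rs R] h, of n]
          mult_right_mono[OF rR ip_self_nonneg[of h], of n]
        by (simp add: ip_diff[OF rs R h])
      then show "\<forall>\<^sub>F n in sequentially. (ip (r n) h - ip R h)\<^sup>2 \<le> 4 / real (Suc n) * ip h h" by simp
      show "(\<lambda>n. 4 / real (Suc n) * ip h h) \<longlonglongrightarrow> 0"
        using tendsto_mult_right[OF e, of "ip h h"] by simp
    qed simp
    then have "(\<lambda>n. ip (r n) h - ip R h) \<longlonglongrightarrow> 0" by (rule LIMSEQ_zero_if_square)
    then show ?thesis by (simp add: LIM_zero_iff)
  qed
  have orth: "ip h R = 0" if h: "h \<in> W" for h
  proof -
    have "(ip (r n) h)\<^sup>2 \<le> 1 / real (Suc n) * ip h h" for n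
    proof -
      have "(ip h (r n))\<^sup>2 \<le> ip h h * (1 / real (Suc n))"
      \<comment> \<open>minimality along the line \<open>f n + t h\<close> is a nonnegative quadratic in \<open>t\<close>\<close>
      proof (rule quadratic_nonneg_discriminant)
        fix t
        have "(\<lambda>i. (-t) * h i + f n i) \<in> W" by (rule lin[OF h fW])
        moreover have "t * h i + r n i = x i - ((-t) * h i + f n i)" for i
          by (simp add: r_def)
        ultimately have "d \<le> ip (\<lambda>i. t * h i + r n i) (\<lambda>i. t * h i + r n i)"
          using d by (simp only: q_def)
        then show "0 \<le> t\<^sup>2 * ip h h + 2 * t * ip h (r n) + 1 / real (Suc n)"
          using ip_self_combination[OF W[OF h] rs[of n], of t] f[of n] q_r[of n] by simp
      qed (rule ip_self_nonneg)
      then show ?thesis by (simp add: ip_commute mult.commute)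
    qed
    note bound = this
    have "(\<lambda>n. (ip (r n) h)\<^sup>2) \<longlonglongrightarrow> 0"
    proof (rule tendsto_sandwich[OF _ _ tendsto_const])
      show "\<forall>\<^sub>F n in sequentially. (ip (r n) h)\<^sup>2 \<le> 1 / real (Suc n) * ip h h" using bound by simp
      show "(\<lambda>n. 1 / real (Suc n) * ip h h) \<longlonglongrightarrow> 0"
        using tendsto_mult_right[OF LIMSEQ_Suc[OF lim_const_over_n[of 1]], of "ip h h"] by simp
    qed simp
    then have "(\<lambda>n. ip (r n) h) \<longlonglongrightarrow> 0" by (rule LIMSEQ_zero_if_square)
    with lim[OF W[OF h]] have "ip R h = 0" using LIMSEQ_unique by blast
    then show ?thesis by (simp add: ip_commute)
  qed
  have "ip x R = 0" by (rule dual[rule_format, OF R orth])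
  then have "ip (r n) R = 0" for n
    using ip_diff[OF x W[OF fW] R, of n] orth[OF fW, of n] by (simp add: r_def)
  with lim[OF R] have "ip R R = 0" by (simp add: LIMSEQ_const_iff)
  then have R0: "R i = 0" if "i \<in> I" for i
    using ip_self_ge_term[OF R that] weight_pos[OF that] by (simp add: mult_le_0_iff)
  have small: "q (f n) \<le> 4 / real (Suc n)" for n
  proof -
    have "ip (\<lambda>i. r n i - R i) (\<lambda>i. r n i - R i) = ip (r n) (r n)"
      unfolding ip_def by (rule infsum_cong) (simp add: R0)
    then show ?thesis using rR[of n] q_r[of n] by linarith
  qed
  obtain n where "4 / real (Suc n) < \<epsilon>"
    using eventually_happens[OF order_tendstoD(2)[OF e \<open>0 < \<epsilon>\<close>]] by auto
  with small[of n] have "q (f n) < \<epsilon>" by linarith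
  with fW have "\<exists>f\<in>W. q f < \<epsilon>" by (intro bexI[of _ "f n"])
  then show ?thesis by (simp only: q_def)
qed

end

section \<open>Cochains, coboundaries and norms\<close>

locale weighted_complex =
  fixes X :: "'v set" and K S :: "'v set set" and m :: "'v set \<Rightarrow> real"
    and \<delta> :: "('v set \<Rightarrow> complex) \<Rightarrow> ('v set \<Rightarrow> complex)"
  assumes complex: "weighted_simplicial_complex X K m"
    and S_def: "S = simplices X K m"
    and coboundary: "coboundary_operator S \<delta>"
begin

abbreviation N :: "('v set \<Rightarrow> complex) \<Rightarrow> ennreal" where "N \<equiv> l2_normsq S m"
abbreviation \<theta> :: "'v set \<Rightarrow> 'v set \<Rightarrow> complex" where "\<theta> \<equiv> incidence \<delta>"
abbreviation e :: "'v set \<Rightarrow> 'v set \<Rightarrow> complex" where "e \<tau> \<equiv> indicator {\<tau>}"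

lemma S_subset: "S \<subseteq> K"
  unfolding S_def simplices_def by auto

lemma simplicial: "simplicial_complex X K"
  using complex by (simp add: weighted_simplicial_complex_def)

lemma finite_simplex: "\<sigma> \<in> S \<Longrightarrow> finite \<sigma>"
  using simplicial subsetD[OF S_subset, of \<sigma>] by (simp add: simplicial_complex_def)

lemma simplex_subset: "\<sigma> \<in> S \<Longrightarrow> \<sigma> \<subseteq> X"
  using simplicial subsetD[OF S_subset, of \<sigma>] by (simp add: simplicial_complex_def)

lemma simplex_between:
  assumes "\<rho> \<in> S" "\<sigma> \<in> S" "\<rho> \<subseteq> \<tau>" "\<tau> \<subseteq> \<sigma>"
  shows "\<tau> \<in> S"
proof -
  have "\<tau> \<in> K"
    using simplicial subsetD[OF S_subset assms(2)] assms(4) by (auto simp: simplicial_complex_def)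
  then show ?thesis using assms(1,3) unfolding S_def simplices_def by (auto split: if_splits)
qed

lemma m_pos: "\<sigma> \<in> S \<Longrightarrow> 0 < m \<sigma>"
  using complex subsetD[OF S_subset, of \<sigma>] by (simp add: weighted_simplicial_complex_def)

lemma m_summable_cofaces: "\<tau> \<in> S \<Longrightarrow> m summable_on {\<sigma>\<in>S. face \<tau> \<sigma>}"
  using complex by (simp add: weighted_simplicial_complex_def S_def)

sublocale l2: weighted_l2 S m
  by unfold_locales (rule m_pos)

lemma finite_faces: "\<sigma> \<in> S \<Longrightarrow> finite {\<tau>. \<tau> \<in> S \<and> face \<tau> \<sigma>}"
  by (rule finite_subset[of _ "Pow \<sigma>"]) (auto simp: face_def finite_simplex)

lemma \<delta>_cochain: "\<omega> \<in> cochains S \<Longrightarrow> \<delta> \<omega> \<in> cochains S"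
  using coboundary by (simp add: coboundary_operator_def)

lemma \<delta>_eq: "\<omega> \<in> cochains S \<Longrightarrow> \<sigma> \<in> S \<Longrightarrow> \<delta> \<omega> \<sigma> = (\<Sum>\<tau> | \<tau> \<in> S \<and> face \<tau> \<sigma>. \<theta> \<tau> \<sigma> * \<omega> \<tau>)"
  using coboundary unfolding coboundary_operator_def by blast

lemma \<delta>_\<delta>: "\<omega> \<in> cochains S \<Longrightarrow> \<delta> (\<delta> \<omega>) = (\<lambda>_. 0)"
  using coboundary unfolding coboundary_operator_def by blast

lemma \<theta>_cases: "\<tau> \<in> S \<Longrightarrow> \<sigma> \<in> S \<Longrightarrow> face \<tau> \<sigma> \<Longrightarrow> \<theta> \<tau> \<sigma> = 1 \<or> \<theta> \<tau> \<sigma> = -1"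
  using coboundary unfolding coboundary_operator_def by blast

lemma \<delta>_outside: "\<omega> \<in> cochains S \<Longrightarrow> \<sigma> \<notin> S \<Longrightarrow> \<delta> \<omega> \<sigma> = 0"
  using \<delta>_cochain by (auto simp: cochains_def)

lemma cochains_combination:
  "f \<in> cochains S \<Longrightarrow> g \<in> cochains S \<Longrightarrow> (\<lambda>\<sigma>. c * f \<sigma> + g \<sigma>) \<in> cochains S"
  by (simp add: cochains_def)

lemma cochains_diff:
  "f \<in> cochains S \<Longrightarrow> g \<in> cochains S \<Longrightarrow> (\<lambda>\<sigma>. f \<sigma> - g \<sigma>) \<in> cochains S"
  by (simp add: cochains_def)

lemma \<delta>_combination:
  assumes "f \<in> cochains S" "g \<in> cochains S"
  shows "\<delta> (\<lambda>\<sigma>. c * f \<sigma> + g \<sigma>) = (\<lambda>\<sigma>. c * \<delta> f \<sigma> + \<delta> g \<sigma>)"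
proof
  fix \<sigma>
  show "\<delta> (\<lambda>\<sigma>. c * f \<sigma> + g \<sigma>) \<sigma> = c * \<delta> f \<sigma> + \<delta> g \<sigma>"
  proof (cases "\<sigma> \<in> S")
    case True
    then show ?thesis
      using assms cochains_combination[OF assms, of c]
      by (simp add: \<delta>_eq sum_distrib_left sum.distrib[symmetric] algebra_simps)
  next
    case False
    then show ?thesis
      using assms cochains_combination[OF assms, of c] by (simp add: \<delta>_outside)
  qed
qed

lemma \<delta>_diff:
  assumes "f \<in> cochains S" "g \<in> cochains S"
  shows "\<delta> (\<lambda>\<sigma>. f \<sigma> - g \<sigma>) = (\<lambda>\<sigma>. \<delta> f \<sigma> - \<delta> g \<sigma>)"
  using \<delta>_combination[OF assms(2,1), of "-1"] by simp

lemma zero_cochain: "(\<lambda>_. 0) \<in> cochains S"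
  by (simp add: cochains_def)

lemma \<delta>_zero: "\<delta> (\<lambda>_. 0) = (\<lambda>_. 0)"
  using \<delta>_\<delta>[OF zero_cochain] \<delta>_diff[OF zero_cochain zero_cochain] by simp

lemma e_cochain: "\<tau> \<in> S \<Longrightarrow> e \<tau> \<in> cochains S"
  by (auto simp: cochains_def indicator_def)

lemma \<theta>_zero:
  assumes "\<tau> \<in> S" "\<sigma> \<in> S" "\<not> face \<tau> \<sigma>"
  shows "\<theta> \<tau> \<sigma> = 0"
proof -
  have "\<theta> \<tau> \<sigma> = (\<Sum>\<tau>' | \<tau>' \<in> S \<and> face \<tau>' \<sigma>. \<theta> \<tau>' \<sigma> * e \<tau> \<tau>')"
    using \<delta>_eq[OF e_cochain[OF assms(1)] assms(2)] by (simp only: incidence_def)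
  also have "\<dots> = 0"
    using assms(3) by (intro sum.neutral) (auto simp: indicator_def)
  finally show ?thesis .
qed

lemma \<theta>_outside: "\<tau> \<in> S \<Longrightarrow> \<sigma> \<notin> S \<Longrightarrow> \<theta> \<tau> \<sigma> = 0"
  unfolding incidence_def by (rule \<delta>_outside[OF e_cochain])

lemma \<delta>_e: "\<delta> (e \<tau>) = \<theta> \<tau>"
  by (rule ext) (simp add: incidence_def)

lemma norm_\<theta>: "\<tau> \<in> S \<Longrightarrow> \<sigma> \<in> S \<Longrightarrow> face \<tau> \<sigma> \<Longrightarrow> cmod (\<theta> \<tau> \<sigma>) = 1"
  using \<theta>_cases[of \<tau> \<sigma>] by auto

text \<open>Statements about finitely supported cochains reduce to the indicators of single simplices.\<close>

lemma fin_cochain_induct [consumes 1, case_names zero add]: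
  assumes "u \<in> fin_cochains S"
    and zero: "P (\<lambda>_. 0)"
    and add: "\<And>c \<tau> f. \<tau> \<in> S \<Longrightarrow> f \<in> fin_cochains S \<Longrightarrow> P f \<Longrightarrow> P (\<lambda>\<sigma>. c * e \<tau> \<sigma> + f \<sigma>)"
  shows "P u"
proof -
  have fin: "P u" if "finite T" "T \<subseteq> S" "\<And>\<sigma>. \<sigma> \<notin> T \<Longrightarrow> u \<sigma> = 0" for T u
    using that
  proof (induction T arbitrary: u)
    case empty
    then have "u = (\<lambda>_. 0)" by auto
    then show ?case using zero by simp
  next
    case (insert \<tau> T)
    define f where "f = u(\<tau> := 0)"
    have f0: "f \<sigma> = 0" if "\<sigma> \<notin> T" for \<sigma>
      using insert.prems(2)[of \<sigma>] that by (auto simp: f_def)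
    have "{\<sigma>. f \<sigma> \<noteq> 0} \<subseteq> T" using f0 by auto
    then have "f \<in> fin_cochains S"
      using f0 insert by (auto simp: fin_cochains_def cochains_def intro: finite_subset)
    moreover have "P f" using insert.IH[of f] insert.prems f0 by blast
    moreover have "u = (\<lambda>\<sigma>. u \<tau> * e \<tau> \<sigma> + f \<sigma>)" by (auto simp: f_def indicator_def)
    ultimately show ?case using add[of \<tau> f "u \<tau>"] insert.prems(1) by simp
  qed
  show ?thesis
    by (rule fin[of "{\<sigma>. u \<sigma> \<noteq> 0}"]) (use assms(1) in \<open>auto simp: fin_cochains_def cochains_def\<close>)
qed

lemma fin_cochains_zero: "(\<lambda>_. 0) \<in> fin_cochains S"
  by (simp add: fin_cochains_def cochains_def)

lemma fin_cochains_cochain: "u \<in> fin_cochains S \<Longrightarrow> u \<in> cochains S"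
  by (simp add: fin_cochains_def)

lemma fin_cochains_combination:
  assumes "f \<in> fin_cochains S" "g \<in> fin_cochains S"
  shows "(\<lambda>\<sigma>. c * f \<sigma> + g \<sigma>) \<in> fin_cochains S"
proof -
  have "{\<sigma>. c * f \<sigma> + g \<sigma> \<noteq> 0} \<subseteq> {\<sigma>. f \<sigma> \<noteq> 0} \<union> {\<sigma>. g \<sigma> \<noteq> 0}" by auto
  then show ?thesis
    using assms cochains_combination by (auto simp: fin_cochains_def intro: finite_subset)
qed

lemma e_fin_cochain: "\<tau> \<in> S \<Longrightarrow> e \<tau> \<in> fin_cochains S"
  by (auto simp: fin_cochains_def e_cochain indicator_def)

text \<open>The norm takes values in the extended half-line; this criterion brings norm estimates down to
finite sums of real numbers.\<close>

lemma N_le_iff: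
  assumes "0 \<le> C"
  shows "N f \<le> ennreal C \<longleftrightarrow> (\<forall>F. finite F \<and> F \<subseteq> S \<longrightarrow> (\<Sum>\<tau>\<in>F. m \<tau> * (cmod (f \<tau>))\<^sup>2) \<le> C)"
proof -
  have "N f = (SUP F\<in>{F. finite F \<and> F \<subseteq> S}. \<Sum>\<tau>\<in>F. ennreal (m \<tau> * (cmod (f \<tau>))\<^sup>2))"
    unfolding l2_normsq_def by (rule nonneg_infsum_complete) simp
  moreover have "(\<Sum>\<tau>\<in>F. ennreal (m \<tau> * (cmod (f \<tau>))\<^sup>2)) = ennreal (\<Sum>\<tau>\<in>F. m \<tau> * (cmod (f \<tau>))\<^sup>2)"
    if "F \<subseteq> S" for F
    using that by (intro sum_ennreal l2.weighted_square_nonneg) auto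
  ultimately show ?thesis
    using assms by (auto simp: SUP_le_iff)
qed

lemma N_leD:
  assumes "N f \<le> ennreal C" "0 \<le> C"
  shows "l2.square_summable (\<lambda>\<sigma>. cmod (f \<sigma>))" and "l2.ip (\<lambda>\<sigma>. cmod (f \<sigma>)) (\<lambda>\<sigma>. cmod (f \<sigma>)) \<le> C"
proof -
  have bound: "(\<Sum>\<tau>\<in>F. m \<tau> * (cmod (f \<tau>))\<^sup>2) \<le> C" if "finite F" "F \<subseteq> S" for F
    using N_le_iff[OF assms(2)] assms(1) that by blast
  show ss: "l2.square_summable (\<lambda>\<sigma>. cmod (f \<sigma>))"
    unfolding l2.square_summable_def
  proof (rule nonneg_bdd_above_summable_on)
    show "bdd_above (sum (\<lambda>\<tau>. m \<tau> * (cmod (f \<tau>))\<^sup>2) ` {F. F \<subseteq> S \<and> finite F})"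
      by (rule bdd_aboveI[where M = C]) (use bound in auto)
  qed (rule l2.weighted_square_nonneg)
  then show "l2.ip (\<lambda>\<sigma>. cmod (f \<sigma>)) (\<lambda>\<sigma>. cmod (f \<sigma>)) \<le> C"
    unfolding l2.ip_self l2.square_summable_def using bound by (rule infsum_le_finite_sums)
qed

lemma N_le_ip:
  assumes "l2.square_summable (\<lambda>\<sigma>. cmod (f \<sigma>))"
  shows "N f \<le> ennreal (l2.ip (\<lambda>\<sigma>. cmod (f \<sigma>)) (\<lambda>\<sigma>. cmod (f \<sigma>)))"
proof (subst N_le_iff[OF l2.ip_self_nonneg], intro allI impI)
  fix F assume "finite F \<and> F \<subseteq> S"
  then show "(\<Sum>\<tau>\<in>F. m \<tau> * (cmod (f \<tau>))\<^sup>2) \<le> l2.ip (\<lambda>\<sigma>. cmod (f \<sigma>)) (\<lambda>\<sigma>. cmod (f \<sigma>))"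
    unfolding l2.ip_self using assms l2.weighted_square_nonneg
    by (intro finite_sum_le_infsum) (auto simp: l2.square_summable_def)
qed

lemma l2_iff: "f \<in> l2 S m \<longleftrightarrow> f \<in> cochains S \<and> l2.square_summable (\<lambda>\<sigma>. cmod (f \<sigma>))"
proof -
  have "l2.square_summable (\<lambda>\<sigma>. cmod (f \<sigma>))" if "N f < \<infinity>"
  proof -
    obtain C where "0 \<le> C" "N f = ennreal C" using \<open>N f < \<infinity>\<close> by (cases "N f") auto
    then show ?thesis using N_leD(1)[of f C] by simp
  qed
  moreover have "N f < \<infinity>" if "l2.square_summable (\<lambda>\<sigma>. cmod (f \<sigma>))"
    using N_le_ip[OF that] le_less_trans ennreal_less_top by fastforce
  ultimately show ?thesis unfolding l2_def by blast
qed

lemma l2I: "f \<in> cochains S \<Longrightarrow> 0 \<le> C \<Longrightarrow> N f \<le> ennreal C \<Longrightarrow> f \<in> l2 S m"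
  by (simp add: l2_iff N_leD(1))

lemma l2_cochain: "f \<in> l2 S m \<Longrightarrow> f \<in> cochains S"
  by (simp add: l2_def)

lemma N_combination_le:
  assumes "N f \<le> ennreal C" "N g \<le> ennreal D" "0 \<le> C" "0 \<le> D"
  shows "N (\<lambda>\<sigma>. c * f \<sigma> + g \<sigma>) \<le> ennreal (2 * (cmod c)\<^sup>2 * C + 2 * D)"
proof (subst N_le_iff, use assms in simp, intro allI impI)
  fix F assume F: "finite F \<and> F \<subseteq> S"
  have "(\<Sum>\<tau>\<in>F. m \<tau> * (cmod (c * f \<tau> + g \<tau>))\<^sup>2)
      \<le> (\<Sum>\<tau>\<in>F. 2 * (cmod c)\<^sup>2 * (m \<tau> * (cmod (f \<tau>))\<^sup>2) + 2 * (m \<tau> * (cmod (g \<tau>))\<^sup>2))"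
  proof (rule sum_mono)
    fix \<tau> assume "\<tau> \<in> F"
    then have "0 < m \<tau>" using F m_pos by blast
    let ?a = "cmod c * cmod (f \<tau>)" and ?b = "cmod (g \<tau>)"
    have "(cmod (c * f \<tau> + g \<tau>))\<^sup>2 \<le> (?a + ?b)\<^sup>2"
      using norm_triangle_ineq[of "c * f \<tau>" "g \<tau>"] by (intro power_mono) (auto simp: norm_mult)
    also have "\<dots> \<le> 2 * ?a\<^sup>2 + 2 * ?b\<^sup>2"
      using sum_squares_bound[of ?a ?b] by (simp add: power2_sum)
    finally have "m \<tau> * (cmod (c * f \<tau> + g \<tau>))\<^sup>2 \<le> m \<tau> * (2 * ?a\<^sup>2 + 2 * ?b\<^sup>2)"
      using \<open>0 < m \<tau>\<close> by (intro mult_left_mono) auto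
    then show "m \<tau> * (cmod (c * f \<tau> + g \<tau>))\<^sup>2
        \<le> 2 * (cmod c)\<^sup>2 * (m \<tau> * (cmod (f \<tau>))\<^sup>2) + 2 * (m \<tau> * (cmod (g \<tau>))\<^sup>2)"
      by (simp add: power_mult_distrib algebra_simps)
  qed
  also have "\<dots> = 2 * (cmod c)\<^sup>2 * (\<Sum>\<tau>\<in>F. m \<tau> * (cmod (f \<tau>))\<^sup>2) + 2 * (\<Sum>\<tau>\<in>F. m \<tau> * (cmod (g \<tau>))\<^sup>2)"
    by (simp add: sum.distrib sum_distrib_left)
  also have "\<dots> \<le> 2 * (cmod c)\<^sup>2 * C + 2 * D"
    using F assms N_le_iff[of C f] N_le_iff[of D g]
    by (intro add_mono mult_left_mono) auto
  finally show "(\<Sum>\<tau>\<in>F. m \<tau> * (cmod (c * f \<tau> + g \<tau>))\<^sup>2) \<le> 2 * (cmod c)\<^sup>2 * C + 2 * D" .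
qed

lemma N_add_le:
  assumes "N f \<le> ennreal \<epsilon>" "N g \<le> ennreal \<epsilon>" "0 \<le> \<epsilon>"
  shows "N (\<lambda>\<sigma>. f \<sigma> + g \<sigma>) \<le> ennreal (4 * \<epsilon>)"
  using N_combination_le[OF assms(1,2,3,3), of 1] by simp

lemma l2_combination:
  assumes "f \<in> l2 S m" "g \<in> l2 S m"
  shows "(\<lambda>\<sigma>. c * f \<sigma> + g \<sigma>) \<in> l2 S m"
proof -
  obtain C D where "0 \<le> C" "0 \<le> D" "N f \<le> ennreal C" "N g \<le> ennreal D"
    using assms N_le_ip l2.ip_self_nonneg unfolding l2_iff by blast
  from N_combination_le[OF this(3,4,1,2), of c] show ?thesis
    using \<open>0 \<le> C\<close> \<open>0 \<le> D\<close>
    by (intro l2I[OF cochains_combination[OF assms[THEN l2_cochain]], of "2 * (cmod c)\<^sup>2 * C + 2 * D"]) auto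
qed

lemma zero_l2: "(\<lambda>_. 0) \<in> l2 S m"
  by (simp add: l2_iff zero_cochain l2.square_summable_def)

lemma pointwise_le_N: "\<sigma> \<in> S \<Longrightarrow> ennreal (m \<sigma> * (cmod (f \<sigma>))\<^sup>2) \<le> N f"
proof (cases "N f" rule: ennreal_cases)
  case (real C)
  assume "\<sigma> \<in> S"
  then have "m \<sigma> * (cmod (f \<sigma>))\<^sup>2 \<le> C"
    using N_le_iff[of C f] real by (auto dest!: spec[of _ "{\<sigma>}"])
  then show ?thesis using real by (simp add: ennreal_leI)
qed simp

lemma pointwise_limit:
  assumes "(\<lambda>n. N (\<lambda>\<sigma>. u n \<sigma> - f \<sigma>)) \<longlonglongrightarrow> 0" "\<sigma> \<in> S"
  shows "(\<lambda>n. u n \<sigma>) \<longlonglongrightarrow> f \<sigma>"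
proof (rule tendstoI)
  fix r :: real assume "0 < r"
  then have "0 < ennreal (m \<sigma> * r\<^sup>2)" using m_pos[OF assms(2)] by simp
  from order_tendstoD(2)[OF assms(1) this]
  show "\<forall>\<^sub>F n in sequentially. dist (u n \<sigma>) (f \<sigma>) < r"
  proof eventually_elim
    case (elim n)
    have "ennreal (m \<sigma> * (cmod (u n \<sigma> - f \<sigma>))\<^sup>2) < ennreal (m \<sigma> * r\<^sup>2)"
      using pointwise_le_N[OF assms(2), of "\<lambda>\<sigma>. u n \<sigma> - f \<sigma>"] elim by (rule le_less_trans)
    then have "(cmod (u n \<sigma> - f \<sigma>))\<^sup>2 < r\<^sup>2"
      using m_pos[OF assms(2)] by (simp add: ennreal_less_iff)
    then show ?case
      using \<open>0 < r\<close> by (simp add: dist_norm power2_less_imp_less)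
  qed
qed

text \<open>Local summability says exactly that the coboundary of the indicator of a simplex has finite norm.\<close>

lemma \<theta>_l2: "\<tau> \<in> S \<Longrightarrow> \<theta> \<tau> \<in> l2 S m"
proof -
  assume \<tau>: "\<tau> \<in> S"
  have "(\<lambda>\<sigma>. m \<sigma> * (cmod (\<theta> \<tau> \<sigma>))\<^sup>2) summable_on S"
    using m_summable_cofaces[OF \<tau>]
    by (rule summable_on_cong_neutral[THEN iffD1, rotated -1]) (auto simp: \<tau> \<theta>_zero norm_\<theta>)
  then show ?thesis
    by (simp add: l2_iff l2.square_summable_def cochains_def \<theta>_outside \<tau>)
qed

lemma e_l2: "\<tau> \<in> S \<Longrightarrow> e \<tau> \<in> l2 S m"
  unfolding l2_iff l2.square_summable_def
  by (auto simp: e_cochain indicator_def intro!: finite_nonzero_values_imp_summable_on)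

lemma fin_cochain_l2:
  assumes "u \<in> fin_cochains S"
  shows "u \<in> l2 S m" and "\<delta> u \<in> l2 S m"
proof -
  have "u \<in> l2 S m \<and> \<delta> u \<in> l2 S m"
    using assms
  proof (induction rule: fin_cochain_induct)
    case zero
    show ?case by (simp add: \<delta>_zero zero_l2)
  next
    case (add c \<tau> f)
    then show ?case
      using l2_combination e_l2 \<theta>_l2
      by (simp add: \<delta>_combination e_cochain fin_cochains_cochain \<delta>_e)
  qed
  then show "u \<in> l2 S m" "\<delta> u \<in> l2 S m" by auto
qed


section \<open>The domain of the Dirichlet coboundary operator\<close>

text \<open>Membership in the domain of \<open>\<delta>\<^sub>D\<close>, without sequences; the two descriptions are identified in
\<open>delta_D_eq\<close>.\<close>

definition approximable :: "('v set \<Rightarrow> complex) \<Rightarrow> bool" where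
  "approximable \<omega> \<longleftrightarrow> \<omega> \<in> cochains S \<and>
     (\<forall>\<epsilon>>0. \<exists>u\<in>fin_cochains S. N (\<lambda>\<sigma>. u \<sigma> - \<omega> \<sigma>) \<le> ennreal \<epsilon> \<and> N (\<delta> (\<lambda>\<sigma>. u \<sigma> - \<omega> \<sigma>)) \<le> ennreal \<epsilon>)"

lemma approximable_cochain: "approximable \<omega> \<Longrightarrow> \<omega> \<in> cochains S"
  by (simp add: approximable_def)

lemma approximableE:
  assumes "approximable \<omega>" "0 < \<epsilon>"
  obtains u where "u \<in> fin_cochains S" "N (\<lambda>\<sigma>. u \<sigma> - \<omega> \<sigma>) \<le> ennreal \<epsilon>" "N (\<delta> (\<lambda>\<sigma>. u \<sigma> - \<omega> \<sigma>)) \<le> ennreal \<epsilon>"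
  using assms unfolding approximable_def by blast

lemma approximable_l2:
  assumes "approximable \<omega>"
  shows "\<omega> \<in> l2 S m" and "\<delta> \<omega> \<in> l2 S m"
proof -
  obtain u where u: "u \<in> fin_cochains S" "N (\<lambda>\<sigma>. u \<sigma> - \<omega> \<sigma>) \<le> ennreal 1"
      "N (\<delta> (\<lambda>\<sigma>. u \<sigma> - \<omega> \<sigma>)) \<le> ennreal 1"
    using approximableE[OF assms, of 1] by auto
  have cu: "u \<in> cochains S" "\<omega> \<in> cochains S" 
    using u(1) assms fin_cochains_cochain approximable_cochain by auto
  have d: "(\<lambda>\<sigma>. u \<sigma> - \<omega> \<sigma>) \<in> l2 S m" "\<delta> (\<lambda>\<sigma>. u \<sigma> - \<omega> \<sigma>) \<in> l2 S m"
    using l2I[OF cochains_diff[OF cu] _ u(2)] l2I[OF \<delta>_cochain[OF cochains_diff[OF cu]] _ u(3)]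
    by auto
  show "\<omega> \<in> l2 S m"
    using l2_combination[OF d(1) fin_cochain_l2(1)[OF u(1)], of "-1"] by simp
  show "\<delta> \<omega> \<in> l2 S m"
    using l2_combination[OF d(2) fin_cochain_l2(2)[OF u(1)], of "-1"] by (simp add: \<delta>_diff cu)
qed

lemma approximable_fin: "u \<in> fin_cochains S \<Longrightarrow> approximable u"
  unfolding approximable_def
  by (auto simp: fin_cochains_cochain \<delta>_zero l2_normsq_def intro!: bexI[of _ u])

lemma approximable_combination:
  assumes "approximable f" "approximable g"
  shows "approximable (\<lambda>\<sigma>. c * f \<sigma> + g \<sigma>)"
  unfolding approximable_def
proof (intro conjI allI impI)
  show "(\<lambda>\<sigma>. c * f \<sigma> + g \<sigma>) \<in> cochains S"
    using assms by (intro cochains_combination approximable_cochain)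
  fix \<epsilon> :: real assume "0 < \<epsilon>"
  define \<epsilon>' where "\<epsilon>' = \<epsilon> / (2 * (cmod c)\<^sup>2 + 2)"
  have pos: "0 < 2 * (cmod c)\<^sup>2 + 2" by (simp add: add_nonneg_pos)
  then have "0 < \<epsilon>'" using \<open>0 < \<epsilon>\<close> by (simp add: \<epsilon>'_def)
  moreover have "2 * (cmod c)\<^sup>2 * \<epsilon>' + 2 * \<epsilon>' = (2 * (cmod c)\<^sup>2 + 2) * \<epsilon>'" by (simp add: distrib_right)
  ultimately have \<epsilon>': "0 < \<epsilon>'" "2 * (cmod c)\<^sup>2 * \<epsilon>' + 2 * \<epsilon>' = \<epsilon>"
    using pos by (simp_all add: \<epsilon>'_def)
  obtain u where u: "u \<in> fin_cochains S" "N (\<lambda>\<sigma>. u \<sigma> - f \<sigma>) \<le> ennreal \<epsilon>'"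
      "N (\<delta> (\<lambda>\<sigma>. u \<sigma> - f \<sigma>)) \<le> ennreal \<epsilon>'"
    using approximableE[OF assms(1) \<epsilon>'(1)] by blast
  obtain v where v: "v \<in> fin_cochains S" "N (\<lambda>\<sigma>. v \<sigma> - g \<sigma>) \<le> ennreal \<epsilon>'"
      "N (\<delta> (\<lambda>\<sigma>. v \<sigma> - g \<sigma>)) \<le> ennreal \<epsilon>'"
    using approximableE[OF assms(2) \<epsilon>'(1)] by blast
  have cochains: "(\<lambda>\<sigma>. u \<sigma> - f \<sigma>) \<in> cochains S" "(\<lambda>\<sigma>. v \<sigma> - g \<sigma>) \<in> cochains S"
    using cochains_diff fin_cochains_cochain[OF u(1)] fin_cochains_cochain[OF v(1)]
      assms[THEN approximable_cochain] by blast+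
  have eq: "(\<lambda>\<sigma>. c * u \<sigma> + v \<sigma> - (c * f \<sigma> + g \<sigma>)) = (\<lambda>\<sigma>. c * (u \<sigma> - f \<sigma>) + (v \<sigma> - g \<sigma>))"
    by (auto simp: algebra_simps)
  show "\<exists>w\<in>fin_cochains S. N (\<lambda>\<sigma>. w \<sigma> - (c * f \<sigma> + g \<sigma>)) \<le> ennreal \<epsilon>
          \<and> N (\<delta> (\<lambda>\<sigma>. w \<sigma> - (c * f \<sigma> + g \<sigma>))) \<le> ennreal \<epsilon>"
  proof (intro bexI conjI)
    show "(\<lambda>\<sigma>. c * u \<sigma> + v \<sigma>) \<in> fin_cochains S"
      by (rule fin_cochains_combination[OF u(1) v(1)])
    show "N (\<lambda>\<sigma>. c * u \<sigma> + v \<sigma> - (c * f \<sigma> + g \<sigma>)) \<le> ennreal \<epsilon>"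
      unfolding eq using N_combination_le[OF u(2) v(2), of c] \<epsilon>' by simp
    show "N (\<delta> (\<lambda>\<sigma>. c * u \<sigma> + v \<sigma> - (c * f \<sigma> + g \<sigma>))) \<le> ennreal \<epsilon>"
      unfolding eq \<delta>_combination[OF cochains] using N_combination_le[OF u(3) v(3), of c] \<epsilon>' by simp
  qed
qed

lemma approximable_limit:
  assumes f: "f \<in> cochains S"
    and lim: "\<And>\<epsilon>. 0 < \<epsilon> \<Longrightarrow> \<exists>g. approximable g \<and> N (\<lambda>\<sigma>. g \<sigma> - f \<sigma>) \<le> ennreal \<epsilon> \<and> N (\<delta> (\<lambda>\<sigma>. g \<sigma> - f \<sigma>)) \<le> ennreal \<epsilon>"
  shows "approximable f"
  unfolding approximable_def
proof (intro conjI allI impI f)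
  fix \<epsilon> :: real assume "0 < \<epsilon>"
  then have \<epsilon>: "0 < \<epsilon> / 4" by simp
  obtain g where g: "approximable g" "N (\<lambda>\<sigma>. g \<sigma> - f \<sigma>) \<le> ennreal (\<epsilon> / 4)"
      "N (\<delta> (\<lambda>\<sigma>. g \<sigma> - f \<sigma>)) \<le> ennreal (\<epsilon> / 4)" using lim[OF \<epsilon>] by blast
  obtain u where u: "u \<in> fin_cochains S" "N (\<lambda>\<sigma>. u \<sigma> - g \<sigma>) \<le> ennreal (\<epsilon> / 4)"
      "N (\<delta> (\<lambda>\<sigma>. u \<sigma> - g \<sigma>)) \<le> ennreal (\<epsilon> / 4)"
    using approximableE[OF g(1) \<epsilon>] by blast
  have cochains: "(\<lambda>\<sigma>. u \<sigma> - g \<sigma>) \<in> cochains S" "(\<lambda>\<sigma>. g \<sigma> - f \<sigma>) \<in> cochains S"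
    using cochains_diff fin_cochains_cochain[OF u(1)] approximable_cochain[OF g(1)] f by blast+
  have eq: "(\<lambda>\<sigma>. u \<sigma> - f \<sigma>) = (\<lambda>\<sigma>. (u \<sigma> - g \<sigma>) + (g \<sigma> - f \<sigma>))" by auto
  have "N (\<lambda>\<sigma>. u \<sigma> - f \<sigma>) \<le> ennreal \<epsilon>"
    unfolding eq using N_add_le[OF u(2) g(2)] \<epsilon> by simp
  moreover have "N (\<delta> (\<lambda>\<sigma>. u \<sigma> - f \<sigma>)) \<le> ennreal \<epsilon>"
    unfolding eq using \<delta>_combination[OF cochains, of 1] N_add_le[OF u(3) g(3)] \<epsilon> by simp
  ultimately show "\<exists>u\<in>fin_cochains S. N (\<lambda>\<sigma>. u \<sigma> - f \<sigma>) \<le> ennreal \<epsilon> \<and> N (\<delta> (\<lambda>\<sigma>. u \<sigma> - f \<sigma>)) \<le> ennreal \<epsilon>"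
    using u(1) by blast
qed

lemma N_tendsto_zeroD:
  assumes "(\<lambda>n. N (u n)) \<longlonglongrightarrow> 0" "0 < \<epsilon>"
  shows "\<forall>\<^sub>F n in sequentially. N (u n) \<le> ennreal \<epsilon>"
proof -
  have "0 < ennreal \<epsilon>" using \<open>0 < \<epsilon>\<close> by simp
  from order_tendstoD(2)[OF assms(1) this] show ?thesis
    by (rule eventually_mono) (rule less_imp_le)
qed

lemma delta_D_eq: "delta_D S m \<delta> = {(\<omega>, \<delta> \<omega>) | \<omega>. approximable \<omega>}"
proof -
  have approximable: "approximable \<omega>"
    if \<omega>: "\<omega> \<in> l2 S m" and u: "\<forall>n. u n \<in> fin_cochains S"
      and lim: "(\<lambda>n. N (\<lambda>\<sigma>. u n \<sigma> - \<omega> \<sigma>) + N (\<delta> (\<lambda>\<sigma>. u n \<sigma> - \<omega> \<sigma>))) \<longlonglongrightarrow> 0"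
    for \<omega> and u :: "nat \<Rightarrow> 'v set \<Rightarrow> complex"
    unfolding approximable_def
  proof (intro conjI allI impI)
    show "\<omega> \<in> cochains S" using \<omega> by (rule l2_cochain)
    fix \<epsilon> :: real assume "0 < \<epsilon>"
    then have "0 < ennreal \<epsilon>" by simp
    obtain n where n: "N (\<lambda>\<sigma>. u n \<sigma> - \<omega> \<sigma>) + N (\<delta> (\<lambda>\<sigma>. u n \<sigma> - \<omega> \<sigma>)) < ennreal \<epsilon>"
      using eventually_happens[OF order_tendstoD(2)[OF lim \<open>0 < ennreal \<epsilon>\<close>]] by auto
    have "a \<le> ennreal \<epsilon> \<and> b \<le> ennreal \<epsilon>" if "a + b < ennreal \<epsilon>" for a b :: ennreal
      using that order_trans[of a "a + b"] order_trans[of b "a + b"]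
      by (simp add: add_increasing add_increasing2 less_imp_le)
    from this[OF n] have "N (\<lambda>\<sigma>. u n \<sigma> - \<omega> \<sigma>) \<le> ennreal \<epsilon>"
      and "N (\<delta> (\<lambda>\<sigma>. u n \<sigma> - \<omega> \<sigma>)) \<le> ennreal \<epsilon>" by auto
    then show "\<exists>u\<in>fin_cochains S. N (\<lambda>\<sigma>. u \<sigma> - \<omega> \<sigma>) \<le> ennreal \<epsilon> \<and> N (\<delta> (\<lambda>\<sigma>. u \<sigma> - \<omega> \<sigma>)) \<le> ennreal \<epsilon>"
      using u by blast
  qed
  have sequence: "\<exists>u :: nat \<Rightarrow> 'v set \<Rightarrow> complex. (\<forall>n. u n \<in> fin_cochains S) \<and>
      (\<lambda>n. N (\<lambda>\<sigma>. u n \<sigma> - \<omega> \<sigma>) + N (\<delta> (\<lambda>\<sigma>. u n \<sigma> - \<omega> \<sigma>))) \<longlonglongrightarrow> 0"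
    if \<omega>: "approximable \<omega>" for \<omega>
  proof -
    have "\<forall>n::nat. \<exists>u. u \<in> fin_cochains S \<and> N (\<lambda>\<sigma>. u \<sigma> - \<omega> \<sigma>) \<le> ennreal (1 / real (Suc n))
        \<and> N (\<delta> (\<lambda>\<sigma>. u \<sigma> - \<omega> \<sigma>)) \<le> ennreal (1 / real (Suc n))"
      using approximableE[OF \<omega>] by (metis of_nat_0_less_iff zero_less_Suc zero_less_divide_1_iff)
    then obtain u where u: "\<forall>n::nat. u n \<in> fin_cochains S \<and> N (\<lambda>\<sigma>. u n \<sigma> - \<omega> \<sigma>) \<le> ennreal (1 / real (Suc n))
        \<and> N (\<delta> (\<lambda>\<sigma>. u n \<sigma> - \<omega> \<sigma>)) \<le> ennreal (1 / real (Suc n))"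
      by (auto dest!: choice)
    have "(\<lambda>n. N (\<lambda>\<sigma>. u n \<sigma> - \<omega> \<sigma>) + N (\<delta> (\<lambda>\<sigma>. u n \<sigma> - \<omega> \<sigma>))) \<longlonglongrightarrow> 0"
    proof (rule tendsto_sandwich[OF _ _ tendsto_const])
      have "(\<lambda>n. ennreal (1 / real (Suc n))) \<longlonglongrightarrow> ennreal 0"
        by (intro tendsto_ennrealI LIMSEQ_Suc[OF lim_const_over_n])
      from tendsto_add[OF this this]
      show "(\<lambda>n. ennreal (1 / real (Suc n)) + ennreal (1 / real (Suc n))) \<longlonglongrightarrow> 0" by simp
      show "\<forall>\<^sub>F n in sequentially. N (\<lambda>\<sigma>. u n \<sigma> - \<omega> \<sigma>) + N (\<delta> (\<lambda>\<sigma>. u n \<sigma> - \<omega> \<sigma>))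
          \<le> ennreal (1 / real (Suc n)) + ennreal (1 / real (Suc n))"
        using u by (intro always_eventually allI add_mono) blast+
      show "\<forall>\<^sub>F n in sequentially. 0 \<le> N (\<lambda>\<sigma>. u n \<sigma> - \<omega> \<sigma>) + N (\<delta> (\<lambda>\<sigma>. u n \<sigma> - \<omega> \<sigma>))"
        by (rule always_eventually) simp
    qed
    then have "(\<forall>n. u n \<in> fin_cochains S) \<and> (\<lambda>n. N (\<lambda>\<sigma>. u n \<sigma> - \<omega> \<sigma>) + N (\<delta> (\<lambda>\<sigma>. u n \<sigma> - \<omega> \<sigma>))) \<longlonglongrightarrow> 0"
      using u by blast
    then show ?thesis by (rule exI[where x = u])
  qed
  show ?thesis
  proof (intro set_eqI iffI)
    fix x assume "x \<in> delta_D S m \<delta>"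
    then obtain \<omega> u where "x = (\<omega>, \<delta> \<omega>)" "\<omega> \<in> l2 S m" "\<forall>n. u n \<in> fin_cochains S"
      "(\<lambda>n. N (\<lambda>\<sigma>. u n \<sigma> - \<omega> \<sigma>) + N (\<delta> (\<lambda>\<sigma>. u n \<sigma> - \<omega> \<sigma>))) \<longlonglongrightarrow> 0"
      unfolding delta_D_def by auto
    with approximable[of \<omega> u] show "x \<in> {(\<omega>, \<delta> \<omega>) | \<omega>. approximable \<omega>}" by auto
  next
    fix x assume "x \<in> {(\<omega>, \<delta> \<omega>) | \<omega>. approximable \<omega>}"
    then obtain \<omega> where \<omega>: "x = (\<omega>, \<delta> \<omega>)" "approximable \<omega>" by auto
    show "x \<in> delta_D S m \<delta>"
      unfolding delta_D_def mem_Collect_eq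
      by (intro exI[of _ \<omega>] conjI \<omega>(1) approximable_l2(1)[OF \<omega>(2)] sequence[OF \<omega>(2)])
  qed
qed

text \<open>Values of \<open>\<delta>\<close> are finite sums, so norm convergence of arguments and images forces the limit pair to
lie on the graph of \<open>\<delta>\<close>; the domain is closed in the graph norm by a diagonal argument.\<close>

lemma closed_delta_D: "closed_operator S m (delta_D S m \<delta>)"
  unfolding closed_operator_def
proof (intro conjI)
  show "delta_D S m \<delta> \<subseteq> l2 S m \<times> l2 S m"
    unfolding delta_D_eq using approximable_l2 by auto
  show "single_valued (delta_D S m \<delta>)"
    unfolding delta_D_eq single_valued_def by auto
  show "((\<lambda>_. 0), (\<lambda>_. 0)) \<in> delta_D S m \<delta>"
    unfolding delta_D_eq using approximable_fin[OF fin_cochains_zero] \<delta>_zero by force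
  show "\<forall>f g f' g' c. (f, g) \<in> delta_D S m \<delta> \<and> (f', g') \<in> delta_D S m \<delta>
      \<longrightarrow> ((\<lambda>\<sigma>. c * f \<sigma> + f' \<sigma>), (\<lambda>\<sigma>. c * g \<sigma> + g' \<sigma>)) \<in> delta_D S m \<delta>"
    unfolding delta_D_eq using approximable_combination \<delta>_combination approximable_cochain by force
  show "\<forall>u v. \<forall>f\<in>l2 S m. \<forall>g\<in>l2 S m.
        (\<forall>n::nat. (u n, v n) \<in> delta_D S m \<delta>) \<and>
        (\<lambda>n. N (\<lambda>\<sigma>. u n \<sigma> - f \<sigma>)) \<longlonglongrightarrow> 0 \<and>
        (\<lambda>n. N (\<lambda>\<sigma>. v n \<sigma> - g \<sigma>)) \<longlonglongrightarrow> 0 \<longrightarrow> (f, g) \<in> delta_D S m \<delta>"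
  proof (intro allI ballI impI, elim conjE)
    fix u v :: "nat \<Rightarrow> 'v set \<Rightarrow> complex" and f g
    assume f: "f \<in> l2 S m" and g: "g \<in> l2 S m"
      and uv: "\<forall>n. (u n, v n) \<in> delta_D S m \<delta>"
      and limu: "(\<lambda>n. N (\<lambda>\<sigma>. u n \<sigma> - f \<sigma>)) \<longlonglongrightarrow> 0"
      and limv: "(\<lambda>n. N (\<lambda>\<sigma>. v n \<sigma> - g \<sigma>)) \<longlonglongrightarrow> 0"
    have u: "approximable (u n)" and v: "v n = \<delta> (u n)" for n
      using uv unfolding delta_D_eq by auto
    have fc: "f \<in> cochains S" using f by (rule l2_cochain)
    have "\<delta> f = g"
    proof
      fix \<sigma>
      show "\<delta> f \<sigma> = g \<sigma>"
      proof (cases "\<sigma> \<in> S")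
        case True
        have "(\<lambda>n. \<Sum>\<tau> | \<tau> \<in> S \<and> face \<tau> \<sigma>. \<theta> \<tau> \<sigma> * u n \<tau>) \<longlonglongrightarrow> (\<Sum>\<tau> | \<tau> \<in> S \<and> face \<tau> \<sigma>. \<theta> \<tau> \<sigma> * f \<tau>)"
          by (intro tendsto_intros pointwise_limit[OF limu]) auto
        then have "(\<lambda>n. v n \<sigma>) \<longlonglongrightarrow> \<delta> f \<sigma>"
          using True by (simp add: v \<delta>_eq approximable_cochain[OF u] fc)
        then show ?thesis
          using pointwise_limit[OF limv True] LIMSEQ_unique by blast
      next
        case False
        then show ?thesis using \<delta>_outside[OF fc False] g by (auto simp: l2_def cochains_def)
      qed
    qed
    moreover have "approximable f"
    proof (rule approximable_limit[OF fc])
      fix \<epsilon> :: real assume "0 < \<epsilon>"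
      have "\<forall>\<^sub>F n in sequentially. N (\<lambda>\<sigma>. u n \<sigma> - f \<sigma>) \<le> ennreal \<epsilon> \<and> N (\<lambda>\<sigma>. v n \<sigma> - g \<sigma>) \<le> ennreal \<epsilon>"
        using N_tendsto_zeroD[OF limu \<open>0 < \<epsilon>\<close>] N_tendsto_zeroD[OF limv \<open>0 < \<epsilon>\<close>] by (rule eventually_conj)
      then obtain n where "N (\<lambda>\<sigma>. u n \<sigma> - f \<sigma>) \<le> ennreal \<epsilon>" "N (\<lambda>\<sigma>. v n \<sigma> - g \<sigma>) \<le> ennreal \<epsilon>"
        using eventually_happens trivial_limit_sequentially by blast
      then show "\<exists>h. approximable h \<and> N (\<lambda>\<sigma>. h \<sigma> - f \<sigma>) \<le> ennreal \<epsilon> \<and> N (\<delta> (\<lambda>\<sigma>. h \<sigma> - f \<sigma>)) \<le> ennreal \<epsilon>"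
        using u[of n] \<open>\<delta> f = g\<close> by (auto simp: \<delta>_diff[OF approximable_cochain[OF u] fc] v intro!: exI[of _ "u n"])
    qed
    ultimately show "(f, g) \<in> delta_D S m \<delta>" unfolding delta_D_eq by blast
  qed
qed

text \<open>If \<open>u\<close> is finitely supported and close to \<open>\<omega>\<close> in the graph norm, then \<open>\<delta> u\<close> is close to
\<open>\<delta> \<omega>\<close> in the graph norm as well, because \<open>\<delta> \<delta> = 0\<close> kills the second component. Hence it is
enough to treat \<open>\<delta> u\<close>, a finite combination of the cochains \<open>\<theta> \<tau>\<close>.\<close>

lemma approximable_\<delta>:
  assumes \<theta>: "\<forall>\<tau>\<in>S. approximable (\<theta> \<tau>)" and \<omega>: "approximable \<omega>"
  shows "approximable (\<delta> \<omega>)"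
proof (rule approximable_limit)
  show "\<delta> \<omega> \<in> cochains S" by (rule \<delta>_cochain[OF approximable_cochain[OF \<omega>]])
  fix \<epsilon> :: real assume \<epsilon>: "0 < \<epsilon>"
  obtain u where u: "u \<in> fin_cochains S" "N (\<delta> (\<lambda>\<sigma>. u \<sigma> - \<omega> \<sigma>)) \<le> ennreal \<epsilon>"
    using approximableE[OF \<omega> \<epsilon>] by blast
  have cochains: "u \<in> cochains S" "\<omega> \<in> cochains S"
    using u(1) \<omega> fin_cochains_cochain approximable_cochain by auto
  have "approximable (\<delta> u)"
    using u(1)
  proof (induction rule: fin_cochain_induct)
    case zero
    then show ?case by (simp add: \<delta>_zero approximable_fin[OF fin_cochains_zero])
  next
    case (add c \<tau> f)
    then show ?case
      using \<theta> approximable_combination by (simp add: \<delta>_combination e_cochain fin_cochains_cochain \<delta>_e)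
  qed
  moreover have "N (\<delta> (\<lambda>\<sigma>. \<delta> u \<sigma> - \<delta> \<omega> \<sigma>)) \<le> ennreal \<epsilon>"
    using \<epsilon> by (simp add: \<delta>_diff \<delta>_cochain cochains \<delta>_\<delta> l2_normsq_def)
  ultimately show "\<exists>g. approximable g \<and> N (\<lambda>\<sigma>. g \<sigma> - \<delta> \<omega> \<sigma>) \<le> ennreal \<epsilon> \<and> N (\<delta> (\<lambda>\<sigma>. g \<sigma> - \<delta> \<omega> \<sigma>)) \<le> ennreal \<epsilon>"
    using u(2) by (auto simp: \<delta>_diff[OF cochains])
qed

lemma ideal_boundary_condition_iff:
  "ideal_boundary_condition S m \<delta> (delta_D S m \<delta>) \<longleftrightarrow> (\<forall>\<tau>\<in>S. approximable (\<theta> \<tau>))"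
proof
  assume "ideal_boundary_condition S m \<delta> (delta_D S m \<delta>)"
  then have range: "Range (delta_D S m \<delta>) \<subseteq> Domain (delta_D S m \<delta>)"
    by (simp add: ideal_boundary_condition_def)
  show "\<forall>\<tau>\<in>S. approximable (\<theta> \<tau>)"
  proof
    fix \<tau> assume "\<tau> \<in> S"
    then have "(e \<tau>, \<theta> \<tau>) \<in> delta_D S m \<delta>"
      unfolding delta_D_eq using approximable_fin[OF e_fin_cochain] \<delta>_e by force
    then have "\<theta> \<tau> \<in> Domain (delta_D S m \<delta>)" using range by blast
    then show "approximable (\<theta> \<tau>)" unfolding delta_D_eq by auto
  qed
next
  assume \<theta>: "\<forall>\<tau>\<in>S. approximable (\<theta> \<tau>)"
  have "delta_D S m \<delta> \<subseteq> delta_N S m \<delta>"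
    unfolding delta_D_eq delta_N_def using approximable_l2 by blast
  moreover have "Range (delta_D S m \<delta>) \<subseteq> Domain (delta_D S m \<delta>)"
    unfolding delta_D_eq using approximable_\<delta>[OF \<theta>] by blast
  ultimately show "ideal_boundary_condition S m \<delta> (delta_D S m \<delta>)"
    using closed_delta_D by (simp add: ideal_boundary_condition_def)
qed

end

section \<open>Boundary operators and duality\<close>

context weighted_complex
begin

text \<open>The bilinear pairing, without complex conjugation: as \<open>\<delta>\<close> has real coefficients, it is dual
to the boundary operator for this form, too.\<close>

definition pairing :: "('v set \<Rightarrow> complex) \<Rightarrow> ('v set \<Rightarrow> complex) \<Rightarrow> complex" where
  "pairing f g = (\<Sum>\<^sub>\<infinity>\<sigma>\<in>S. of_real (m \<sigma>) * f \<sigma> * g \<sigma>)"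

lemma norm_weighted_product: "\<sigma> \<in> S \<Longrightarrow> cmod (of_real (m \<sigma>) * f \<sigma> * g \<sigma>) = m \<sigma> * cmod (f \<sigma>) * cmod (g \<sigma>)"
  using m_pos[of \<sigma>] by (simp add: norm_mult)

lemma norm_summable_pairing:
  assumes "f \<in> l2 S m" "g \<in> l2 S m"
  shows "(\<lambda>\<sigma>. cmod (of_real (m \<sigma>) * f \<sigma> * g \<sigma>)) summable_on S"
proof -
  have "(\<lambda>\<sigma>. m \<sigma> * cmod (f \<sigma>) * cmod (g \<sigma>)) summable_on S"
    using assms by (intro l2.summable_product) (simp_all add: l2_iff)
  then show ?thesis by (rule summable_on_cong[THEN iffD2, rotated]) (rule norm_weighted_product)
qed

lemma summable_pairing:
  assumes "f \<in> l2 S m" "g \<in> l2 S m"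
  shows "(\<lambda>\<sigma>. of_real (m \<sigma>) * f \<sigma> * g \<sigma>) summable_on S"
  by (rule abs_summable_summable[OF norm_summable_pairing[OF assms]])

lemma pairing_combination:
  assumes "f \<in> l2 S m" "g \<in> l2 S m" "h \<in> l2 S m"
  shows "pairing (\<lambda>\<sigma>. c * f \<sigma> + g \<sigma>) h = c * pairing f h + pairing g h"
proof -
  have "pairing (\<lambda>\<sigma>. c * f \<sigma> + g \<sigma>) h
      = (\<Sum>\<^sub>\<infinity>\<sigma>\<in>S. c * (of_real (m \<sigma>) * f \<sigma> * h \<sigma>) + of_real (m \<sigma>) * g \<sigma> * h \<sigma>)"
    unfolding pairing_def by (rule infsum_cong) (simp add: algebra_simps)
  also have "\<dots> = (\<Sum>\<^sub>\<infinity>\<sigma>\<in>S. c * (of_real (m \<sigma>) * f \<sigma> * h \<sigma>)) + pairing g h"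
    unfolding pairing_def
    by (rule infsum_add[OF summable_on_cmult_right[OF summable_pairing[OF assms(1,3)]] summable_pairing[OF assms(2,3)]])
  also have "(\<Sum>\<^sub>\<infinity>\<sigma>\<in>S. c * (of_real (m \<sigma>) * f \<sigma> * h \<sigma>)) = c * pairing f h"
    unfolding pairing_def by (rule infsum_cmult_right')
  finally show ?thesis .
qed

lemma norm_pairing_le:
  assumes f: "f \<in> l2 S m" and g: "g \<in> l2 S m" and C: "N f \<le> ennreal C" "0 \<le> C"
  shows "(cmod (pairing f g))\<^sup>2 \<le> C * l2.ip (\<lambda>\<sigma>. cmod (g \<sigma>)) (\<lambda>\<sigma>. cmod (g \<sigma>))"
proof -
  have "cmod (pairing f g) \<le> (\<Sum>\<^sub>\<infinity>\<sigma>\<in>S. cmod (of_real (m \<sigma>) * f \<sigma> * g \<sigma>))"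
    unfolding pairing_def by (rule norm_infsum_bound[OF norm_summable_pairing[OF f g]])
  also have "\<dots> = l2.ip (\<lambda>\<sigma>. cmod (f \<sigma>)) (\<lambda>\<sigma>. cmod (g \<sigma>))"
    unfolding l2.ip_def by (rule infsum_cong) (rule norm_weighted_product)
  finally have "(cmod (pairing f g))\<^sup>2 \<le> (l2.ip (\<lambda>\<sigma>. cmod (f \<sigma>)) (\<lambda>\<sigma>. cmod (g \<sigma>)))\<^sup>2"
    by (rule power_mono) simp
  also have "\<dots> \<le> l2.ip (\<lambda>\<sigma>. cmod (f \<sigma>)) (\<lambda>\<sigma>. cmod (f \<sigma>)) * l2.ip (\<lambda>\<sigma>. cmod (g \<sigma>)) (\<lambda>\<sigma>. cmod (g \<sigma>))"
    using f g by (intro l2.Cauchy_Schwarz) (simp_all add: l2_iff)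
  also have "\<dots> \<le> C * l2.ip (\<lambda>\<sigma>. cmod (g \<sigma>)) (\<lambda>\<sigma>. cmod (g \<sigma>))"
    by (rule mult_right_mono[OF N_leD(2)[OF C] l2.ip_self_nonneg])
  finally show ?thesis .
qed

text \<open>Incidence numbers vanish off the cofaces of \<open>\<rho>\<close>, so the sum over the cofaces extends to all
simplices. This expresses the boundary by the pairing, whose continuity and linearity are at hand.\<close>

lemma boundary_fun_eq:
  assumes \<rho>: "\<rho> \<in> S"
  shows "boundary_fun S m \<delta> \<omega> \<rho> = pairing (\<theta> \<rho>) \<omega> / of_real (m \<rho>)"
proof -
  have "(\<Sum>\<^sub>\<infinity>\<tau>\<in>{\<tau>\<in>S. face \<rho> \<tau>}. of_real (m \<tau>) * \<theta> \<rho> \<tau> * \<omega> \<tau>) = pairing (\<theta> \<rho>) \<omega>"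
    unfolding pairing_def by (rule infsum_cong_neutral) (auto simp: \<theta>_zero[OF \<rho>])
  then show ?thesis using \<rho> by (simp add: boundary_fun_def)
qed

lemma boundary_fun_outside: "\<rho> \<notin> S \<Longrightarrow> boundary_fun S m \<delta> \<omega> \<rho> = 0"
  by (simp add: boundary_fun_def)

text \<open>Over the cofaces of a simplex the weights are summable, so square summability implies
summability there, by \<open>t \<le> 1 + t\<^sup>2\<close>.\<close>

lemma l2_boundary_dom:
  assumes \<omega>: "\<omega> \<in> l2 S m"
  shows "\<omega> \<in> boundary_dom S m"
  unfolding boundary_dom_def
proof (intro CollectI conjI ballI)
  show "\<omega> \<in> cochains S" by (rule l2_cochain[OF \<omega>])
  fix \<rho> assume \<rho>: "\<rho> \<in> S"
  have "(\<lambda>\<tau>. m \<tau> * (cmod (\<omega> \<tau>))\<^sup>2) summable_on {\<tau>\<in>S. face \<rho> \<tau>}"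
    by (rule summable_on_subset_banach[of _ S]) (use \<omega> in \<open>auto simp: l2_iff l2.square_summable_def\<close>)
  from summable_on_add[OF m_summable_cofaces[OF \<rho>] this]
  show "(\<lambda>\<tau>. m \<tau> * cmod (\<omega> \<tau>)) summable_on {\<tau>\<in>S. face \<rho> \<tau>}"
  proof (rule summable_on_comparison_test)
    fix \<tau> assume "\<tau> \<in> {\<tau>\<in>S. face \<rho> \<tau>}"
    then have "0 < m \<tau>" using m_pos by simp
    have "cmod (\<omega> \<tau>) \<le> 1 + (cmod (\<omega> \<tau>))\<^sup>2"
      using sum_squares_bound[of 1 "cmod (\<omega> \<tau>)"] norm_ge_zero[of "\<omega> \<tau>"] by (simp del: norm_ge_zero)
    from mult_left_mono[OF this, of "m \<tau>"] \<open>0 < m \<tau>\<close>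
    show "m \<tau> * cmod (\<omega> \<tau>) \<le> m \<tau> + m \<tau> * (cmod (\<omega> \<tau>))\<^sup>2" by (simp add: distrib_left)
    show "0 \<le> m \<tau> * cmod (\<omega> \<tau>)" using \<open>0 < m \<tau>\<close> by simp
  qed
qed

lemma boundary_N_iff:
  "(\<omega>, \<eta>) \<in> boundary_N S m \<delta> \<longleftrightarrow> \<omega> \<in> l2 S m \<and> \<eta> \<in> l2 S m \<and> \<eta> = boundary_fun S m \<delta> \<omega>"
  using l2_boundary_dom[of \<omega>] by (auto simp: boundary_N_def boundary_def)

lemma boundary_zero_iff:
  assumes "\<eta> \<in> l2 S m"
  shows "(\<eta>, (\<lambda>_. 0)) \<in> boundary S m \<delta> \<longleftrightarrow> (\<forall>\<rho>\<in>S. pairing (\<theta> \<rho>) \<eta> = 0)"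
proof -
  have "(\<lambda>_. 0) = boundary_fun S m \<delta> \<eta> \<longleftrightarrow> (\<forall>\<rho>\<in>S. pairing (\<theta> \<rho>) \<eta> = 0)"
  proof
    assume zero: "(\<lambda>_. 0) = boundary_fun S m \<delta> \<eta>"
    show "\<forall>\<rho>\<in>S. pairing (\<theta> \<rho>) \<eta> = 0"
    proof
      fix \<rho> assume "\<rho> \<in> S"
      then show "pairing (\<theta> \<rho>) \<eta> = 0"
        using fun_cong[OF zero, of \<rho>] m_pos[of \<rho>] by (simp add: boundary_fun_eq)
    qed
  next
    assume zero: "\<forall>\<rho>\<in>S. pairing (\<theta> \<rho>) \<eta> = 0"
    show "(\<lambda>_. 0) = boundary_fun S m \<delta> \<eta>"
    proof
      show "0 = boundary_fun S m \<delta> \<eta> \<rho>" for \<rho>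
        using zero by (cases "\<rho> \<in> S") (simp_all add: boundary_fun_eq boundary_fun_outside)
    qed
  qed
  then show ?thesis using l2_boundary_dom[OF assms] by (simp add: boundary_def)
qed

lemma pairing_e: "\<tau> \<in> S \<Longrightarrow> pairing (e \<tau>) \<eta> = of_real (m \<tau>) * \<eta> \<tau>"
proof -
  assume \<tau>: "\<tau> \<in> S"
  have "pairing (e \<tau>) \<eta> = (\<Sum>\<^sub>\<infinity>\<sigma>\<in>{\<tau>}. of_real (m \<sigma>) * \<eta> \<sigma>)"
    unfolding pairing_def by (rule infsum_cong_neutral) (use \<tau> in \<open>auto simp: indicator_def\<close>)
  then show ?thesis by simp
qed

lemma Green_formula:
  assumes u: "u \<in> fin_cochains S" and b: "(\<omega>, \<eta>) \<in> boundary_N S m \<delta>"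
  shows "pairing u \<eta> = pairing (\<delta> u) \<omega>"
  using u
proof (induction rule: fin_cochain_induct)
  case zero
  show ?case by (simp add: \<delta>_zero pairing_def)
next
  case (add c \<tau> f)
  have l2: "\<omega> \<in> l2 S m" "\<eta> \<in> l2 S m" and \<eta>: "\<eta> = boundary_fun S m \<delta> \<omega>"
    using b unfolding boundary_N_iff by fast+
  have "pairing (e \<tau>) \<eta> = pairing (\<theta> \<tau>) \<omega>"
    using m_pos[OF add.hyps(1)] add.hyps(1) by (simp add: pairing_e \<eta> boundary_fun_eq)
  then show ?case
    using add l2 fin_cochain_l2[OF add.hyps(2)] e_l2[OF add.hyps(1)] \<theta>_l2[OF add.hyps(1)]
    by (simp add: \<delta>_combination e_cochain fin_cochains_cochain \<delta>_e pairing_combination)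
qed

lemma \<delta>_\<theta>: "\<rho> \<in> S \<Longrightarrow> \<delta> (\<theta> \<rho>) = (\<lambda>_. 0)"
  using \<delta>_\<delta>[OF e_cochain, of \<rho>] by (simp add: \<delta>_e)

text \<open>Let \<open>u\<close> be finitely supported with \<open>u\<close> close to \<open>\<theta> \<rho>\<close> and \<open>\<delta> u\<close> close to \<open>\<delta> (\<theta> \<rho>) = 0\<close>. Then
\<open>pairing (\<theta> \<rho>) \<eta>\<close> is close to \<open>pairing u \<eta>\<close>, which equals \<open>pairing (\<delta> u) \<omega>\<close> by Green's formula
and is therefore small.\<close>

lemma boundary_boundary_N_if_approximable:
  assumes appr: "\<forall>\<tau>\<in>S. approximable (\<theta> \<tau>)" and b: "(\<omega>, \<eta>) \<in> boundary_N S m \<delta>"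
  shows "(\<eta>, (\<lambda>_. 0)) \<in> boundary S m \<delta>"
proof -
  have l2: "\<omega> \<in> l2 S m" "\<eta> \<in> l2 S m" using b unfolding boundary_N_iff by fast+
  let ?A = "l2.ip (\<lambda>\<sigma>. cmod (\<eta> \<sigma>)) (\<lambda>\<sigma>. cmod (\<eta> \<sigma>))" and ?B = "l2.ip (\<lambda>\<sigma>. cmod (\<omega> \<sigma>)) (\<lambda>\<sigma>. cmod (\<omega> \<sigma>))"
  have "pairing (\<theta> \<rho>) \<eta> = 0" if \<rho>: "\<rho> \<in> S" for \<rho>
  proof -
    have bound: "(cmod (pairing (\<theta> \<rho>) \<eta>))\<^sup>2 \<le> \<epsilon> * (2 * ?A + 2 * ?B)" if \<epsilon>: "0 < \<epsilon>" for \<epsilon>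
    proof -
      have "approximable (\<theta> \<rho>)" using appr \<rho> by blast
      then obtain u where u: "u \<in> fin_cochains S" "N (\<lambda>\<sigma>. u \<sigma> - \<theta> \<rho> \<sigma>) \<le> ennreal \<epsilon>"
          "N (\<delta> (\<lambda>\<sigma>. u \<sigma> - \<theta> \<rho> \<sigma>)) \<le> ennreal \<epsilon>" using \<epsilon> by (rule approximableE)
      have c: "u \<in> cochains S" "\<theta> \<rho> \<in> cochains S"
        using fin_cochains_cochain[OF u(1)] l2_cochain[OF \<theta>_l2[OF \<rho>]] .
      have \<delta>u: "N (\<delta> u) \<le> ennreal \<epsilon>" using u(3) by (simp add: \<delta>_diff[OF c] \<delta>_\<theta>[OF \<rho>])
      have d: "(\<lambda>\<sigma>. u \<sigma> - \<theta> \<rho> \<sigma>) \<in> l2 S m"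
        using l2_combination[OF \<theta>_l2[OF \<rho>] fin_cochain_l2(1)[OF u(1)], of "-1"] by simp
      let ?a = "cmod (pairing (\<lambda>\<sigma>. u \<sigma> - \<theta> \<rho> \<sigma>) \<eta>)" and ?b = "cmod (pairing (\<delta> u) \<omega>)"
      have "pairing (\<lambda>\<sigma>. (-1) * (u \<sigma> - \<theta> \<rho> \<sigma>) + u \<sigma>) \<eta>
          = (-1) * pairing (\<lambda>\<sigma>. u \<sigma> - \<theta> \<rho> \<sigma>) \<eta> + pairing u \<eta>"
        by (rule pairing_combination[OF d fin_cochain_l2(1)[OF u(1)] l2(2)])
      then have "pairing (\<theta> \<rho>) \<eta> = pairing (\<delta> u) \<omega> - pairing (\<lambda>\<sigma>. u \<sigma> - \<theta> \<rho> \<sigma>) \<eta>"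
        using Green_formula[OF u(1) b] by simp
      then have "cmod (pairing (\<theta> \<rho>) \<eta>) \<le> ?b + ?a"
        by (simp only: norm_triangle_ineq4)
      then have "cmod (pairing (\<theta> \<rho>) \<eta>) \<le> ?a + ?b" by simp
      then have "(cmod (pairing (\<theta> \<rho>) \<eta>))\<^sup>2 \<le> (?a + ?b)\<^sup>2" by (rule power_mono) simp
      also have "\<dots> \<le> 2 * ?a\<^sup>2 + 2 * ?b\<^sup>2"
        using sum_squares_bound[of ?a ?b] by (simp add: power2_sum)
      also have "\<dots> \<le> 2 * (\<epsilon> * ?A) + 2 * (\<epsilon> * ?B)"
        using norm_pairing_le[OF d l2(2) u(2)] norm_pairing_le[OF fin_cochain_l2(2)[OF u(1)] l2(1) \<delta>u] \<epsilon>
        by simp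
      finally show ?thesis by (simp add: algebra_simps)
    qed
    have "(cmod (pairing (\<theta> \<rho>) \<eta>))\<^sup>2 \<le> 0"
    proof (rule field_le_epsilon)
      fix r :: real assume "0 < r"
      define D where "D = 2 * ?A + 2 * ?B + 1"
      have D: "0 < D" "2 * ?A + 2 * ?B \<le> D"
        using l2.ip_self_nonneg[of "\<lambda>\<sigma>. cmod (\<eta> \<sigma>)"] l2.ip_self_nonneg[of "\<lambda>\<sigma>. cmod (\<omega> \<sigma>)"]
        by (auto simp: D_def)
      have "(cmod (pairing (\<theta> \<rho>) \<eta>))\<^sup>2 \<le> r / D * (2 * ?A + 2 * ?B)"
        using bound[of "r / D"] \<open>0 < r\<close> D(1) by simp
      also have "\<dots> \<le> r / D * D" using \<open>0 < r\<close> D by (intro mult_left_mono) auto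
      also have "\<dots> = 0 + r" using D(1) by simp
      finally show "(cmod (pairing (\<theta> \<rho>) \<eta>))\<^sup>2 \<le> 0 + r" .
    qed
    then show ?thesis by simp
  qed
  then show ?thesis using boundary_zero_iff[OF l2(2)] by simp
qed

text \<open>The direct sum of two copies of the Hilbert space is realised over the index set
\<open>S \<times> UNIV\<close> with a boolean tag: tag \<open>True\<close> for the first component.\<close>

lemma infsum_Times_bool:
  fixes h :: "'v set \<times> bool \<Rightarrow> real"
  assumes "(\<lambda>\<sigma>. h (\<sigma>, True)) summable_on S" "(\<lambda>\<sigma>. h (\<sigma>, False)) summable_on S"
  shows "h summable_on S \<times> UNIV"
    and "infsum h (S \<times> UNIV) = (\<Sum>\<^sub>\<infinity>\<sigma>\<in>S. h (\<sigma>, True)) + (\<Sum>\<^sub>\<infinity>\<sigma>\<in>S. h (\<sigma>, False))"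
proof -
  have has_sum: "(h has_sum (\<Sum>\<^sub>\<infinity>\<sigma>\<in>S. h (\<sigma>, b))) ((\<lambda>\<sigma>. (\<sigma>, b)) ` S)"
    if "(\<lambda>\<sigma>. h (\<sigma>, b)) summable_on S" for b
    using has_sum_infsum[OF that] by (subst has_sum_reindex) (auto simp: inj_on_def o_def)
  have "(h has_sum ((\<Sum>\<^sub>\<infinity>\<sigma>\<in>S. h (\<sigma>, True)) + (\<Sum>\<^sub>\<infinity>\<sigma>\<in>S. h (\<sigma>, False))))
      ((\<lambda>\<sigma>. (\<sigma>, True)) ` S \<union> (\<lambda>\<sigma>. (\<sigma>, False)) ` S)"
    by (rule has_sum_Un_disjoint[OF has_sum[OF assms(1)] has_sum[OF assms(2)]]) auto
  also have "(\<lambda>\<sigma>. (\<sigma>, True)) ` S \<union> (\<lambda>\<sigma>. (\<sigma>, False)) ` S = S \<times> UNIV"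
    by (auto simp: UNIV_bool)
  finally have *: "(h has_sum ((\<Sum>\<^sub>\<infinity>\<sigma>\<in>S. h (\<sigma>, True)) + (\<Sum>\<^sub>\<infinity>\<sigma>\<in>S. h (\<sigma>, False)))) (S \<times> UNIV)" .
  show "h summable_on S \<times> UNIV" using * by (rule has_sum_imp_summable)
  show "infsum h (S \<times> UNIV) = (\<Sum>\<^sub>\<infinity>\<sigma>\<in>S. h (\<sigma>, True)) + (\<Sum>\<^sub>\<infinity>\<sigma>\<in>S. h (\<sigma>, False))"
    using * by (rule infsumI)
qed

lemma summable_Times_boolD:
  fixes h :: "'v set \<times> bool \<Rightarrow> real"
  assumes "h summable_on S \<times> UNIV"
  shows "(\<lambda>\<sigma>. h (\<sigma>, b)) summable_on S"
proof -
  have "h summable_on (\<lambda>\<sigma>. (\<sigma>, b)) ` S"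
    using assms by (rule summable_on_subset_banach) auto
  then show ?thesis by (subst (asm) summable_on_reindex) (auto simp: inj_on_def o_def)
qed

sublocale pair: weighted_l2 "S \<times> (UNIV :: bool set)" "\<lambda>p. m (fst p)"
  by unfold_locales (auto simp: m_pos)

lemma pair_square_summable_iff:
  "pair.square_summable f \<longleftrightarrow>
     l2.square_summable (\<lambda>\<sigma>. f (\<sigma>, True)) \<and> l2.square_summable (\<lambda>\<sigma>. f (\<sigma>, False))"
proof
  assume "pair.square_summable f"
  then have "(\<lambda>\<sigma>. m (fst (\<sigma>, b)) * (f (\<sigma>, b))\<^sup>2) summable_on S" for b
    unfolding pair.square_summable_def by (rule summable_Times_boolD)
  then show "l2.square_summable (\<lambda>\<sigma>. f (\<sigma>, True)) \<and> l2.square_summable (\<lambda>\<sigma>. f (\<sigma>, False))"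
    by (simp add: l2.square_summable_def)
next
  assume "l2.square_summable (\<lambda>\<sigma>. f (\<sigma>, True)) \<and> l2.square_summable (\<lambda>\<sigma>. f (\<sigma>, False))"
  then show "pair.square_summable f"
    unfolding pair.square_summable_def l2.square_summable_def by (intro infsum_Times_bool(1)) simp_all
qed

lemma pair_ip:
  assumes "pair.square_summable f" "pair.square_summable g"
  shows "pair.ip f g = l2.ip (\<lambda>\<sigma>. f (\<sigma>, True)) (\<lambda>\<sigma>. g (\<sigma>, True)) + l2.ip (\<lambda>\<sigma>. f (\<sigma>, False)) (\<lambda>\<sigma>. g (\<sigma>, False))"
proof -
  have "(\<lambda>\<sigma>. m (fst (\<sigma>, b)) * f (\<sigma>, b) * g (\<sigma>, b)) summable_on S" for b
    using assms unfolding pair_square_summable_iff by (cases b) (simp_all add: l2.summable_product)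
  from infsum_Times_bool(2)[OF this this] show ?thesis
    by (simp add: pair.ip_def l2.ip_def)
qed

lemma Re_square_summable:
  assumes "f \<in> l2 S m"
  shows "l2.square_summable (\<lambda>\<sigma>. Re (f \<sigma>))"
  unfolding l2.square_summable_def
proof (rule summable_on_comparison_test)
  show "(\<lambda>\<sigma>. m \<sigma> * (cmod (f \<sigma>))\<^sup>2) summable_on S"
    using assms by (simp add: l2_iff l2.square_summable_def)
  fix \<sigma> assume "\<sigma> \<in> S"
  then show "0 \<le> m \<sigma> * (Re (f \<sigma>))\<^sup>2" by (rule l2.weighted_square_nonneg)
  show "m \<sigma> * (Re (f \<sigma>))\<^sup>2 \<le> m \<sigma> * (cmod (f \<sigma>))\<^sup>2"
    using m_pos[OF \<open>\<sigma> \<in> S\<close>] by (simp add: cmod_power2)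
qed

lemma N_le_real:
  assumes "l2.square_summable g" "\<And>\<sigma>. \<sigma> \<in> S \<Longrightarrow> (cmod (f \<sigma>))\<^sup>2 = (g \<sigma>)\<^sup>2"
  shows "N f \<le> ennreal (l2.ip g g)"
proof (subst N_le_iff[OF l2.ip_self_nonneg], intro allI impI)
  fix F assume F: "finite F \<and> F \<subseteq> S"
  then have "(\<Sum>\<tau>\<in>F. m \<tau> * (cmod (f \<tau>))\<^sup>2) = (\<Sum>\<tau>\<in>F. m \<tau> * (g \<tau>)\<^sup>2)"
    by (intro sum.cong refl) (auto simp: assms(2))
  also have "\<dots> \<le> l2.ip g g"
    unfolding l2.ip_self using F assms(1) l2.weighted_square_nonneg
    by (intro finite_sum_le_infsum) (auto simp: l2.square_summable_def)
  finally show "(\<Sum>\<tau>\<in>F. m \<tau> * (cmod (f \<tau>))\<^sup>2) \<le> l2.ip g g" .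
qed

lemma Im_\<theta>: "\<tau> \<in> S \<Longrightarrow> Im (\<theta> \<tau> \<sigma>) = 0"
  using \<theta>_cases[of \<tau> \<sigma>] \<theta>_zero[of \<tau> \<sigma>] \<theta>_outside[of \<tau> \<sigma>]
  by (cases "\<sigma> \<in> S"; cases "face \<tau> \<sigma>") auto

lemma Im_\<delta>:
  assumes "\<omega> \<in> cochains S" "\<And>\<sigma>. Im (\<omega> \<sigma>) = 0"
  shows "Im (\<delta> \<omega> \<sigma>) = 0"
proof (cases "\<sigma> \<in> S")
  case True
  have "Im (\<delta> \<omega> \<sigma>) = (\<Sum>\<tau> | \<tau> \<in> S \<and> face \<tau> \<sigma>. Im (\<theta> \<tau> \<sigma> * \<omega> \<tau>))"
    by (simp add: \<delta>_eq[OF assms(1) True] Im_sum)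
  also have "\<dots> = 0" by (rule sum.neutral) (simp add: assms(2) Im_\<theta>)
  finally show ?thesis .
qed (simp add: \<delta>_outside assms(1))

lemma pairing_of_real:
  assumes "l2.square_summable f'" "l2.square_summable g'"
    and "\<And>\<sigma>. \<sigma> \<in> S \<Longrightarrow> f \<sigma> = of_real (f' \<sigma>)" "\<And>\<sigma>. \<sigma> \<in> S \<Longrightarrow> g \<sigma> = of_real (g' \<sigma>)"
  shows "pairing f g = of_real (l2.ip f' g')"
proof -
  have "pairing f g = (\<Sum>\<^sub>\<infinity>\<sigma>\<in>S. of_real (m \<sigma> * f' \<sigma> * g' \<sigma>))"
    unfolding pairing_def by (rule infsum_cong) (simp add: assms(3,4))
  also have "\<dots> = of_real (l2.ip f' g')"
    unfolding l2.ip_def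
    by (rule infsumI[OF has_sum_of_real[OF has_sum_infsum[OF l2.summable_product[OF assms(1,2)]]]])
  finally show ?thesis .
qed

lemma of_real_Re: "Im z = 0 \<Longrightarrow> of_real (Re z) = z"
  by (simp add: complex_eq_iff)

definition graph_point :: "('v set \<Rightarrow> complex) \<Rightarrow> 'v set \<times> bool \<Rightarrow> real" where
  "graph_point u p = (if snd p then Re (u (fst p)) else Re (\<delta> u (fst p)))"

text \<open>Real cochains suffice, since \<open>\<theta> \<rho>\<close> is real. Let \<open>W\<close> be the graph of \<open>\<delta>\<close> over the real finitely
supported cochains. A pair \<open>(a, b)\<close> orthogonal to \<open>W\<close> satisfies \<open>a = - \<partial> b\<close>, as one sees by
testing with indicators of simplices, so \<open>b\<close> is in the domain of \<open>\<partial>\<^sub>N\<close>. The inner product of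
\<open>(\<theta> \<rho>, 0)\<close> with \<open>(a, b)\<close> is then \<open>- m \<rho> * \<partial> (\<partial> b) \<rho> = 0\<close>, and duality puts \<open>(\<theta> \<rho>, 0)\<close>
into the closure of \<open>W\<close>.\<close>

lemma approximable_if_boundary_boundary_N:
  assumes bb: "\<forall>\<omega> \<eta>. (\<omega>, \<eta>) \<in> boundary_N S m \<delta> \<longrightarrow> (\<eta>, (\<lambda>_. 0)) \<in> boundary S m \<delta>"
    and \<rho>: "\<rho> \<in> S"
  shows "approximable (\<theta> \<rho>)"
proof -
  let ?W = "{graph_point u | u. u \<in> fin_cochains S \<and> (\<forall>\<sigma>. Im (u \<sigma>) = 0)}"
  define x where "x p = (if snd p then Re (\<theta> \<rho> (fst p)) else 0)" for p :: "'v set \<times> bool"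
  have \<theta>\<rho>: "\<theta> \<rho> \<in> l2 S m" using \<rho> by (rule \<theta>_l2)
  have x: "pair.square_summable x"
    unfolding pair_square_summable_iff using Re_square_summable[OF \<theta>\<rho>]
    by (simp add: x_def l2.square_summable_def)
  have W: "pair.square_summable (graph_point u)" if "u \<in> fin_cochains S" for u
    unfolding pair_square_summable_iff
    using Re_square_summable[OF fin_cochain_l2(1)[OF that]] Re_square_summable[OF fin_cochain_l2(2)[OF that]]
    by (simp add: graph_point_def)
  have dual: "pair.ip x r = 0" if r: "pair.square_summable r" and orth: "\<forall>f\<in>?W. pair.ip f r = 0" for r
  proof -
    \<comment> \<open>the cochains \<open>b\<close> and \<open>- a = \<partial> b\<close> are extended by zero to \<open>\<omega>\<close> and \<open>\<eta>\<close>\<close>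
    define a where "a \<sigma> = r (\<sigma>, True)" for \<sigma>
    define b where "b \<sigma> = r (\<sigma>, False)" for \<sigma>
    have ab: "l2.square_summable a" "l2.square_summable b"
      using r unfolding pair_square_summable_iff a_def b_def by auto
    then have ma: "l2.square_summable (\<lambda>\<sigma>. - a \<sigma>)" by (simp add: l2.square_summable_def)
    define \<omega> where "\<omega> \<sigma> = (if \<sigma> \<in> S then complex_of_real (b \<sigma>) else 0)" for \<sigma>
    define \<eta> where "\<eta> \<sigma> = (if \<sigma> \<in> S then complex_of_real (- a \<sigma>) else 0)" for \<sigma>
    have l2: "f \<in> l2 S m" if "l2.square_summable g" "f = (\<lambda>\<sigma>. if \<sigma> \<in> S then complex_of_real (g \<sigma>) else 0)" for f g
      using that by (intro l2I[OF _ l2.ip_self_nonneg N_le_real[OF that(1)]]) (auto simp: cochains_def)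
    have \<omega>: "\<omega> \<in> l2 S m" by (rule l2[OF ab(2)]) (auto simp: \<omega>_def)
    have \<eta>: "\<eta> \<in> l2 S m" by (rule l2[OF ma]) (auto simp: \<eta>_def)
    have pair_\<omega>: "pairing (\<theta> \<tau>) \<omega> = of_real (l2.ip (\<lambda>\<sigma>. Re (\<theta> \<tau> \<sigma>)) b)" if "\<tau> \<in> S" for \<tau>
      by (rule pairing_of_real[OF Re_square_summable[OF \<theta>_l2[OF that]] ab(2)])
        (simp_all add: of_real_Re Im_\<theta> that \<omega>_def)
    have "pairing (\<theta> \<tau>) \<omega> = of_real (m \<tau>) * \<eta> \<tau>" if \<tau>: "\<tau> \<in> S" for \<tau>
    proof -
      have "graph_point (e \<tau>) \<in> ?W" using e_fin_cochain[OF \<tau>] by (auto simp: indicator_def)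
      then have "pair.ip (graph_point (e \<tau>)) r = 0" using orth by blast
      then have "l2.ip (\<lambda>\<sigma>. Re (e \<tau> \<sigma>)) a + l2.ip (\<lambda>\<sigma>. Re (\<theta> \<tau> \<sigma>)) b = 0"
        unfolding pair_ip[OF W[OF e_fin_cochain[OF \<tau>]] r] by (simp add: graph_point_def \<delta>_e a_def[abs_def] b_def[abs_def])
      moreover have "l2.ip (\<lambda>\<sigma>. Re (e \<tau> \<sigma>)) a = m \<tau> * a \<tau>"
      proof -
        have "l2.ip (\<lambda>\<sigma>. Re (e \<tau> \<sigma>)) a = (\<Sum>\<^sub>\<infinity>\<sigma>\<in>{\<tau>}. m \<sigma> * a \<sigma>)"
          unfolding l2.ip_def by (rule infsum_cong_neutral) (use \<tau> in \<open>auto simp: indicator_def\<close>)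
        then show ?thesis by simp
      qed
      ultimately have "l2.ip (\<lambda>\<sigma>. Re (\<theta> \<tau> \<sigma>)) b = m \<tau> * (- a \<tau>)" by simp
      then show ?thesis using \<tau> by (simp add: pair_\<omega> \<eta>_def)
    qed
    then have "boundary_fun S m \<delta> \<omega> \<tau> = \<eta> \<tau>" for \<tau>
      using m_pos[of \<tau>] by (cases "\<tau> \<in> S") (simp_all add: boundary_fun_eq boundary_fun_outside \<eta>_def)
    then have "(\<omega>, \<eta>) \<in> boundary_N S m \<delta>"
      unfolding boundary_N_iff using \<omega> \<eta> by (simp add: fun_eq_iff)
    then have "(\<eta>, (\<lambda>_. 0)) \<in> boundary S m \<delta>" using bb by blast
    then have "pairing (\<theta> \<rho>) \<eta> = 0" using boundary_zero_iff[OF \<eta>] \<rho> by simp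
    moreover have "pairing (\<theta> \<rho>) \<eta> = of_real (l2.ip (\<lambda>\<sigma>. Re (\<theta> \<rho> \<sigma>)) (\<lambda>\<sigma>. - a \<sigma>))"
      by (rule pairing_of_real[OF Re_square_summable[OF \<theta>\<rho>] ma]) (simp_all add: of_real_Re Im_\<theta> \<rho> \<eta>_def)
    moreover have "l2.ip (\<lambda>\<sigma>. Re (\<theta> \<rho> \<sigma>)) (\<lambda>\<sigma>. - a \<sigma>) = - l2.ip (\<lambda>\<sigma>. Re (\<theta> \<rho> \<sigma>)) a"
      by (simp add: l2.ip_def infsum_uminus)
    ultimately have "l2.ip (\<lambda>\<sigma>. Re (\<theta> \<rho> \<sigma>)) a = 0" by simp
    then show "pair.ip x r = 0"
      unfolding pair_ip[OF x r] by (simp add: x_def a_def l2.ip_def)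
  qed
  have "\<exists>f\<in>?W. pair.ip (\<lambda>p. x p - f p) (\<lambda>p. x p - f p) < \<epsilon>" if \<epsilon>: "0 < \<epsilon>" for \<epsilon>
  proof (rule pair.approximable_by_duality)
    have "graph_point (\<lambda>_. 0) = (\<lambda>_. 0)" by (rule ext) (simp add: graph_point_def \<delta>_zero)
    moreover have "graph_point (\<lambda>_. 0) \<in> ?W" using fin_cochains_zero by auto
    ultimately show "(\<lambda>_. 0) \<in> ?W" by simp
    show "\<forall>f\<in>?W. \<forall>g\<in>?W. \<forall>c. (\<lambda>p. c * f p + g p) \<in> ?W"
    proof (intro ballI allI)
      fix f g c assume "f \<in> ?W" "g \<in> ?W"
      then obtain u v where uv: "f = graph_point u" "u \<in> fin_cochains S" "\<And>\<sigma>. Im (u \<sigma>) = 0"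
        "g = graph_point v" "v \<in> fin_cochains S" "\<And>\<sigma>. Im (v \<sigma>) = 0" by auto
      let ?w = "\<lambda>\<sigma>. of_real c * u \<sigma> + v \<sigma>"
      have "(\<lambda>p. c * f p + g p) = graph_point ?w"
        using uv by (auto simp: graph_point_def \<delta>_combination fin_cochains_cochain)
      moreover have "?w \<in> fin_cochains S" by (rule fin_cochains_combination[OF uv(2,5)])
      moreover have "Im (?w \<sigma>) = 0" for \<sigma> using uv by simp
      ultimately show "(\<lambda>p. c * f p + g p) \<in> ?W" by blast
    qed
    show "\<forall>f\<in>?W. pair.square_summable f" using W by auto
    show "pair.square_summable x" by (rule x)
    show "\<forall>r. pair.square_summable r \<longrightarrow> (\<forall>f\<in>?W. pair.ip f r = 0) \<longrightarrow> pair.ip x r = 0"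
      using dual by simp
  qed (rule \<epsilon>)
  note close = this
  show ?thesis
    unfolding approximable_def
  proof (intro conjI allI impI)
    show "\<theta> \<rho> \<in> cochains S" using \<theta>\<rho> by (rule l2_cochain)
    fix \<epsilon> :: real assume \<epsilon>: "0 < \<epsilon>"
    obtain u where u: "u \<in> fin_cochains S" "\<And>\<sigma>. Im (u \<sigma>) = 0"
      and less: "pair.ip (\<lambda>p. x p - graph_point u p) (\<lambda>p. x p - graph_point u p) < \<epsilon>"
      using close[OF \<epsilon>] by auto
    have c: "u \<in> cochains S" "\<theta> \<rho> \<in> cochains S"
      using fin_cochains_cochain[OF u(1)] l2_cochain[OF \<theta>\<rho>] .
    let ?f = "\<lambda>\<sigma>. Re (\<theta> \<rho> \<sigma>) - Re (u \<sigma>)" and ?g = "\<lambda>\<sigma>. - Re (\<delta> u \<sigma>)"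
    have d: "pair.square_summable (\<lambda>p. x p - graph_point u p)"
      by (rule pair.square_summable_diff[OF x W[OF u(1)]])
    then have ss: "l2.square_summable ?f" "l2.square_summable ?g"
      unfolding pair_square_summable_iff by (simp_all add: x_def graph_point_def)
    have sum: "l2.ip ?f ?f + l2.ip ?g ?g < \<epsilon>"
      using less unfolding pair_ip[OF d d] by (simp add: x_def graph_point_def)
    have "N (\<lambda>\<sigma>. u \<sigma> - \<theta> \<rho> \<sigma>) \<le> ennreal (l2.ip ?f ?f)"
      by (rule N_le_real[OF ss(1)]) (simp add: cmod_power2 u(2) Im_\<theta>[OF \<rho>] power2_commute)
    also have "\<dots> \<le> ennreal \<epsilon>"
      using sum l2.ip_self_nonneg[of ?g] by (intro ennreal_leI) linarith
    finally have 1: "N (\<lambda>\<sigma>. u \<sigma> - \<theta> \<rho> \<sigma>) \<le> ennreal \<epsilon>" .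
    have "N (\<delta> (\<lambda>\<sigma>. u \<sigma> - \<theta> \<rho> \<sigma>)) \<le> ennreal (l2.ip ?g ?g)"
      by (rule N_le_real[OF ss(2)]) (simp add: \<delta>_diff[OF c] \<delta>_\<theta>[OF \<rho>] cmod_power2 Im_\<delta>[OF c(1) u(2)])
    also have "\<dots> \<le> ennreal \<epsilon>"
      using sum l2.ip_self_nonneg[of ?f] by (intro ennreal_leI) linarith
    finally have "N (\<delta> (\<lambda>\<sigma>. u \<sigma> - \<theta> \<rho> \<sigma>)) \<le> ennreal \<epsilon>" .
    with 1 u(1) show "\<exists>u\<in>fin_cochains S. N (\<lambda>\<sigma>. u \<sigma> - \<theta> \<rho> \<sigma>) \<le> ennreal \<epsilon> \<and> N (\<delta> (\<lambda>\<sigma>. u \<sigma> - \<theta> \<rho> \<sigma>)) \<le> ennreal \<epsilon>"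
      by (intro bexI[of _ u]) auto
  qed
qed

end

section \<open>Hitting probabilities and cutoffs of small energy\<close>

text \<open>For a Markov chain with transition probabilities \<open>p\<close>, this is the probability that the chain
started at \<open>v\<close> visits \<open>x\<close> within \<open>n\<close> steps and before leaving \<open>F\<close>. Truncating time as well as
space keeps everything a finite sum and avoids solving a Dirichlet problem on \<open>F\<close>.\<close>

fun hit :: "('v \<Rightarrow> 'v \<Rightarrow> real) \<Rightarrow> 'v set \<Rightarrow> 'v \<Rightarrow> nat \<Rightarrow> 'v \<Rightarrow> real" where
  "hit p F x 0 v = (if v = x then 1 else 0)"
| "hit p F x (Suc n) v =
     (if v = x then 1 else if v \<in> F then \<Sum>w\<in>F. p v w * hit p F x n w else 0)"

text \<open>The probability that the chain started at \<open>x\<close> is at \<open>v\<close> after \<open>n\<close> steps, having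
stayed in \<open>F\<close> before and not having returned to \<open>x\<close>.\<close>

fun taboo :: "('v \<Rightarrow> 'v \<Rightarrow> real) \<Rightarrow> 'v set \<Rightarrow> 'v \<Rightarrow> nat \<Rightarrow> 'v \<Rightarrow> real" where
  "taboo p F x 0 v = (if v = x then 1 else 0)"
| "taboo p F x (Suc n) v = (if v = x then 0 else \<Sum>u\<in>F. taboo p F x n u * p u v)"

lemma hit_start [simp]: "hit p F x n x = 1"
  by (cases n) auto

lemma hit_outside: "x \<in> F \<Longrightarrow> v \<notin> F \<Longrightarrow> hit p F x n v = 0"
  by (cases n) auto

lemma hit_nonneg:
  assumes "\<And>v w. v \<in> F \<Longrightarrow> w \<in> F \<Longrightarrow> 0 \<le> p v w"
  shows "0 \<le> hit p F x n v"
  by (induction n arbitrary: v) (auto intro!: sum_nonneg mult_nonneg_nonneg assms)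

lemma hit_le_1:
  assumes p: "\<And>v w. v \<in> F \<Longrightarrow> w \<in> F \<Longrightarrow> 0 \<le> p v w"
    and sub: "\<And>v. v \<in> F \<Longrightarrow> (\<Sum>w\<in>F. p v w) \<le> 1"
  shows "hit p F x n v \<le> 1"
proof (induction n arbitrary: v)
  case (Suc n)
  have "(\<Sum>w\<in>F. p v w * hit p F x n w) \<le> 1" if "v \<in> F"
  proof -
    have "(\<Sum>w\<in>F. p v w * hit p F x n w) \<le> (\<Sum>w\<in>F. p v w * 1)"
      using that p Suc by (intro sum_mono mult_left_mono) auto
    then show ?thesis using sub[OF that] by simp
  qed
  then show ?case by simp
qed simp

lemma hit_mono:
  assumes p: "\<And>v w. v \<in> F \<Longrightarrow> w \<in> F \<Longrightarrow> 0 \<le> p v w"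
  shows "hit p F x n v \<le> hit p F x (Suc n) v"
proof (induction n arbitrary: v)
  case 0
  then show ?case by (auto intro!: sum_nonneg mult_nonneg_nonneg p)
next
  case (Suc n)
  have "(\<Sum>w\<in>F. p v w * hit p F x n w) \<le> (\<Sum>w\<in>F. p v w * hit p F x (Suc n) w)" if "v \<in> F"
    using that p Suc by (intro sum_mono mult_left_mono) auto
  then show ?case
    unfolding hit.simps(2)[of p F x n v] hit.simps(2)[of p F x "Suc n" v] by simp
qed

text \<open>For \<open>k = 0\<close> the left side is the probability of a return to \<open>x\<close> within \<open>n + 1\<close> steps inside \<open>F\<close>,
computed by conditioning on the first step; the right side decomposes the same event according
to the time of the first return. The parameter \<open>k\<close> makes the induction work.\<close>

lemma hit_eq_sum_first_returns:
  assumes F: "finite F" "x \<in> F"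
  shows "(\<Sum>v\<in>F. taboo p F x k v * (\<Sum>w\<in>F. p v w * hit p F x n w))
         = (\<Sum>j\<le>n. \<Sum>v\<in>F. taboo p F x (k + j) v * p v x)"
proof (induction n arbitrary: k)
  case 0
  have "(\<Sum>w\<in>F. p v w * hit p F x 0 w) = p v x" for v
    using F by (simp add: if_distrib cong: if_cong)
  then show ?case by simp
next
  case (Suc n)
  let ?H = "\<lambda>w. \<Sum>u\<in>F. p w u * hit p F x n u"
  have split: "(\<Sum>w\<in>F. p v w * hit p F x (Suc n) w) = p v x + (\<Sum>w\<in>F - {x}. p v w * ?H w)" for v
    using F by (subst sum.remove[of F x]) (auto intro!: sum.cong)
  have "(\<Sum>v\<in>F. taboo p F x k v * (\<Sum>w\<in>F - {x}. p v w * ?H w))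
      = (\<Sum>w\<in>F - {x}. \<Sum>v\<in>F. taboo p F x k v * p v w * ?H w)"
    by (subst sum.swap) (simp add: sum_distrib_left mult.assoc)
  also have "\<dots> = (\<Sum>w\<in>F - {x}. taboo p F x (Suc k) w * ?H w)"
    by (intro sum.cong) (simp_all add: sum_distrib_right)
  also have "\<dots> = (\<Sum>w\<in>F. taboo p F x (Suc k) w * ?H w)"
    using F by (intro sum.mono_neutral_left) auto
  also have "\<dots> = (\<Sum>j\<le>n. \<Sum>v\<in>F. taboo p F x (k + Suc j) v * p v x)"
    using Suc.IH[of "Suc k"] by simp
  finally show ?case
    unfolding split by (simp add: distrib_left sum.distrib sum.atMost_Suc_shift del: taboo.simps sum.atMost_Suc)
qed

lemma sum_edges_eq_twice_sum_vertices:
  fixes b :: "'v \<Rightarrow> 'v \<Rightarrow> real"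
  assumes "\<And>v w. v \<in> W \<Longrightarrow> w \<in> W \<Longrightarrow> b v w = b w v"
  shows "(\<Sum>v\<in>W. \<Sum>w\<in>W. b v w * (f v - f w)\<^sup>2) = 2 * (\<Sum>v\<in>W. f v * (\<Sum>w\<in>W. b v w * (f v - f w)))"
proof -
  have "(\<Sum>v\<in>W. \<Sum>w\<in>W. b v w * (f w - f v) * f w) = (\<Sum>w\<in>W. \<Sum>v\<in>W. b w v * (f w - f v) * f w)"
    by (subst sum.swap) (intro sum.cong refl, simp add: assms)
  moreover have "(\<Sum>v\<in>W. \<Sum>w\<in>W. b v w * (f v - f w)\<^sup>2)
     = (\<Sum>v\<in>W. \<Sum>w\<in>W. b v w * (f v - f w) * f v) + (\<Sum>v\<in>W. \<Sum>w\<in>W. b v w * (f w - f v) * f w)"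
    by (simp only: sum.distrib[symmetric]) (simp add: power2_eq_square algebra_simps)
  ultimately show ?thesis
    by (simp add: sum_distrib_left mult_ac)
qed

text \<open>Summation by parts bounds the energy of \<open>h\<close> by twice the sum of \<open>\<mu> v * h v * (h v - (P h) v)\<close>.
Away from \<open>x\<close> these terms are not positive, because \<open>P h\<close> is there the hitting probability with one
more step and so at least \<open>h\<close>. Only the term at \<open>x\<close> remains, and it contains the probability of not
returning to \<open>x\<close>.\<close>

lemma energy_hit_le:
  fixes p b :: "'v \<Rightarrow> 'v \<Rightarrow> real" and n :: nat
  assumes F: "finite F" "x \<in> F" "F \<subseteq> V" and W: "finite W" "F \<subseteq> W" "W \<subseteq> V"
    and sym: "\<And>v w. v \<in> V \<Longrightarrow> w \<in> V \<Longrightarrow> b v w = b w v"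
    and b: "\<And>v w. v \<in> V \<Longrightarrow> w \<in> V \<Longrightarrow> 0 \<le> b v w"
    and p: "\<And>v w. v \<in> V \<Longrightarrow> w \<in> V \<Longrightarrow> 0 \<le> p v w"
    and \<mu>: "\<And>v. v \<in> V \<Longrightarrow> (\<Sum>w\<in>W. b v w) \<le> \<mu> v" "\<And>v. v \<in> V \<Longrightarrow> 0 \<le> \<mu> v"
    and bp: "\<And>v w. v \<in> V \<Longrightarrow> w \<in> V \<Longrightarrow> b v w = \<mu> v * p v w"
  defines "h \<equiv> hit p F x n"
  shows "(\<Sum>v\<in>W. \<Sum>w\<in>W. b v w * (h v - h w)\<^sup>2) \<le> 2 * (\<mu> x * (1 - (\<Sum>w\<in>F. p x w * h w)))"
proof -
  let ?D = "\<lambda>v. h v * (\<Sum>w\<in>W. b v w * (h v - h w))"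
  have h0: "0 \<le> h v" for v
    unfolding h_def using F(3) p by (intro hit_nonneg) auto
  have D: "?D v \<le> h v * (\<mu> v * (h v - (\<Sum>w\<in>F. p v w * h w)))" if v: "v \<in> V" for v
  proof -
    have "(\<Sum>w\<in>F. b v w * h w) = (\<Sum>w\<in>W. b v w * h w)"
      using W hit_outside[OF F(2)] by (intro sum.mono_neutral_left) (auto simp: h_def)
    moreover have "(\<Sum>w\<in>F. b v w * h w) = \<mu> v * (\<Sum>w\<in>F. p v w * h w)"
      using F(3) v by (subst sum_distrib_left, intro sum.cong) (auto simp: bp)
    moreover have "(\<Sum>w\<in>W. b v w * (h v - h w)) = (\<Sum>w\<in>W. b v w) * h v - (\<Sum>w\<in>W. b v w * h w)"
      by (simp add: right_diff_distrib sum_subtractf sum_distrib_right)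
    moreover have "(\<Sum>w\<in>W. b v w) * h v \<le> \<mu> v * h v"
      by (intro mult_right_mono \<mu>(1) v h0)
    ultimately show ?thesis
      by (intro mult_left_mono h0) (simp add: right_diff_distrib)
  qed
  have "?D v \<le> 0" if v: "v \<in> W - {x}" for v
  proof (cases "v \<in> F")
    case True
    have "h v \<le> (\<Sum>w\<in>F. p v w * h w)"
      using hit_mono[of F p x n v] True F(3) p v by (auto simp: h_def subset_iff)
    then have "h v * (\<mu> v * (h v - (\<Sum>w\<in>F. p v w * h w))) \<le> 0"
      using True F(3) h0 \<mu>(2) by (intro mult_nonneg_nonpos) auto
    then show ?thesis using D[of v] True F(3) by auto
  next
    case False
    then show ?thesis using hit_outside[OF F(2) False] by (simp add: h_def)
  qed
  then have "(\<Sum>v\<in>W - {x}. ?D v) \<le> 0" by (rule sum_nonpos)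
  then have "(\<Sum>v\<in>W. ?D v) \<le> ?D x"
    using W F(2) by (subst sum.remove[of W x]) auto
  also have "\<dots> \<le> \<mu> x * (1 - (\<Sum>w\<in>F. p x w * h w))"
    using D[of x] F by (auto simp: h_def)
  finally show ?thesis
    using sum_edges_eq_twice_sum_vertices[of W b h] W(3) sym by (simp add: subset_iff)
qed

text \<open>Any realisation of the chain will do: the probability of a return is a limit of probabilities that
depend on finitely many steps only, and these are determined by \<open>p\<close>.\<close>

locale markov =
  fixes M :: "'w measure" and Y :: "nat \<Rightarrow> 'w \<Rightarrow> 'v" and V p x
  assumes markov: "markov_chain M Y V p x"
begin

sublocale prob_space M
  using markov by (simp add: markov_chain_def)

lemma pred_value [measurable]: "Measurable.pred M (\<lambda>\<omega>. Y i \<omega> = v)"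
proof -
  have "Y i \<in> measurable M (count_space V)" using markov by (simp add: markov_chain_def)
  then show ?thesis by (rule measurable_compose) simp
qed

lemma pred_member [measurable]: "Measurable.pred M (\<lambda>\<omega>. Y i \<omega> \<in> F)"
proof -
  have "Y i \<in> measurable M (count_space V)" using markov by (simp add: markov_chain_def)
  then show ?thesis by (rule measurable_compose) simp
qed

lemma value_in: "\<omega> \<in> space M \<Longrightarrow> Y i \<omega> \<in> V"
  using markov measurable_space[of "Y i" M "count_space V"] by (simp add: markov_chain_def)

text \<open>The Markov property concerns single paths. Since \<open>F\<close> is finite, it can be summed over any set
\<open>B\<close> of paths of length \<open>k\<close> in \<open>F\<close>.\<close>

lemma prob_next:
  assumes F: "finite F" "F \<subseteq> V" and z: "z \<in> V"
    and B: "B \<subseteq> PiE {..k} (\<lambda>_. F)"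
  shows "\<P>(\<omega> in M. restrict (\<lambda>i. Y i \<omega>) {..k} \<in> B \<and> Y (Suc k) \<omega> = z)
         = (\<Sum>v\<in>F. \<P>(\<omega> in M. restrict (\<lambda>i. Y i \<omega>) {..k} \<in> B \<and> Y k \<omega> = v) * p v z)"
proof -
  have finB: "finite B" using F B by (auto intro: finite_subset finite_PiE)
  have path: "restrict (\<lambda>i. Y i \<omega>) {..k} = s \<longleftrightarrow> (\<forall>i\<le>k. Y i \<omega> = s i)" if "s \<in> B" for s \<omega>
    using B that by (auto simp: fun_eq_iff restrict_def PiE_def extensional_def)
  have sum_paths: "\<P>(\<omega> in M. restrict (\<lambda>i. Y i \<omega>) {..k} \<in> C \<and> Q \<omega>)
      = (\<Sum>s\<in>C. \<P>(\<omega> in M. (\<forall>i\<le>k. Y i \<omega> = s i) \<and> Q \<omega>))"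
    if Q[measurable]: "Measurable.pred M Q" and C: "C \<subseteq> B" for Q C
  proof -
    have mem: "restrict (\<lambda>i. Y i \<omega>) {..k} \<in> C \<longleftrightarrow> (\<exists>s\<in>C. \<forall>i\<le>k. Y i \<omega> = s i)" for \<omega>
      using path[OF subsetD[OF C], of _ \<omega>] by blast
    have "{\<omega> \<in> space M. restrict (\<lambda>i. Y i \<omega>) {..k} \<in> C \<and> Q \<omega>}
        = (\<Union>s\<in>C. {\<omega> \<in> space M. (\<forall>i\<le>k. Y i \<omega> = s i) \<and> Q \<omega>})"
      using mem by auto
    moreover have "disjoint_family_on (\<lambda>s. {\<omega> \<in> space M. (\<forall>i\<le>k. Y i \<omega> = s i) \<and> Q \<omega>}) C"
    proof (unfold disjoint_family_on_def, intro ballI impI)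
      fix s t assume "s \<in> C" "t \<in> C" "s \<noteq> t"
      then have "\<not> ((\<forall>i\<le>k. Y i \<omega> = s i) \<and> (\<forall>i\<le>k. Y i \<omega> = t i))" for \<omega>
        using path[of s \<omega>] path[of t \<omega>] C by auto
      then show "{\<omega> \<in> space M. (\<forall>i\<le>k. Y i \<omega> = s i) \<and> Q \<omega>}
          \<inter> {\<omega> \<in> space M. (\<forall>i\<le>k. Y i \<omega> = t i) \<and> Q \<omega>} = {}" by blast
    qed
    moreover have "{\<omega> \<in> space M. (\<forall>i\<le>k. Y i \<omega> = s i) \<and> Q \<omega>} \<in> sets M" for s
      by measurable
    ultimately show ?thesis
      using finite_subset[OF C finB] by (simp add: finite_measure_finite_Union image_subset_iff)
  qed
  have step: "\<P>(\<omega> in M. (\<forall>i\<le>k. Y i \<omega> = s i) \<and> Y (Suc k) \<omega> = z) = \<P>(\<omega> in M. (\<forall>i\<le>k. Y i \<omega> = s i) \<and> True) * p (s k) z"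
    if "s \<in> B" for s
  proof -
    have "\<forall>i\<le>k. s i \<in> V" using that B F by (auto simp: PiE_def Pi_def)
    then show ?thesis using markov z by (simp add: markov_chain_def)
  qed
  have last: "\<P>(\<omega> in M. restrict (\<lambda>i. Y i \<omega>) {..k} \<in> B \<and> Y k \<omega> = v)
      = (\<Sum>s\<in>{s\<in>B. s k = v}. \<P>(\<omega> in M. (\<forall>i\<le>k. Y i \<omega> = s i) \<and> True))" for v
  proof -
    have "{\<omega> \<in> space M. restrict (\<lambda>i. Y i \<omega>) {..k} \<in> B \<and> Y k \<omega> = v}
        = {\<omega> \<in> space M. restrict (\<lambda>i. Y i \<omega>) {..k} \<in> {s\<in>B. s k = v} \<and> True}"
      by auto
    then show ?thesis using sum_paths[of "\<lambda>_. True" "{s\<in>B. s k = v}"] by simp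
  qed
  have "\<P>(\<omega> in M. restrict (\<lambda>i. Y i \<omega>) {..k} \<in> B \<and> Y (Suc k) \<omega> = z)
      = (\<Sum>s\<in>B. \<P>(\<omega> in M. (\<forall>i\<le>k. Y i \<omega> = s i) \<and> True) * p (s k) z)"
    using sum_paths[of "\<lambda>\<omega>. Y (Suc k) \<omega> = z" B] step by simp
  also have "\<dots> = (\<Sum>v\<in>F. \<Sum>s\<in>{s\<in>B. s k = v}. \<P>(\<omega> in M. (\<forall>i\<le>k. Y i \<omega> = s i) \<and> True) * p (s k) z)"
    using finB F(1) B by (intro sum.group[symmetric]) (auto simp: PiE_def Pi_def)
  also have "\<dots> = (\<Sum>v\<in>F. \<P>(\<omega> in M. restrict (\<lambda>i. Y i \<omega>) {..k} \<in> B \<and> Y k \<omega> = v) * p v z)"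
    unfolding last by (simp add: sum_distrib_right)
  finally show ?thesis .
qed

definition excursion :: "'v set \<Rightarrow> nat \<Rightarrow> 'w \<Rightarrow> bool" where
  "excursion F k \<omega> \<longleftrightarrow> Y 0 \<omega> = x \<and> (\<forall>i\<in>{0<..k}. Y i \<omega> \<in> F - {x})"

lemma pred_excursion [measurable]: "Measurable.pred M (excursion F k)"
  unfolding excursion_def Diff_iff singleton_iff by measurable

lemma prob_excursion_next:
  assumes F: "finite F" "F \<subseteq> V" "x \<in> F" and z: "z \<in> V"
  shows "\<P>(\<omega> in M. excursion F k \<omega> \<and> Y (Suc k) \<omega> = z)
         = (\<Sum>v\<in>F. \<P>(\<omega> in M. excursion F k \<omega> \<and> Y k \<omega> = v) * p v z)"
proof -
  let ?B = "{s \<in> PiE {..k} (\<lambda>_. F). s 0 = x \<and> (\<forall>i\<in>{0<..k}. s i \<in> F - {x})}"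
  have "restrict (\<lambda>i. Y i \<omega>) {..k} \<in> ?B \<longleftrightarrow> excursion F k \<omega>" for \<omega>
  proof -
    have "Y i \<omega> \<in> F" if "excursion F k \<omega>" "i \<le> k" for i
      using that F(3) by (cases "i = 0") (auto simp: excursion_def)
    then show ?thesis by (auto simp: excursion_def)
  qed
  then show ?thesis using prob_next[OF F(1,2) z, of ?B k] by simp
qed

lemma prob_excursion:
  assumes F: "finite F" "F \<subseteq> V" "x \<in> F" and v: "v \<in> F"
  shows "\<P>(\<omega> in M. excursion F k \<omega> \<and> Y k \<omega> = v) = taboo p F x k v"
  using v
proof (induction k arbitrary: v)
  case 0
  show ?case
  proof (cases "v = x")
    case True
    then have "{\<omega> \<in> space M. excursion F 0 \<omega> \<and> Y 0 \<omega> = v} = {\<omega> \<in> space M. Y 0 \<omega> = x}"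
      by (auto simp: excursion_def)
    then show ?thesis using True markov by (simp add: markov_chain_def)
  next
    case False
    then have empty: "{\<omega> \<in> space M. excursion F 0 \<omega> \<and> Y 0 \<omega> = v} = {}"
      by (auto simp: excursion_def)
    show ?thesis unfolding empty using False by simp
  qed
next
  case (Suc k)
  show ?case
  proof (cases "v = x")
    case True
    then have empty: "{\<omega> \<in> space M. excursion F (Suc k) \<omega> \<and> Y (Suc k) \<omega> = v} = {}"
      by (auto simp: excursion_def)
    show ?thesis unfolding empty using True by simp
  next
    case False
    have "excursion F (Suc k) \<omega> \<and> Y (Suc k) \<omega> = v \<longleftrightarrow> excursion F k \<omega> \<and> Y (Suc k) \<omega> = v" for \<omega>
      using False Suc.prems by (auto simp: excursion_def le_Suc_eq)
    then show ?thesis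
      using prob_excursion_next[OF F, of v k] Suc F(2) False by (auto simp: subset_iff)
  qed
qed

lemma prob_return_le_hit:
  assumes F: "finite F" "F \<subseteq> V" "x \<in> F"
  shows "\<P>(\<omega> in M. \<exists>k\<le>n. excursion F k \<omega> \<and> Y (Suc k) \<omega> = x) \<le> (\<Sum>w\<in>F. p x w * hit p F x n w)"
proof -
  have "{\<omega> \<in> space M. \<exists>k\<le>n. excursion F k \<omega> \<and> Y (Suc k) \<omega> = x}
      = (\<Union>k\<in>{..n}. {\<omega> \<in> space M. excursion F k \<omega> \<and> Y (Suc k) \<omega> = x})"
    by auto
  moreover have "{\<omega> \<in> space M. excursion F k \<omega> \<and> Y (Suc k) \<omega> = x} \<in> sets M" for k
    by measurable
  ultimately have "\<P>(\<omega> in M. \<exists>k\<le>n. excursion F k \<omega> \<and> Y (Suc k) \<omega> = x)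
      \<le> (\<Sum>k\<le>n. \<P>(\<omega> in M. excursion F k \<omega> \<and> Y (Suc k) \<omega> = x))"
    by (auto intro!: finite_measure_subadditive_finite)
  also have "\<dots> = (\<Sum>k\<le>n. \<Sum>v\<in>F. taboo p F x k v * p v x)"
    using F by (intro sum.cong refl) (subst prob_excursion_next, auto simp: prob_excursion)
  also have "\<dots> = (\<Sum>v\<in>F. taboo p F x 0 v * (\<Sum>w\<in>F. p v w * hit p F x n w))"
    by (subst hit_eq_sum_first_returns[OF F(1,3)]) simp
  also have "\<dots> = (\<Sum>w\<in>F. p x w * hit p F x n w)"
    using F(1,3) by (simp add: if_distrib[of "\<lambda>a. a * _"] cong: if_cong)
  finally show ?thesis .
qed

text \<open>Exhaust the countable set \<open>V\<close> by finite sets. An almost surely returning path stays in one of them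
up to its first return, so the probabilities of returning within bounded time and inside the finite
set increase to one.\<close>

lemma hit_tends_to_1:
  assumes V: "countable V" and x: "x \<in> V"
    and return: "\<P>(\<omega> in M. \<exists>k>0. Y k \<omega> = x) = 1" and "0 < \<epsilon>"
  obtains F n where "finite F" "F \<subseteq> V" "x \<in> F" "1 - \<epsilon> < (\<Sum>w\<in>F. p x w * hit p F x n w)"
proof -
  define F where "F n = insert x (from_nat_into V ` {..n})" for n :: nat
  have F: "finite (F n)" "F n \<subseteq> V" "x \<in> F n" for n
    using x from_nat_into[of V] by (auto simp: F_def)
  have F_mono: "F m \<subseteq> F n" if "m \<le> n" for m n
    using that by (auto simp: F_def)
  have F_exhausts: "\<exists>n. v \<in> F n" if "v \<in> V" for v
  proof -
    have "v = from_nat_into V (to_nat_on V v)" using that V by simp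
    then have "v \<in> F (to_nat_on V v)" unfolding F_def by blast
    then show ?thesis ..
  qed
  \<comment> \<open>return to \<open>x\<close> by time \<open>n + 1\<close>, inside \<open>F n\<close> until then\<close>
  define G where "G n = {\<omega> \<in> space M. \<exists>k\<le>n. excursion (F n) k \<omega> \<and> Y (Suc k) \<omega> = x}" for n
  have G_sets: "G n \<in> sets M" for n unfolding G_def by measurable
  have "incseq G"
  proof (rule incseq_SucI)
    fix n
    have "excursion (F (Suc n)) k \<omega>" if "excursion (F n) k \<omega>" for k \<omega>
      using that F_mono[OF le_SucI[OF order_refl[of n]]] by (auto simp: excursion_def)
    then show "G n \<subseteq> G (Suc n)"
      by (auto simp: G_def intro: le_SucI)
  qed
  then have "(\<lambda>n. prob (G n)) \<longlonglongrightarrow> prob (\<Union>n. G n)"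
    using G_sets by (intro finite_Lim_measure_incseq) auto
  moreover have "prob (\<Union>n. G n) = 1"
  proof -
    have AE1: "AE \<omega> in M. Y 0 \<omega> = x"
      using markov by (subst prob_Collect_eq_1[symmetric]) (auto simp: markov_chain_def)
    have AE2: "AE \<omega> in M. \<exists>k>0. Y k \<omega> = x"
      using return by (subst prob_Collect_eq_1[symmetric]) auto
    have "AE \<omega> in M. \<omega> \<in> (\<Union>n. G n)"
      using AE1 AE2 AE_space
    proof eventually_elim
      fix \<omega> assume 0: "Y 0 \<omega> = x" and ex: "\<exists>k>0. Y k \<omega> = x" and \<omega>: "\<omega> \<in> space M"
      define K where "K = (LEAST k. 0 < k \<and> Y k \<omega> = x)"
      have K: "0 < K" "Y K \<omega> = x" using LeastI_ex[OF ex] by (auto simp: K_def)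
      have least: "Y i \<omega> \<noteq> x" if "0 < i" "i < K" for i
        using not_less_Least[of i "\<lambda>k. 0 < k \<and> Y k \<omega> = x"] that by (auto simp: K_def)
      obtain N where N: "\<And>i. Y i \<omega> \<in> F (N i)"
        using choice[of "\<lambda>i n. Y i \<omega> \<in> F n"] F_exhausts value_in[OF \<omega>] by blast
      define n where "n = K + Max (N ` {..K})"
      have "Y i \<omega> \<in> F n" if "i \<le> K" for i
      proof -
        have "N i \<le> Max (N ` {..K})" using that by (intro Max_ge) auto
        then show ?thesis using N[of i] F_mono[of "N i" n] by (auto simp: n_def)
      qed
      then have "excursion (F n) (K - 1) \<omega>" using 0 least K by (auto simp: excursion_def)
      moreover have "K - 1 \<le> n" "Suc (K - 1) = K" using K by (auto simp: n_def)
      ultimately have "\<omega> \<in> G n" unfolding G_def using \<omega> K(2) by force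
      then show "\<omega> \<in> (\<Union>n. G n)" by blast
    qed
    then show ?thesis using G_sets by (subst prob_eq_1) auto
  qed
  ultimately have "\<forall>\<^sub>F n in sequentially. 1 - \<epsilon> < prob (G n)"
    using \<open>0 < \<epsilon>\<close> by (intro order_tendstoD) auto
  then obtain n where "1 - \<epsilon> < prob (G n)" using eventually_happens by fastforce
  then have "1 - \<epsilon> < (\<Sum>w\<in>F n. p x w * hit p (F n) x n w)"
    using prob_return_le_hit[OF F, of n n] by (simp add: G_def)
  then show ?thesis using that[OF F] by blast
qed

end

text \<open>The energy is bounded over all finite sets of vertices, which avoids asking for summability of
the double sum.\<close>

definition low_energy_cutoff :: "'v set \<Rightarrow> ('v \<Rightarrow> 'v \<Rightarrow> real) \<Rightarrow> real \<Rightarrow> ('v \<Rightarrow> real) \<Rightarrow> bool" where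
  "low_energy_cutoff V b \<epsilon> \<phi> \<longleftrightarrow>
     finite {v. \<phi> v \<noteq> 0} \<and> {v. \<phi> v \<noteq> 0} \<subseteq> V \<and> (\<forall>v. 0 \<le> \<phi> v \<and> \<phi> v \<le> 1) \<and>
     (\<forall>W. finite W \<and> W \<subseteq> V \<longrightarrow> (\<Sum>v\<in>W. \<Sum>w\<in>W. b v w * (\<phi> v - \<phi> w)\<^sup>2) \<le> \<epsilon>)"

definition null_capacity :: "'v set \<Rightarrow> ('v \<Rightarrow> 'v \<Rightarrow> real) \<Rightarrow> 'v \<Rightarrow> bool" where
  "null_capacity V b x \<longleftrightarrow> (\<forall>\<epsilon>>0. \<exists>\<phi>. low_energy_cutoff V b \<epsilon> \<phi> \<and> \<phi> x = 1)"

lemma null_capacity_if_returns: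
  assumes V: "countable V" and x: "x \<in> V"
    and sym: "\<And>v w. v \<in> V \<Longrightarrow> w \<in> V \<Longrightarrow> b v w = b w v"
    and b: "\<And>v w. v \<in> V \<Longrightarrow> w \<in> V \<Longrightarrow> 0 \<le> b v w"
    and summable: "\<And>v. v \<in> V \<Longrightarrow> b v summable_on V"
    and chain: "markov_chain M Y V (\<lambda>v w. b v w / (\<Sum>\<^sub>\<infinity>z\<in>V. b v z)) x"
    and return: "\<P>(\<omega> in M. \<exists>k>0. Y k \<omega> = x) = 1"
  shows "null_capacity V b x"
  unfolding null_capacity_def
proof (intro allI impI)
  fix \<epsilon> :: real assume "0 < \<epsilon>"
  define \<mu> where "\<mu> v = (\<Sum>\<^sub>\<infinity>z\<in>V. b v z)" for v
  define p where "p v w = b v w / \<mu> v" for v w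
  have \<mu>0: "0 \<le> \<mu> v" if "v \<in> V" for v
    unfolding \<mu>_def using b that by (intro infsum_nonneg) auto
  have \<mu>: "(\<Sum>w\<in>W. b v w) \<le> \<mu> v" if "v \<in> V" "finite W" "W \<subseteq> V" for v W
    unfolding \<mu>_def using that b by (intro finite_sum_le_infsum summable) auto
  have p0: "0 \<le> p v w" if "v \<in> V" "w \<in> V" for v w
    using b \<mu>0 that by (simp add: p_def)
  \<comment> \<open>also true for \<open>\<mu> v = 0\<close>, where all \<open>b v w\<close> vanish\<close>
  have bp: "b v w = \<mu> v * p v w" if "v \<in> V" "w \<in> V" for v w
    using \<mu>[of v "{w}"] b[of v w] that by (cases "\<mu> v = 0") (auto simp: p_def)
  have sub: "(\<Sum>w\<in>W. p v w) \<le> 1" if "v \<in> V" "finite W" "W \<subseteq> V" for v W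
    using \<mu>[OF that] \<mu>0[of v] that
    by (cases "\<mu> v = 0") (auto simp: p_def sum_divide_distrib[symmetric] divide_le_eq)
  interpret markov M Y V p x
    using chain by unfold_locales (simp add: p_def[abs_def] \<mu>_def)
  have "0 < \<epsilon> / (2 * (\<mu> x + 1))" using \<open>0 < \<epsilon>\<close> \<mu>0[OF x] by simp
  from hit_tends_to_1[OF V x return this]
  obtain F n where F: "finite F" "F \<subseteq> V" "x \<in> F"
    and hit: "1 - \<epsilon> / (2 * (\<mu> x + 1)) < (\<Sum>w\<in>F. p x w * hit p F x n w)" by blast
  define \<phi> where "\<phi> = hit p F x n"
  have small: "2 * (\<mu> x * (1 - (\<Sum>w\<in>F. p x w * \<phi> w))) \<le> \<epsilon>"
  proof -
    have "\<mu> x * (1 - (\<Sum>w\<in>F. p x w * \<phi> w)) \<le> \<mu> x * (\<epsilon> / (2 * (\<mu> x + 1)))"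
      using hit \<mu>0[OF x] by (intro mult_left_mono) (auto simp: \<phi>_def)
    also have "\<dots> \<le> (\<mu> x + 1) * (\<epsilon> / (2 * (\<mu> x + 1)))"
      using \<open>0 < \<epsilon>\<close> \<mu>0[OF x] by (intro mult_right_mono) auto
    also have "\<dots> = \<epsilon> / 2"
    proof -
      have "c * (\<epsilon> / (2 * c)) = \<epsilon> / 2" if "c \<noteq> 0" for c using that by simp
      from this[of "\<mu> x + 1"] show ?thesis using \<mu>0[OF x] by simp
    qed
    finally show ?thesis by simp
  qed
  have energy: "(\<Sum>v\<in>W. \<Sum>w\<in>W. b v w * (\<phi> v - \<phi> w)\<^sup>2) \<le> \<epsilon>" if W: "finite W" "W \<subseteq> V" for W
  proof -
    let ?U = "W \<union> F"
    have U: "finite ?U" "?U \<subseteq> V" using W F by auto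
    have "(\<Sum>v\<in>W. \<Sum>w\<in>W. b v w * (\<phi> v - \<phi> w)\<^sup>2) \<le> (\<Sum>v\<in>W. \<Sum>w\<in>?U. b v w * (\<phi> v - \<phi> w)\<^sup>2)"
      using U b W by (intro sum_mono sum_mono2) (auto simp: subset_iff)
    also have "\<dots> \<le> (\<Sum>v\<in>?U. \<Sum>w\<in>?U. b v w * (\<phi> v - \<phi> w)\<^sup>2)"
      using U b W by (intro sum_mono2) (auto simp: subset_iff intro!: sum_nonneg)
    also have "\<dots> \<le> 2 * (\<mu> x * (1 - (\<Sum>w\<in>F. p x w * \<phi> w)))"
      unfolding \<phi>_def using F U b sym p0 \<mu>0 \<mu> bp by (intro energy_hit_le[where V = V]) auto
    finally show ?thesis using small by simp
  qed
  have "low_energy_cutoff V b \<epsilon> \<phi>"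
    unfolding low_energy_cutoff_def
  proof (intro conjI allI impI)
    have "{v. \<phi> v \<noteq> 0} \<subseteq> F" using hit_outside[OF F(3)] by (auto simp: \<phi>_def)
    then show "finite {v. \<phi> v \<noteq> 0}" "{v. \<phi> v \<noteq> 0} \<subseteq> V"
      using finite_subset F(1,2) by auto
    show "0 \<le> \<phi> v" for v
      unfolding \<phi>_def by (intro hit_nonneg p0 subsetD[OF F(2)])
    show "\<phi> v \<le> 1" for v
      unfolding \<phi>_def by (intro hit_le_1 p0 sub subsetD[OF F(2)] F)
  qed (use energy in auto)
  then show "\<exists>\<phi>. low_energy_cutoff V b \<epsilon> \<phi> \<and> \<phi> x = 1"
    by (intro exI[of _ \<phi>]) (simp add: \<phi>_def)
qed

lemma null_capacity_if_recurrent: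
  assumes V: "countable V" and x: "x \<in> V"
    and sym: "\<And>v w. v \<in> V \<Longrightarrow> w \<in> V \<Longrightarrow> b v w = b w v"
    and b: "\<And>v w. v \<in> V \<Longrightarrow> w \<in> V \<Longrightarrow> 0 \<le> b v w"
    and summable: "\<And>v. v \<in> V \<Longrightarrow> b v summable_on V"
    and rec: "recurrent V b"
  shows "null_capacity V b x"
proof (cases "V = {x}")
  case True
  have "(\<Sum>v\<in>W. \<Sum>w\<in>W. b v w * (indicator {x} v - indicator {x} w)\<^sup>2) \<le> \<epsilon>"
    if "W \<subseteq> V" "0 < \<epsilon>" for W and \<epsilon> :: real
  proof -
    have "(\<Sum>v\<in>W. \<Sum>w\<in>W. b v w * (indicator {x} v - indicator {x} w)\<^sup>2) = 0"
      using that(1) True by (intro sum.neutral ballI) auto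
    then show ?thesis using \<open>0 < \<epsilon>\<close> by simp
  qed
  then have "low_energy_cutoff V b \<epsilon> (indicator {x})" if "0 < \<epsilon>" for \<epsilon>
    unfolding low_energy_cutoff_def using that x by (auto simp: indicator_def)
  then show ?thesis
    unfolding null_capacity_def by (intro allI impI exI[of _ "indicator {x}"]) simp
next
  case False
  then have "\<not> (\<exists>y. V = {y})" using x by auto
  then obtain M :: "(nat \<Rightarrow> 'a) measure" and Y
    where chain: "markov_chain M Y V (\<lambda>v w. b v w / (\<Sum>\<^sub>\<infinity>z\<in>V. b v z)) x"
      and return: "\<P>(\<omega> in M. \<exists>k>0. Y k \<omega> = x) = 1"
    using rec x unfolding recurrent_def by fast
  show ?thesis
    by (rule null_capacity_if_returns[OF V x _ _ _ chain return]) (fact sym b summable)+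
qed

text \<open>When no edge joins \<open>A\<close> to the rest of the graph, a function supported in \<open>A\<close> has no energy outside
\<open>A\<close>. This passes from a connected component to the whole graph.\<close>

lemma null_capacity_mono:
  assumes cap: "null_capacity A b x" and A: "A \<subseteq> V"
    and isolated: "\<And>v w. v \<in> A \<Longrightarrow> w \<in> V - A \<Longrightarrow> b v w = 0 \<and> b w v = 0"
  shows "null_capacity V b x"
  unfolding null_capacity_def
proof (intro allI impI)
  fix \<epsilon> :: real assume "0 < \<epsilon>"
  then obtain \<phi> where cutoff: "low_energy_cutoff A b \<epsilon> \<phi>" and x: "\<phi> x = 1"
    using cap unfolding null_capacity_def by auto
  have supp: "\<phi> v = 0" if "v \<notin> A" for v
    using cutoff that by (auto simp: low_energy_cutoff_def)
  have "(\<Sum>v\<in>W. \<Sum>w\<in>W. b v w * (\<phi> v - \<phi> w)\<^sup>2) \<le> \<epsilon>" if W: "finite W" "W \<subseteq> V" for W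
  proof -
    have zero: "b v w * (\<phi> v - \<phi> w)\<^sup>2 = 0" if "v \<in> W" "w \<in> W" "v \<notin> A \<or> w \<notin> A" for v w
    proof -
      have "v \<in> V" "w \<in> V" using that W(2) by auto
      then show ?thesis
        using that isolated[of v w] isolated[of w v] supp[of v] supp[of w] by (cases "v \<in> A"; cases "w \<in> A") auto
    qed
    have "(\<Sum>v\<in>W. \<Sum>w\<in>W. b v w * (\<phi> v - \<phi> w)\<^sup>2) = (\<Sum>v\<in>W. \<Sum>w\<in>W \<inter> A. b v w * (\<phi> v - \<phi> w)\<^sup>2)"
      using W(1) zero by (intro sum.cong sum.mono_neutral_right refl) auto
    also have "\<dots> = (\<Sum>v\<in>W \<inter> A. \<Sum>w\<in>W \<inter> A. b v w * (\<phi> v - \<phi> w)\<^sup>2)"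
    proof (rule sum.mono_neutral_right[OF W(1)])
      show "\<forall>v\<in>W - W \<inter> A. (\<Sum>w\<in>W \<inter> A. b v w * (\<phi> v - \<phi> w)\<^sup>2) = 0"
        by (intro ballI sum.neutral zero) auto
    qed auto
    also have "\<dots> \<le> \<epsilon>" using cutoff W(1) by (simp add: low_energy_cutoff_def)
    finally show ?thesis .
  qed
  then have "low_energy_cutoff V b \<epsilon> \<phi>" using cutoff A by (auto simp: low_energy_cutoff_def)
  then show "\<exists>\<phi>. low_energy_cutoff V b \<epsilon> \<phi> \<and> \<phi> x = 1" using x by blast
qed

lemma max_diff_square_le:
  fixes a b c d :: real
  shows "(max a b - max c d)\<^sup>2 \<le> (a - c)\<^sup>2 + (b - d)\<^sup>2"
proof -
  have "\<bar>max a b - max c d\<bar> \<le> \<bar>a - c\<bar> \<or> \<bar>max a b - max c d\<bar> \<le> \<bar>b - d\<bar>" by linarith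
  then have "(max a b - max c d)\<^sup>2 \<le> (a - c)\<^sup>2 \<or> (max a b - max c d)\<^sup>2 \<le> (b - d)\<^sup>2"
    by (simp add: abs_le_square_iff)
  then show ?thesis using zero_le_power2[of "a - c"] zero_le_power2[of "b - d"] by linarith
qed

text \<open>Along an edge, the difference of two maxima is at most the larger of the two differences, so the
energy of the maximum is at most the sum of the energies.\<close>

lemma low_energy_cutoff_max:
  assumes \<phi>: "low_energy_cutoff V b \<epsilon> \<phi>" and \<psi>: "low_energy_cutoff V b \<epsilon>' \<psi>"
    and b: "\<And>v w. v \<in> V \<Longrightarrow> w \<in> V \<Longrightarrow> 0 \<le> b v w"
  shows "low_energy_cutoff V b (\<epsilon> + \<epsilon>') (\<lambda>v. max (\<phi> v) (\<psi> v))"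
  unfolding low_energy_cutoff_def
proof (intro conjI allI impI)
  have "{v. max (\<phi> v) (\<psi> v) \<noteq> 0} \<subseteq> {v. \<phi> v \<noteq> 0} \<union> {v. \<psi> v \<noteq> 0}" by (auto simp: max_def)
  then show "finite {v. max (\<phi> v) (\<psi> v) \<noteq> 0}" "{v. max (\<phi> v) (\<psi> v) \<noteq> 0} \<subseteq> V"
    using \<phi> \<psi> by (auto simp: low_energy_cutoff_def intro: finite_subset)
  show "0 \<le> max (\<phi> v) (\<psi> v)" "max (\<phi> v) (\<psi> v) \<le> 1" for v
    using \<phi> \<psi> by (simp_all add: low_energy_cutoff_def le_max_iff_disj)
  fix W assume W: "finite W \<and> W \<subseteq> V"
  have "(\<Sum>v\<in>W. \<Sum>w\<in>W. b v w * (max (\<phi> v) (\<psi> v) - max (\<phi> w) (\<psi> w))\<^sup>2)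
      \<le> (\<Sum>v\<in>W. \<Sum>w\<in>W. b v w * ((\<phi> v - \<phi> w)\<^sup>2 + (\<psi> v - \<psi> w)\<^sup>2))"
    using b W by (intro sum_mono mult_left_mono max_diff_square_le) auto
  also have "\<dots> = (\<Sum>v\<in>W. \<Sum>w\<in>W. b v w * (\<phi> v - \<phi> w)\<^sup>2) + (\<Sum>v\<in>W. \<Sum>w\<in>W. b v w * (\<psi> v - \<psi> w)\<^sup>2)"
    by (simp add: distrib_left sum.distrib)
  also have "\<dots> \<le> \<epsilon> + \<epsilon>'"
    using W \<phi> \<psi> by (intro add_mono) (auto simp: low_energy_cutoff_def)
  finally show "(\<Sum>v\<in>W. \<Sum>w\<in>W. b v w * (max (\<phi> v) (\<psi> v) - max (\<phi> w) (\<psi> w))\<^sup>2) \<le> \<epsilon> + \<epsilon>'" .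
qed

lemma low_energy_cutoff_on_finite_set:
  assumes T: "finite T" "T \<subseteq> V" and cap: "\<And>x. x \<in> V \<Longrightarrow> null_capacity V b x"
    and b: "\<And>v w. v \<in> V \<Longrightarrow> w \<in> V \<Longrightarrow> 0 \<le> b v w" and "0 < \<epsilon>"
  shows "\<exists>\<phi>. low_energy_cutoff V b \<epsilon> \<phi> \<and> (\<forall>x\<in>T. \<phi> x = 1)"
  using T \<open>0 < \<epsilon>\<close>
proof (induction T arbitrary: \<epsilon>)
  case empty
  then show ?case by (intro exI[of _ "\<lambda>_. 0"]) (auto simp: low_energy_cutoff_def)
next
  case (insert x T)
  have half: "0 < \<epsilon> / 2" using insert.prems(2) by simp
  obtain \<phi> where \<phi>: "low_energy_cutoff V b (\<epsilon> / 2) \<phi>" "\<forall>x\<in>T. \<phi> x = 1"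
    using insert.IH[OF _ half] insert.prems(1) by auto
  have "null_capacity V b x" using cap insert.prems(1) by simp
  from this[unfolded null_capacity_def, rule_format, OF half]
  obtain \<psi> where \<psi>: "low_energy_cutoff V b (\<epsilon> / 2) \<psi>" "\<psi> x = 1" by auto
  have "\<phi> v \<le> 1" "\<psi> v \<le> 1" for v using \<phi>(1) \<psi>(1) by (simp_all add: low_energy_cutoff_def)
  then have "max (\<phi> y) (\<psi> y) = 1" if "y \<in> insert x T" for y
    using that \<phi>(2) \<psi>(2) by (auto simp: max_def intro: antisym)
  moreover have "low_energy_cutoff V b \<epsilon> (\<lambda>v. max (\<phi> v) (\<psi> v))"
    using low_energy_cutoff_max[OF \<phi>(1) \<psi>(1) b] by simp
  ultimately show ?case by blast
qed

section \<open>Cutoffs on links\<close>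

lemma face_iff_insert: "face \<tau> \<sigma> \<longleftrightarrow> (\<exists>v. v \<notin> \<tau> \<and> \<sigma> = insert v \<tau>)"
proof
  assume "face \<tau> \<sigma>"
  then have sub: "\<tau> \<subseteq> \<sigma>" and "card (\<sigma> - \<tau>) = 1" by (auto simp: face_def)
  then obtain v where "\<sigma> - \<tau> = {v}" by (auto simp: card_1_singleton_iff)
  then show "\<exists>v. v \<notin> \<tau> \<and> \<sigma> = insert v \<tau>" using sub by (intro exI[of _ v]) auto
next
  assume "\<exists>v. v \<notin> \<tau> \<and> \<sigma> = insert v \<tau>"
  then obtain v where "v \<notin> \<tau>" "\<sigma> = insert v \<tau>" by auto
  then have "\<sigma> - \<tau> = {v}" by auto
  then show "face \<tau> \<sigma>" using \<open>\<sigma> = insert v \<tau>\<close> by (auto simp: face_def)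
qed

lemma the_new_vertex: "v \<notin> \<rho> \<Longrightarrow> the_elem (insert v \<rho> - \<rho>) = v"
proof -
  assume "v \<notin> \<rho>"
  then have "insert v \<rho> - \<rho> = {v}" by auto
  then show ?thesis by simp
qed

context weighted_complex
begin

lemma link_iff: "v \<in> link X S \<rho> \<longleftrightarrow> insert v \<rho> \<in> S \<and> v \<notin> \<rho>"
proof
  assume "v \<in> link X S \<rho>"
  then have "insert v \<rho> \<in> S" "face \<rho> (insert v \<rho>)" by (simp_all add: link_def)
  then show "insert v \<rho> \<in> S \<and> v \<notin> \<rho>" by (auto simp: face_def)
next
  assume v: "insert v \<rho> \<in> S \<and> v \<notin> \<rho>"
  then have "face \<rho> (insert v \<rho>)" unfolding face_iff_insert by blast
  then show "v \<in> link X S \<rho>" using v simplex_subset[of "insert v \<rho>"] by (simp add: link_def)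
qed

lemma countable_link:
  assumes "\<rho> \<in> S"
  shows "countable (link X S \<rho>)"
proof -
  let ?C = "{\<sigma>\<in>S. face \<rho> \<sigma>}"
  have "{\<sigma>\<in>?C. m \<sigma> \<noteq> 0} = ?C" using m_pos by fastforce
  then have "countable ?C" using summable_countable_real[OF m_summable_cofaces[OF assms]] by simp
  moreover have "link X S \<rho> \<subseteq> (\<lambda>\<sigma>. the_elem (\<sigma> - \<rho>)) ` ?C"
  proof
    fix v assume "v \<in> link X S \<rho>"
    then have v: "insert v \<rho> \<in> S" "v \<notin> \<rho>" by (simp_all add: link_iff)
    then have "insert v \<rho> \<in> ?C" by (auto simp: face_iff_insert)
    then show "v \<in> (\<lambda>\<sigma>. the_elem (\<sigma> - \<rho>)) ` ?C"
      by (rule rev_image_eqI) (simp add: the_new_vertex[OF v(2)])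
  qed
  ultimately show ?thesis by (meson countable_image countable_subset)
qed

lemma link_graph_sym: "link_graph X S m \<rho> v w = link_graph X S m \<rho> w v"
proof -
  have "{v} \<union> {w} \<union> \<rho> = {w} \<union> {v} \<union> \<rho>" by auto
  then show ?thesis by (auto simp: link_graph_def)
qed

lemma link_graph_nonneg: "0 \<le> link_graph X S m \<rho> v w"
  using m_pos[of "{v} \<union> {w} \<union> \<rho>"] by (auto simp: link_graph_def less_imp_le)

text \<open>This is local summability at the simplex \<open>insert v \<rho>\<close>.\<close>

lemma link_graph_summable:
  assumes v: "v \<in> link X S \<rho>"
  shows "link_graph X S m \<rho> v summable_on link X S \<rho>"
proof -
  let ?L = "{w \<in> link X S \<rho>. v \<noteq> w \<and> {v} \<union> {w} \<union> \<rho> \<in> S}"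
  let ?g = "\<lambda>w. insert w (insert v \<rho>)"
  have v': "insert v \<rho> \<in> S" "v \<notin> \<rho>" using v by (simp_all add: link_iff)
  have g: "{v} \<union> {w} \<union> \<rho> = ?g w" for w by auto
  have "?g ` ?L \<subseteq> {\<sigma>\<in>S. face (insert v \<rho>) \<sigma>}"
    unfolding g by (auto simp: face_iff_insert link_iff)
  then have "m summable_on ?g ` ?L"
    by (rule summable_on_subset_banach[OF m_summable_cofaces[OF v'(1)]])
  moreover have "inj_on ?g ?L"
  proof (rule inj_onI)
    fix w w' assume "w \<in> ?L" "w' \<in> ?L" "?g w = ?g w'"
    then show "w = w'" by (auto simp: link_iff)
  qed
  ultimately have "(m \<circ> ?g) summable_on ?L" by (subst (asm) summable_on_reindex)
  then show ?thesis
    by (rule summable_on_cong_neutral[THEN iffD1, rotated -1]) (use v in \<open>auto simp: link_graph_def g\<close>)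
qed

lemma link_null_capacity:
  assumes \<rho>: "\<rho> \<in> S" and x: "x \<in> link X S \<rho>"
    and rec: "\<forall>A\<in>graph_components (link X S \<rho>) (link_graph X S m \<rho>). recurrent A (link_graph X S m \<rho>)"
  shows "null_capacity (link X S \<rho>) (link_graph X S m \<rho>) x"
proof -
  let ?L = "link X S \<rho>" and ?b = "link_graph X S m \<rho>"
  let ?R = "{(v, v'). v \<in> ?L \<and> v' \<in> ?L \<and> 0 < ?b v v'}"
  define A where "A = {y\<in>?L. (x, y) \<in> ?R\<^sup>*}"
  have "A \<in> graph_components ?L ?b" unfolding graph_components_def A_def using x by blast
  then have "recurrent A ?b" using rec by blast
  moreover have "x \<in> A" using x by (simp add: A_def)
  moreover have A: "A \<subseteq> ?L" by (auto simp: A_def)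
  moreover have "countable A" using countable_subset[OF A countable_link[OF \<rho>]] .
  ultimately have "null_capacity A ?b x"
    by (intro null_capacity_if_recurrent link_graph_sym link_graph_nonneg
        summable_on_subset_banach[OF link_graph_summable A]) auto
  then show ?thesis using A
  proof (rule null_capacity_mono)
    fix v w assume "v \<in> A" "w \<in> ?L - A"
    have "\<not> 0 < ?b v w"
    proof
      assume "0 < ?b v w"
      then have "(v, w) \<in> ?R" using \<open>v \<in> A\<close> \<open>w \<in> ?L - A\<close> by (simp add: A_def)
      moreover have "(x, v) \<in> ?R\<^sup>*" using \<open>v \<in> A\<close> by (simp add: A_def)
      ultimately have "(x, w) \<in> ?R\<^sup>*" by (rule rtrancl_into_rtrancl[rotated])
      then show False using \<open>w \<in> ?L - A\<close> by (simp add: A_def)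
    qed
    then have "?b v w = 0" using link_graph_nonneg[of \<rho> v w] by simp
    then show "?b v w = 0 \<and> ?b w v = 0" using link_graph_sym[of \<rho> v w] by simp
  qed
qed

text \<open>The coboundary of the indicator of \<open>\<rho>\<close>, damped by a function on the vertices of the link.\<close>

definition cutoff :: "'v set \<Rightarrow> ('v \<Rightarrow> real) \<Rightarrow> 'v set \<Rightarrow> complex" where
  "cutoff \<rho> \<phi> \<tau> = \<theta> \<rho> \<tau> * of_real (\<phi> (the_elem (\<tau> - \<rho>)))"

lemma cutoff_cochain: "\<rho> \<in> S \<Longrightarrow> cutoff \<rho> \<phi> \<in> cochains S"
  by (simp add: cochains_def cutoff_def \<theta>_outside)

lemma \<delta>_cutoff_two_faces:
  assumes \<rho>: "\<rho> \<in> S" and \<sigma>: "\<sigma> \<in> S" "\<sigma> = insert v (insert w \<rho>)" and vw: "v \<noteq> w" "v \<notin> \<rho>" "w \<notin> \<rho>"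
  shows "\<delta> (cutoff \<rho> \<phi>) \<sigma> = \<theta> (insert v \<rho>) \<sigma> * \<theta> \<rho> (insert v \<rho>) * of_real (\<phi> v)
    + \<theta> (insert w \<rho>) \<sigma> * \<theta> \<rho> (insert w \<rho>) * of_real (\<phi> w)"
proof -
  have faces: "insert v \<rho> \<in> S" "insert w \<rho> \<in> S"
    using simplex_between[OF \<rho> \<sigma>(1)] \<sigma>(2) by auto
  have f: "face (insert v \<rho>) \<sigma>" "face (insert w \<rho>) \<sigma>"
    using \<sigma>(2) vw unfolding face_iff_insert by auto
  have ne: "insert v \<rho> \<noteq> insert w \<rho>" using vw by auto
  have "\<delta> (cutoff \<rho> \<phi>) \<sigma> = (\<Sum>\<tau> | \<tau> \<in> S \<and> face \<tau> \<sigma>. \<theta> \<tau> \<sigma> * cutoff \<rho> \<phi> \<tau>)"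
    by (rule \<delta>_eq[OF cutoff_cochain[OF \<rho>] \<sigma>(1)])
  also have "\<dots> = (\<Sum>\<tau>\<in>{insert v \<rho>, insert w \<rho>}. \<theta> \<tau> \<sigma> * cutoff \<rho> \<phi> \<tau>)"
  proof (rule sum.mono_neutral_right[OF finite_faces[OF \<sigma>(1)]])
    show "{insert v \<rho>, insert w \<rho>} \<subseteq> {\<tau>. \<tau> \<in> S \<and> face \<tau> \<sigma>}" using faces f by simp
    show "\<forall>\<tau>\<in>{\<tau>. \<tau> \<in> S \<and> face \<tau> \<sigma>} - {insert v \<rho>, insert w \<rho>}. \<theta> \<tau> \<sigma> * cutoff \<rho> \<phi> \<tau> = 0"
    proof
      fix \<tau> assume \<tau>: "\<tau> \<in> {\<tau>. \<tau> \<in> S \<and> face \<tau> \<sigma>} - {insert v \<rho>, insert w \<rho>}"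
      have "\<not> face \<rho> \<tau>"
      proof
        assume "face \<rho> \<tau>"
        then obtain z where z: "z \<notin> \<rho>" "\<tau> = insert z \<rho>" unfolding face_iff_insert by blast
        moreover have "\<tau> \<subseteq> \<sigma>" using \<tau> by (simp add: face_def)
        ultimately have "z = v \<or> z = w" using \<sigma>(2) by auto
        then show False using z(2) \<tau> by auto
      qed
      then show "\<theta> \<tau> \<sigma> * cutoff \<rho> \<phi> \<tau> = 0" using \<tau> \<rho> by (simp add: cutoff_def \<theta>_zero)
    qed
  qed
  also have "\<dots> = \<theta> (insert v \<rho>) \<sigma> * \<theta> \<rho> (insert v \<rho>) * of_real (\<phi> v)
    + \<theta> (insert w \<rho>) \<sigma> * \<theta> \<rho> (insert w \<rho>) * of_real (\<phi> w)"
    using ne by (simp add: cutoff_def the_new_vertex vw mult.assoc)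
  finally show ?thesis .
qed

text \<open>Above \<open>\<rho>\<close>, a simplex \<open>\<sigma>\<close> has exactly two faces that are cofaces of \<open>\<rho>\<close>. Their two sign products
are opposite because \<open>\<delta> \<delta> = 0\<close>, so \<open>\<delta>\<close> of the damped cochain is, up to a sign, the difference of
\<open>\<phi>\<close> along the edge of the link graph given by \<open>\<sigma>\<close>.\<close>

lemma norm_\<delta>_cutoff:
  assumes \<rho>: "\<rho> \<in> S" and \<sigma>: "\<sigma> \<in> S" "\<sigma> = insert v (insert w \<rho>)" and vw: "v \<noteq> w" "v \<notin> \<rho>" "w \<notin> \<rho>"
  shows "(cmod (\<delta> (cutoff \<rho> \<phi>) \<sigma>))\<^sup>2 = (\<phi> v - \<phi> w)\<^sup>2"
proof -
  define a where "a = \<theta> (insert v \<rho>) \<sigma> * \<theta> \<rho> (insert v \<rho>)"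
  define b where "b = \<theta> (insert w \<rho>) \<sigma> * \<theta> \<rho> (insert w \<rho>)"
  have two_terms: "\<delta> (cutoff \<rho> \<psi>) \<sigma> = a * of_real (\<psi> v) + b * of_real (\<psi> w)" for \<psi>
    unfolding a_def b_def by (rule \<delta>_cutoff_two_faces[OF assms])
  \<comment> \<open>without damping the coboundary is \<open>\<delta> \<delta>\<close> of an indicator\<close>
  have "cutoff \<rho> (\<lambda>_. 1) = \<delta> (e \<rho>)" by (rule ext) (simp add: cutoff_def \<delta>_e)
  then have "\<delta> (cutoff \<rho> (\<lambda>_. 1)) \<sigma> = 0" by (simp add: \<delta>_\<delta>[OF e_cochain[OF \<rho>]])
  then have "b = - a" using two_terms[of "\<lambda>_. 1"] by (simp add: add_eq_0_iff)
  then have "\<delta> (cutoff \<rho> \<phi>) \<sigma> = a * of_real (\<phi> v - \<phi> w)" using two_terms[of \<phi>] by (simp add: algebra_simps)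
  moreover have "cmod a = 1"
  proof -
    have "insert v \<rho> \<in> S" using simplex_between[OF \<rho> \<sigma>(1)] \<sigma>(2) by auto
    moreover have "face (insert v \<rho>) \<sigma>" "face \<rho> (insert v \<rho>)"
      using \<sigma>(2) vw unfolding face_iff_insert by auto
    ultimately show ?thesis by (simp add: a_def norm_mult norm_\<theta> \<rho> \<sigma>(1))
  qed
  ultimately show ?thesis by (simp only: norm_mult norm_of_real power2_abs mult_1)
qed

lemma \<delta>_cutoff_support:
  assumes \<rho>: "\<rho> \<in> S" and \<sigma>: "\<sigma> \<in> S" and nz: "\<delta> (cutoff \<rho> \<phi>) \<sigma> \<noteq> 0"
  shows "\<exists>v w. \<sigma> = insert v (insert w \<rho>) \<and> v \<noteq> w \<and> v \<notin> \<rho> \<and> w \<notin> \<rho>"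
proof -
  obtain \<tau> where \<tau>: "\<tau> \<in> S" "face \<tau> \<sigma>" "cutoff \<rho> \<phi> \<tau> \<noteq> 0"
  proof (rule ccontr)
    assume "\<not> thesis"
    then have "\<theta> \<tau> \<sigma> * cutoff \<rho> \<phi> \<tau> = 0" if "\<tau> \<in> S" "face \<tau> \<sigma>" for \<tau>
      using that \<open>(\<And>\<tau>. \<tau> \<in> S \<Longrightarrow> face \<tau> \<sigma> \<Longrightarrow> cutoff \<rho> \<phi> \<tau> \<noteq> 0 \<Longrightarrow> thesis)\<close> by fastforce
    then have "\<delta> (cutoff \<rho> \<phi>) \<sigma> = 0"
      unfolding \<delta>_eq[OF cutoff_cochain[OF \<rho>] \<sigma>] by (intro sum.neutral) auto
    then show False using nz by simp
  qed
  have "face \<rho> \<tau>"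
  proof (rule ccontr)
    assume "\<not> face \<rho> \<tau>"
    then show False using \<tau> \<rho> by (simp add: cutoff_def \<theta>_zero)
  qed
  then obtain w where w: "w \<notin> \<rho>" "\<tau> = insert w \<rho>" unfolding face_iff_insert by blast
  obtain v where v: "v \<notin> \<tau>" "\<sigma> = insert v \<tau>" using \<tau>(2) unfolding face_iff_insert by blast
  show ?thesis using v w by (intro exI[of _ v] exI[of _ w]) auto
qed

text \<open>Damp \<open>\<theta> \<rho>\<close> by a cutoff of small energy that equals one on a finite set of link vertices
carrying almost all of the weight. The damped cochain is finitely supported and close to \<open>\<theta> \<rho>\<close>,
and the squared norm of its coboundary is at most the energy of the cutoff on the link graph.\<close>

lemma approximable_\<theta>_if_null_capacity:
  assumes \<rho>: "\<rho> \<in> S"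
    and cap: "\<And>x. x \<in> link X S \<rho> \<Longrightarrow> null_capacity (link X S \<rho>) (link_graph X S m \<rho>) x"
  shows "approximable (\<theta> \<rho>)"
  unfolding approximable_def
proof (intro conjI allI impI)
  let ?L = "link X S \<rho>" and ?b = "link_graph X S m \<rho>" and ?C = "{\<sigma>\<in>S. face \<rho> \<sigma>}"
  show \<theta>c: "\<theta> \<rho> \<in> cochains S" by (rule l2_cochain[OF \<theta>_l2[OF \<rho>]])
  fix \<epsilon> :: real assume \<epsilon>: "0 < \<epsilon>"
  obtain T0 where T0: "finite T0" "T0 \<subseteq> ?C" and close: "dist (sum m T0) (infsum m ?C) \<le> \<epsilon>"
    using infsum_finite_approximation[OF m_summable_cofaces[OF \<rho>] \<epsilon>] by auto
  have tail: "sum m G \<le> \<epsilon>" if G: "finite G" "G \<subseteq> ?C - T0" for G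
  proof -
    have "sum m G + sum m T0 = sum m (G \<union> T0)"
      using G T0 by (intro sum.union_disjoint[symmetric]) auto
    also have "\<dots> \<le> infsum m ?C"
      using G T0 m_pos by (intro finite_sum_le_infsum m_summable_cofaces[OF \<rho>]) (auto intro: less_imp_le)
    finally show ?thesis using close by (simp add: dist_real_def abs_le_iff)
  qed
  define T where "T = {v\<in>?L. insert v \<rho> \<in> T0}"
  have "T \<subseteq> (\<lambda>\<tau>. the_elem (\<tau> - \<rho>)) ` T0"
  proof
    fix v assume "v \<in> T"
    then have "insert v \<rho> \<in> T0" "v \<notin> \<rho>" by (simp_all add: T_def link_iff)
    then show "v \<in> (\<lambda>\<tau>. the_elem (\<tau> - \<rho>)) ` T0" by (metis imageI the_new_vertex)
  qed
  then have T: "finite T" "T \<subseteq> ?L" using T0(1) by (auto intro: finite_surj simp: T_def)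
  obtain \<phi> where \<phi>: "low_energy_cutoff ?L ?b \<epsilon> \<phi>" and \<phi>_T: "\<forall>x\<in>T. \<phi> x = 1"
    using low_energy_cutoff_on_finite_set[OF T cap link_graph_nonneg \<epsilon>] by auto
  have F: "finite {v. \<phi> v \<noteq> 0}" and \<phi>_range: "\<And>v. 0 \<le> \<phi> v" "\<And>v. \<phi> v \<le> 1"
    and energy: "\<And>W. finite W \<Longrightarrow> W \<subseteq> ?L \<Longrightarrow> (\<Sum>v\<in>W. \<Sum>w\<in>W. ?b v w * (\<phi> v - \<phi> w)\<^sup>2) \<le> \<epsilon>"
    using \<phi> by (simp_all add: low_energy_cutoff_def)
  define u where "u = cutoff \<rho> \<phi>"
  have uc: "u \<in> cochains S" unfolding u_def by (rule cutoff_cochain[OF \<rho>])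
  have coface: "\<exists>v. v \<notin> \<rho> \<and> \<tau> = insert v \<rho> \<and> v \<in> ?L" if "\<tau> \<in> ?C" for \<tau>
    using that unfolding link_iff by (auto simp: face_iff_insert)
  have \<theta>0: "\<theta> \<rho> \<tau> = 0" if "\<tau> \<notin> ?C" for \<tau>
    using that \<theta>_zero[OF \<rho>] \<theta>_outside[OF \<rho>] by (cases "\<tau> \<in> S") auto
  have "{\<tau>. u \<tau> \<noteq> 0} \<subseteq> (\<lambda>v. insert v \<rho>) ` {v. \<phi> v \<noteq> 0}"
  proof
    fix \<tau> assume "\<tau> \<in> {\<tau>. u \<tau> \<noteq> 0}"
    then have nz: "\<theta> \<rho> \<tau> \<noteq> 0" "\<phi> (the_elem (\<tau> - \<rho>)) \<noteq> 0" by (auto simp: u_def cutoff_def)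
    then obtain v where v: "v \<notin> \<rho>" "\<tau> = insert v \<rho>" using coface \<theta>0 by blast
    then have "v \<in> {v. \<phi> v \<noteq> 0}" using nz(2) by (simp add: the_new_vertex)
    then show "\<tau> \<in> (\<lambda>v. insert v \<rho>) ` {v. \<phi> v \<noteq> 0}" using v by blast
  qed
  then have u: "u \<in> fin_cochains S" using uc F by (auto simp: fin_cochains_def intro: finite_surj)
  have "N (\<lambda>\<sigma>. u \<sigma> - \<theta> \<rho> \<sigma>) \<le> ennreal \<epsilon>"
  proof (subst N_le_iff, use \<epsilon> in simp, intro allI impI)
    fix G assume G: "finite G \<and> G \<subseteq> S"
    have "(\<Sum>\<tau>\<in>G. m \<tau> * (cmod (u \<tau> - \<theta> \<rho> \<tau>))\<^sup>2) \<le> (\<Sum>\<tau>\<in>G. if \<tau> \<in> ?C - T0 then m \<tau> else 0)"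
    proof (rule sum_mono)
      fix \<tau> assume "\<tau> \<in> G"
      then have "0 < m \<tau>" using G m_pos by blast
      show "m \<tau> * (cmod (u \<tau> - \<theta> \<rho> \<tau>))\<^sup>2 \<le> (if \<tau> \<in> ?C - T0 then m \<tau> else 0)"
      proof (cases "\<tau> \<in> ?C")
        case True
        then obtain v where v: "v \<notin> \<rho>" "\<tau> = insert v \<rho>" "v \<in> ?L" using coface by blast
        have "u \<tau> - \<theta> \<rho> \<tau> = \<theta> \<rho> \<tau> * of_real (\<phi> v - 1)"
          using v by (simp add: u_def cutoff_def the_new_vertex algebra_simps)
        moreover have "cmod (\<theta> \<rho> \<tau>) = 1" using True \<rho> by (simp add: norm_\<theta>)
        ultimately have eq: "(cmod (u \<tau> - \<theta> \<rho> \<tau>))\<^sup>2 = (\<phi> v - 1)\<^sup>2"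
          by (simp only: norm_mult norm_of_real power2_abs mult_1)
        show ?thesis
        proof (cases "\<tau> \<in> T0")
          case True
          then have "\<phi> v = 1" using \<phi>_T v by (simp add: T_def)
          then show ?thesis using eq True by simp
        next
          case False
          have "\<bar>\<phi> v - 1\<bar> \<le> 1" using \<phi>_range[of v] by (simp add: abs_le_iff)
          then have "(\<phi> v - 1)\<^sup>2 \<le> 1" by (simp add: abs_square_le_1)
          then show ?thesis using eq False True \<open>0 < m \<tau>\<close> by (simp add: mult_left_le)
        qed
      next
        case False
        then show ?thesis using \<theta>0[OF False] \<open>0 < m \<tau>\<close> by (simp add: u_def cutoff_def less_imp_le)
      qed
    qed
    also have "\<dots> = sum m (G \<inter> (?C - T0))"
      using G by (simp add: sum.inter_restrict)
    also have "\<dots> \<le> \<epsilon>" using G by (intro tail) auto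
    finally show "(\<Sum>\<tau>\<in>G. m \<tau> * (cmod (u \<tau> - \<theta> \<rho> \<tau>))\<^sup>2) \<le> \<epsilon>" .
  qed
  moreover have "N (\<delta> (\<lambda>\<sigma>. u \<sigma> - \<theta> \<rho> \<sigma>)) \<le> ennreal \<epsilon>"
  proof (subst N_le_iff, use \<epsilon> in simp, intro allI impI)
    fix G assume G: "finite G \<and> G \<subseteq> S"
    have \<delta>u: "\<delta> (\<lambda>\<sigma>. u \<sigma> - \<theta> \<rho> \<sigma>) = \<delta> u" by (simp add: \<delta>_diff[OF uc \<theta>c] \<delta>_\<theta>[OF \<rho>])
    define G' where "G' = {\<sigma>\<in>G. \<delta> u \<sigma> \<noteq> 0}"
    have "\<forall>\<sigma>\<in>G'. \<exists>p. \<sigma> = insert (fst p) (insert (snd p) \<rho>) \<and> fst p \<noteq> snd p \<and> fst p \<notin> \<rho> \<and> snd p \<notin> \<rho>"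
    proof
      fix \<sigma> assume "\<sigma> \<in> G'"
      then have "\<sigma> \<in> S" "\<delta> (cutoff \<rho> \<phi>) \<sigma> \<noteq> 0" using G by (auto simp: G'_def u_def)
      from \<delta>_cutoff_support[OF \<rho> this]
      obtain v w where "\<sigma> = insert v (insert w \<rho>) \<and> v \<noteq> w \<and> v \<notin> \<rho> \<and> w \<notin> \<rho>" by blast
      then show "\<exists>p. \<sigma> = insert (fst p) (insert (snd p) \<rho>) \<and> fst p \<noteq> snd p \<and> fst p \<notin> \<rho> \<and> snd p \<notin> \<rho>"
        by (intro exI[of _ "(v, w)"]) simp
    qed
    \<comment> \<open>an edge of the link graph for each simplex above \<open>\<rho>\<close>\<close>
    from bchoice[OF this] obtain p where p_edge:
      "\<forall>\<sigma>\<in>G'. \<sigma> = insert (fst (p \<sigma>)) (insert (snd (p \<sigma>)) \<rho>) \<and> fst (p \<sigma>) \<noteq> snd (p \<sigma>) \<and> fst (p \<sigma>) \<notin> \<rho> \<and> snd (p \<sigma>) \<notin> \<rho>"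
      by (rule exE)
    note p = bspec[OF p_edge, THEN conjunct1] bspec[OF p_edge, THEN conjunct2, THEN conjunct1]
      bspec[OF p_edge, THEN conjunct2, THEN conjunct2, THEN conjunct1]
      bspec[OF p_edge, THEN conjunct2, THEN conjunct2, THEN conjunct2]
    have inj: "inj_on p G'" by (rule inj_onI) (metis p(1))
    have G'S: "\<sigma> \<in> S" if "\<sigma> \<in> G'" for \<sigma> using that G by (auto simp: G'_def)
    have in_link: "fst (p \<sigma>) \<in> ?L" "snd (p \<sigma>) \<in> ?L" if \<sigma>: "\<sigma> \<in> G'" for \<sigma>
    proof -
      have "insert (fst (p \<sigma>)) \<rho> \<in> S" by (rule simplex_between[OF \<rho> G'S[OF \<sigma>]]) (use p(1)[OF \<sigma>] in auto)
      then show "fst (p \<sigma>) \<in> ?L" using p(3)[OF \<sigma>] by (simp add: link_iff)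
      have "insert (snd (p \<sigma>)) \<rho> \<in> S" by (rule simplex_between[OF \<rho> G'S[OF \<sigma>]]) (use p(1)[OF \<sigma>] in auto)
      then show "snd (p \<sigma>) \<in> ?L" using p(4)[OF \<sigma>] by (simp add: link_iff)
    qed
    define W where "W = fst ` p ` G' \<union> snd ` p ` G'"
    have "finite G'" using G by (simp add: G'_def)
    then have W: "finite W" "W \<subseteq> ?L" using in_link by (auto simp: W_def)
    define h where "h q = ?b (fst q) (snd q) * (\<phi> (fst q) - \<phi> (snd q))\<^sup>2" for q
    have h0: "0 \<le> h q" for q by (simp add: h_def link_graph_nonneg)
    have "(\<Sum>\<tau>\<in>G. m \<tau> * (cmod (\<delta> u \<tau>))\<^sup>2) = (\<Sum>\<sigma>\<in>G'. m \<sigma> * (cmod (\<delta> u \<sigma>))\<^sup>2)"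
      using G by (intro sum.mono_neutral_right) (auto simp: G'_def)
    also have "\<dots> = (\<Sum>\<sigma>\<in>G'. h (p \<sigma>))"
    proof (rule sum.cong[OF refl])
      fix \<sigma> assume \<sigma>: "\<sigma> \<in> G'"
      have "{fst (p \<sigma>)} \<union> {snd (p \<sigma>)} \<union> \<rho> = \<sigma>" using p(1)[OF \<sigma>] by auto
      then have "?b (fst (p \<sigma>)) (snd (p \<sigma>)) = m \<sigma>"
        using in_link[OF \<sigma>] p(2)[OF \<sigma>] G'S[OF \<sigma>] by (simp add: link_graph_def)
      then show "m \<sigma> * (cmod (\<delta> u \<sigma>))\<^sup>2 = h (p \<sigma>)"
        unfolding h_def u_def using norm_\<delta>_cutoff[OF \<rho> G'S[OF \<sigma>] p(1-4)[OF \<sigma>], of \<phi>] by simp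
    qed
    also have "\<dots> = sum h (p ` G')" by (simp add: sum.reindex[OF inj])
    also have "\<dots> \<le> sum h (W \<times> W)"
    proof (rule sum_mono2)
      show "p ` G' \<subseteq> W \<times> W"
      proof
        fix q assume "q \<in> p ` G'"
        then have "fst q \<in> W" "snd q \<in> W" by (auto simp: W_def)
        then show "q \<in> W \<times> W" by (simp add: mem_Times_iff)
      qed
    qed (use W h0 in auto)
    also have "\<dots> = (\<Sum>v\<in>W. \<Sum>w\<in>W. ?b v w * (\<phi> v - \<phi> w)\<^sup>2)"
      unfolding sum.cartesian_product by (rule sum.cong) (auto simp: h_def)
    also have "\<dots> \<le> \<epsilon>" by (rule energy[OF W])
    finally show "(\<Sum>\<tau>\<in>G. m \<tau> * (cmod (\<delta> (\<lambda>\<sigma>. u \<sigma> - \<theta> \<rho> \<sigma>) \<tau>))\<^sup>2) \<le> \<epsilon>" unfolding \<delta>u .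
  qed
  ultimately show "\<exists>u\<in>fin_cochains S. N (\<lambda>\<sigma>. u \<sigma> - \<theta> \<rho> \<sigma>) \<le> ennreal \<epsilon> \<and> N (\<delta> (\<lambda>\<sigma>. u \<sigma> - \<theta> \<rho> \<sigma>)) \<le> ennreal \<epsilon>"
    using u by blast
qed

end

section \<open>Ideal boundary conditions\<close>

theorem theorem5p2:
  fixes X :: "'v set" and K S :: "'v set set" and m :: "'v set \<Rightarrow> real"
    and \<delta> :: "('v set \<Rightarrow> complex) \<Rightarrow> ('v set \<Rightarrow> complex)"
  assumes "weighted_simplicial_complex X K m"
    and "S = simplices X K m"
    and "coboundary_operator S \<delta>"
  shows "(ideal_boundary_condition S m \<delta> (delta_D S m \<delta>) \<longleftrightarrow>
           (\<forall>\<omega> \<eta>. (\<omega>, \<eta>) \<in> boundary_N S m \<delta> \<longrightarrow> (\<eta>, (\<lambda>_. 0)) \<in> boundary S m \<delta>)) \<and>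
         ((\<forall>\<rho>\<in>S. \<forall>A\<in>graph_components (link X S \<rho>) (link_graph X S m \<rho>). recurrent A (link_graph X S m \<rho>)) \<longrightarrow>
           ideal_boundary_condition S m \<delta> (delta_D S m \<delta>))"
proof -
  interpret weighted_complex X K S m \<delta>
    by (rule weighted_complex.intro[OF assms])
  let ?rec = "\<forall>\<rho>\<in>S. \<forall>A\<in>graph_components (link X S \<rho>) (link_graph X S m \<rho>). recurrent A (link_graph X S m \<rho>)"
  let ?bb = "\<forall>\<omega> \<eta>. (\<omega>, \<eta>) \<in> boundary_N S m \<delta> \<longrightarrow> (\<eta>, (\<lambda>_. 0)) \<in> boundary S m \<delta>"
  have "ideal_boundary_condition S m \<delta> (delta_D S m \<delta>) \<longleftrightarrow> ?bb"
    unfolding ideal_boundary_condition_iff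
  proof
    assume "\<forall>\<tau>\<in>S. approximable (\<theta> \<tau>)"
    then show ?bb by (intro allI impI) (rule boundary_boundary_N_if_approximable)
  next
    assume ?bb
    then show "\<forall>\<tau>\<in>S. approximable (\<theta> \<tau>)"
      by (intro ballI) (rule approximable_if_boundary_boundary_N)
  qed
  moreover have "ideal_boundary_condition S m \<delta> (delta_D S m \<delta>)" if rec: ?rec
    unfolding ideal_boundary_condition_iff
  proof
    fix \<rho> assume \<rho>: "\<rho> \<in> S"
    show "approximable (\<theta> \<rho>)"
      by (rule approximable_\<theta>_if_null_capacity[OF \<rho> link_null_capacity[OF \<rho> _ bspec[OF rec \<rho>]]])
  qed
  ultimately show ?thesis by blast
qed

end
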